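(* Let $H_1$ and $H_2$ be graphs each having at least one edge. Then $c(H_1,H_2)$ equals the minimum of all real $\alpha$ for which there exists an $\alpha$-certificate for $(H_1,H_2)$ (in particular this minimum is attained).
   Context: A graphon is a measurable symmetric function $W:[0,1]^2\to[0,1]$. For a graph $H$ and graphon $W$, $t(H,W):=\int_{[0,1]^{V(H)}}\prod_{uv\in E(H)}W(x_u,x_v)\prod_{v\in V(H)}dx_v$; for a finite graph $G$, $t(H,G)$ is the probability a uniformly random map $V(H)\to V(G)$ is a homomorphism. Let $G_1,G_2,\dots$ be a sequence containing every finite graph exactly once; $\overline{G}$ is the complement of $G$. For $\lambda\in[0,2]$, $c_\lambda(H_1,H_2):=\liminf_{n\to\infty}[\lambda\, t(H_1,G_n)+(2-\lambda)\, t(H_2,\overline{G_n})]$ and $c(H_1,H_2):=\sup_{\lambda\in[0,2]}c_\lambda(H_1,H_2)$. For $\alpha\in\mathbb{R}$, a pair of graphons $(W_1,W_2)$ is an $\alpha$-certificate for $(H_1,H_2)$ if there exists $\lambda\in[0,2]$ such that: (i) $\lambda\, t(H_1,W_1)+(2-\lambda)\, t(H_2,1-W_1)\le\alpha$; (ii) $\lambda\, t(H_1,W_2)+(2-\lambda)\, t(H_2,1-W_2)\le\alpha$; (iii) $t(H_1,W_1)\ge t(H_2,1-W_1)$; (iv) $t(H_1,W_2)\le t(H_2,1-W_2)$. *)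

theory Defs
  imports "HOL-Probability.Probability"
begin

record 'v ugraph =
  verts :: "'v set"
  edges :: "'v set set"

definition all_pairs :: "'v set \<Rightarrow> 'v set set" where
  "all_pairs V = {e. e \<subseteq> V \<and> card e = 2}"

text \<open>The vertex set is required to be nonempty, since otherwise there is no random map into it.\<close>

definition finite_graph :: "'v ugraph \<Rightarrow> bool" where
  "finite_graph G \<longleftrightarrow> finite (verts G) \<and> verts G \<noteq> {} \<and> edges G \<subseteq> all_pairs (verts G)"

definition complement :: "'v ugraph \<Rightarrow> 'v ugraph" where
  "complement G = \<lparr>verts = verts G, edges = all_pairs (verts G) - edges G\<rparr>"

definition isomorphic :: "'v ugraph \<Rightarrow> 'w ugraph \<Rightarrow> bool" where
  "isomorphic G H \<longleftrightarrow>
     (\<exists>f. bij_betw f (verts G) (verts H) \<and>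
          (\<forall>u\<in>verts G. \<forall>v\<in>verts G. {u, v} \<in> edges G \<longleftrightarrow> {f u, f v} \<in> edges H))"

definition is_hom :: "('v \<Rightarrow> 'w) \<Rightarrow> 'v ugraph \<Rightarrow> 'w ugraph \<Rightarrow> bool" where
  "is_hom f H G \<longleftrightarrow>
     f ` verts H \<subseteq> verts G \<and> (\<forall>u v. {u, v} \<in> edges H \<longrightarrow> {f u, f v} \<in> edges G)"

definition hom_density :: "'v ugraph \<Rightarrow> 'w ugraph \<Rightarrow> real" where
  "hom_density H G =
     measure_pmf.prob (pmf_of_set (verts H \<rightarrow>\<^sub>E verts G)) {f. is_hom f H G}"

text \<open>Graphs are enumerated up to isomorphism. Every finite graph has an isomorphic copy whose
  vertices are natural numbers, so it suffices to let the members of the sequence be of this kind.\<close>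

definition enumerates_graphs :: "(nat \<Rightarrow> nat ugraph) \<Rightarrow> bool" where
  "enumerates_graphs G \<longleftrightarrow>
     (\<forall>n. finite_graph (G n)) \<and>
     (\<forall>F :: nat ugraph. finite_graph F \<longrightarrow> (\<exists>!n. isomorphic F (G n)))"

text \<open>Only the values on the unit square matter; nothing is required elsewhere.
  Measurable means Lebesgue measurable.\<close>

definition graphon :: "(real \<times> real \<Rightarrow> real) \<Rightarrow> bool" where
  "graphon W \<longleftrightarrow>
     W \<in> borel_measurable (lebesgue_on ({0..1} \<times> {0..1})) \<and>
     (\<forall>x\<in>{0..1}. \<forall>y\<in>{0..1}. W (x, y) = W (y, x) \<and> 0 \<le> W (x, y) \<and> W (x, y) \<le> 1)"

text \<open>The value \<open>W (x u, x v)\<close> for an unordered pair \<open>e = {u, v}\<close>; it is well-defined when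
  \<open>W\<close> is symmetric.\<close>

definition edge_weight :: "(real \<times> real \<Rightarrow> real) \<Rightarrow> ('v \<Rightarrow> real) \<Rightarrow> 'v set \<Rightarrow> real" where
  "edge_weight W x e = (THE w. \<exists>u v. e = {u, v} \<and> w = W (x u, x v))"

lemma edge_weight_doubleton:
  assumes "W (x u, x v) = W (x v, x u)"
  shows "edge_weight W x {u, v} = W (x u, x v)"
  unfolding edge_weight_def
  by (rule the_equality) (use assms in \<open>auto simp: doubleton_eq_iff\<close>)

text \<open>The completed product measure is Lebesgue measure on the cube \<open>[0,1]\<^sup>V\<close>. The completion is
  needed because \<open>W\<close> is only assumed to be Lebesgue measurable.\<close>

definition unit_cube :: "'v set \<Rightarrow> ('v \<Rightarrow> real) measure" where
  "unit_cube V = completion (\<Pi>\<^sub>M v\<in>V. restrict_space lborel {0..1})"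

definition graphon_density :: "'v ugraph \<Rightarrow> (real \<times> real \<Rightarrow> real) \<Rightarrow> real" where
  "graphon_density H W = (\<integral>x. (\<Prod>e\<in>edges H. edge_weight W x e) \<partial>unit_cube (verts H))"

text \<open>The limit inferior and the supremum are taken in the extended reals, where both always exist.\<close>

definition c_lambda ::
  "(nat \<Rightarrow> nat ugraph) \<Rightarrow> real \<Rightarrow> 'a ugraph \<Rightarrow> 'b ugraph \<Rightarrow> ereal" where
  "c_lambda G l H1 H2 =
     liminf (\<lambda>n. ereal (l * hom_density H1 (G n) + (2 - l) * hom_density H2 (complement (G n))))"

definition c_const :: "(nat \<Rightarrow> nat ugraph) \<Rightarrow> 'a ugraph \<Rightarrow> 'b ugraph \<Rightarrow> ereal" where
  "c_const G H1 H2 = (SUP l\<in>{0..2}. c_lambda G l H1 H2)"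

definition certificate ::
  "real \<Rightarrow> 'a ugraph \<Rightarrow> 'b ugraph \<Rightarrow> (real \<times> real \<Rightarrow> real) \<Rightarrow> (real \<times> real \<Rightarrow> real) \<Rightarrow> bool" where
  "certificate \<alpha> H1 H2 W1 W2 \<longleftrightarrow>
     graphon W1 \<and> graphon W2 \<and>
     (\<exists>l\<in>{0..2}.
        l * graphon_density H1 W1 + (2 - l) * graphon_density H2 (\<lambda>p. 1 - W1 p) \<le> \<alpha> \<and>
        l * graphon_density H1 W2 + (2 - l) * graphon_density H2 (\<lambda>p. 1 - W2 p) \<le> \<alpha> \<and>
        graphon_density H1 W1 \<ge> graphon_density H2 (\<lambda>p. 1 - W1 p) \<and>
        graphon_density H1 W2 \<le> graphon_density H2 (\<lambda>p. 1 - W2 p))"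

end

theory Submission
  imports Defs "HOL-Library.Diagonal_Subsequence"
begin

text \<open>
  Write \<open>p\<^sub>n\<close> for the pair of densities of the \<open>n\<close>-th graph and let \<open>Q\<close> be the compact set of cluster
  points of \<open>p\<close>. Then \<open>c_lambda\<close> at \<open>l\<close> is the minimum over \<open>Q\<close> of the linear functional
  \<open>l * x + (2 - l) * y\<close>, a continuous function of \<open>l\<close>. At a maximiser \<open>l\<^sub>0\<close>, minimisers for parameters
  just below and just above \<open>l\<^sub>0\<close> accumulate at minimisers for \<open>l\<^sub>0\<close> on either side of the diagonal;
  at an end of the interval a constant graphon takes over. Conversely, for a certificate with
  parameter \<open>l\<close>, moving \<open>l\<close> in either direction decreases the functional at one of its two points.

  Points of \<open>Q\<close> are densities of graphons by compactness of the graphon space: weak regularity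
  partitions with classes coded by base-4 digits converge along a subsequence to nested interval
  partitions, whose step graphons form a bounded martingale. The energy increments control both the
  cut distance of a graph to its step approximation and the \<open>L\<^sup>2\<close> distances within the martingale, so
  the densities of its limit are the limits of the densities. In the other direction, a first moment
  computation for random graphs sampled from a graphon bounds \<open>c_lambda\<close> by the value at that graphon.
\<close>

section \<open>Weighted homomorphism densities and the counting lemma\<close>

text \<open>Two obstacles shape the development. Partitions of different graphs have to be
  comparable, so every level is refined, whether or not its partition is already good: level
  \<open>m\<close> then has 4^m classes for all graphs, and a limit of partitions is a countable
  family of numbers. The price is that no single level has an a priori error bound. The error at
  level \<open>m\<close> is the energy increment there, which tends to 0 because the energy is
  monotone and at most 1. The other obstacle is the diagonal: \<open>1 - W\<close> stands for a
  graph with all loops, a complement has none, and a random map may fail to be injective. Each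
  effect costs a multiple of 1/n, so the orders of the graphs must tend to infinity, which comes
  from uniqueness in the enumeration. Weights in place of uniform measures let graphs, their
  quotients and step graphons share one counting lemma. To bound a limit inferior from above, one
  good graph of each large order is enough, so averages do and no concentration is required. That
  both graphs have edges enters at the ends of the parameter interval, where a constant graphon must
  have value 0.\<close>

definition wsum :: "'a set \<Rightarrow> 'w set \<Rightarrow> ('w \<Rightarrow> real) \<Rightarrow> (('a \<Rightarrow> 'w) \<Rightarrow> real) \<Rightarrow> real" where
  "wsum A V p \<Psi> = (\<Sum>x\<in>A \<rightarrow>\<^sub>E V. (\<Prod>v\<in>A. p (x v)) * \<Psi> x)"

definition edge_prod :: "('a \<times> 'a) set \<Rightarrow> ('w \<Rightarrow> 'w \<Rightarrow> real) \<Rightarrow> ('a \<Rightarrow> 'w) \<Rightarrow> real" where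
  "edge_prod D f x = (\<Prod>(u, v)\<in>D. f (x u) (x v))"

text \<open>For weights of total 1 this is a homomorphism density, the expectation of the edge
  product at independent random vertices. Edges are ordered pairs, so the product makes sense
  without symmetry of \<open>f\<close>.\<close>

definition wdens ::
  "'a set \<Rightarrow> ('a \<times> 'a) set \<Rightarrow> 'w set \<Rightarrow> ('w \<Rightarrow> real) \<Rightarrow> ('w \<Rightarrow> 'w \<Rightarrow> real) \<Rightarrow> real" where
  "wdens A D V p f = wsum A V p (edge_prod D f)"

lemma wsum_insert:
  assumes "finite A" "u \<notin> A"
  shows "wsum (insert u A) V p \<Psi> = (\<Sum>s\<in>V. p s * wsum A V p (\<lambda>z. \<Psi> (z(u := s))))"
proof -
  have upd: "(\<Prod>v\<in>A. p ((z(u := s)) v)) = (\<Prod>v\<in>A. p (z v))" for z s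
    using assms by (intro prod.cong) auto
  have "wsum (insert u A) V p \<Psi> =
      (\<Sum>(s, z)\<in>V \<times> (A \<rightarrow>\<^sub>E V). (\<Prod>v\<in>insert u A. p ((z(u := s)) v)) * \<Psi> (z(u := s)))"
    unfolding wsum_def PiE_insert_eq
    by (subst sum.reindex [OF inj_combinator [OF assms(2)]]) (simp add: case_prod_unfold)
  also have "\<dots> = (\<Sum>s\<in>V. \<Sum>z\<in>A \<rightarrow>\<^sub>E V. p s * ((\<Prod>v\<in>A. p (z v)) * \<Psi> (z(u := s))))"
    using assms by (subst sum.cartesian_product [symmetric]) (simp add: upd mult.assoc del: fun_upd_apply add: fun_upd_same)
  finally show ?thesis by (simp add: wsum_def sum_distrib_left)
qed

lemma wsum_cong:
  assumes "\<And>x. x \<in> A \<rightarrow>\<^sub>E V \<Longrightarrow> \<Psi> x = \<Phi> x"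
  shows "wsum A V p \<Psi> = wsum A V p \<Phi>"
  unfolding wsum_def using assms by (intro sum.cong) auto

lemma wdens_cong:
  assumes "D \<subseteq> A \<times> A" "\<And>s t. s \<in> V \<Longrightarrow> t \<in> V \<Longrightarrow> f s t = g s t"
  shows "wdens A D V p f = wdens A D V p g"
  unfolding wdens_def edge_prod_def
  by (intro wsum_cong prod.cong) (use assms in \<open>auto simp: PiE_iff\<close>)

lemma wsum_diff: "wsum A V p (\<lambda>x. \<Psi> x - \<Phi> x) = wsum A V p \<Psi> - wsum A V p \<Phi>"
  by (simp add: wsum_def algebra_simps sum_subtractf)

text \<open>A bilinear form on a cube is extremal at vertices: for fixed \<open>b\<close> replace
  \<open>a\<close> by the indicator of the rows with positive coefficient, then treat
  \<open>b\<close> alike. Running this for \<open>h\<close> and for \<open>- h\<close> gives the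
  absolute value.\<close>

lemma bilinear_bound:
  fixes h :: "'w \<Rightarrow> 'w \<Rightarrow> real"
  assumes V: "finite V"
    and cut: "\<And>S T. S \<subseteq> V \<Longrightarrow> T \<subseteq> V \<Longrightarrow> \<bar>\<Sum>s\<in>S. \<Sum>t\<in>T. h s t\<bar> \<le> \<delta>"
    and a: "\<And>s. s \<in> V \<Longrightarrow> 0 \<le> a s \<and> a s \<le> 1"
    and b: "\<And>s. s \<in> V \<Longrightarrow> 0 \<le> b s \<and> b s \<le> 1"
  shows "\<bar>\<Sum>s\<in>V. \<Sum>t\<in>V. h s t * a s * b t\<bar> \<le> \<delta>"
proof -
  have linear: "(\<Sum>s\<in>V. r s * a s) \<le> (\<Sum>s\<in>{s\<in>V. r s > 0}. r s)"
    if a: "\<And>s. s \<in> V \<Longrightarrow> 0 \<le> a s \<and> a s \<le> 1" for a r :: "'w \<Rightarrow> real"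
  proof -
    have "(\<Sum>s\<in>V. r s * a s) \<le> (\<Sum>s\<in>V. if r s > 0 then r s else 0)"
      using a by (intro sum_mono) (auto simp: mult_left_le mult_le_0_iff not_less)
    also have "\<dots> = (\<Sum>s\<in>{s\<in>V. r s > 0}. r s)"
      using V by (simp add: sum.inter_filter)
    finally show ?thesis .
  qed
  have upper: "(\<Sum>s\<in>V. \<Sum>t\<in>V. g s t * a s * b t) \<le> \<delta>"
    if g: "\<And>S T. S \<subseteq> V \<Longrightarrow> T \<subseteq> V \<Longrightarrow> (\<Sum>s\<in>S. \<Sum>t\<in>T. g s t) \<le> \<delta>" for g
  proof -
    define r where "r s = (\<Sum>t\<in>V. g s t * b t)" for s
    define S where "S = {s\<in>V. r s > 0}"
    define q where "q t = (\<Sum>s\<in>S. g s t)" for t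
    have "(\<Sum>s\<in>V. \<Sum>t\<in>V. g s t * a s * b t) = (\<Sum>s\<in>V. r s * a s)"
      by (simp add: r_def sum_distrib_left sum_distrib_right mult_ac)
    also have "\<dots> \<le> (\<Sum>s\<in>S. r s)" unfolding S_def by (rule linear [OF a])
    also have "\<dots> = (\<Sum>t\<in>V. q t * b t)"
      unfolding r_def q_def sum_distrib_right by (rule sum.swap)
    also have "\<dots> \<le> (\<Sum>t\<in>{t\<in>V. q t > 0}. q t)" by (rule linear [OF b])
    also have "\<dots> = (\<Sum>s\<in>S. \<Sum>t\<in>{t\<in>V. q t > 0}. g s t)"
      by (simp add: q_def) (rule sum.swap)
    also have "\<dots> \<le> \<delta>" by (rule g) (auto simp: S_def)
    finally show ?thesis .
  qed
  have 1: "(\<Sum>s\<in>V. \<Sum>t\<in>V. h s t * a s * b t) \<le> \<delta>"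
    by (rule upper) (use cut in \<open>fastforce simp: abs_le_iff\<close>)
  have 2: "(\<Sum>s\<in>V. \<Sum>t\<in>V. - h s t * a s * b t) \<le> \<delta>"
    by (rule upper) (use cut in \<open>fastforce simp: abs_le_iff sum_negf\<close>)
  show ?thesis using 1 2 by (simp add: sum_negf abs_le_iff)
qed

locale weighted_set =
  fixes V :: "'w set" and p :: "'w \<Rightarrow> real"
  assumes fin: "finite V" and nonneg: "\<And>v. v \<in> V \<Longrightarrow> 0 \<le> p v" and total: "(\<Sum>v\<in>V. p v) = 1"
begin

lemma wsum_const: "finite A \<Longrightarrow> wsum A V p (\<lambda>_. c) = c"
  using prod_sum_PiE [of A "\<lambda>_. V" "\<lambda>_. p"] fin total
  by (simp add: wsum_def sum_distrib_right [symmetric])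

lemma wsum_abs_le:
  assumes "finite A" "\<And>x. x \<in> A \<rightarrow>\<^sub>E V \<Longrightarrow> \<bar>\<Psi> x\<bar> \<le> c"
  shows "\<bar>wsum A V p \<Psi>\<bar> \<le> c"
proof -
  have "\<bar>wsum A V p \<Psi>\<bar> \<le> wsum A V p (\<lambda>_. c)"
    unfolding wsum_def using assms
    by (intro order_trans [OF sum_abs] sum_mono)
       (auto simp: abs_mult abs_prod nonneg PiE_iff intro!: mult_mono prod_nonneg prod_mono)
  then show ?thesis using assms(1) by (simp add: wsum_const)
qed

text \<open>No factor of the product other than \<open>k\<close> depends on both \<open>x u\<close> and \<open>x v\<close>, so with the
  remaining coordinates fixed the sum is bilinear in a function of \<open>x u\<close> and one of \<open>x v\<close>.\<close>

lemma single_edge_bound: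
  assumes A: "finite A" and uv: "u \<in> A" "v \<in> A" "u \<noteq> v"
    and D: "finite D" "D \<subseteq> A \<times> A" "(u, v) \<notin> D" "(v, u) \<notin> D"
    and h: "\<And>q s t. q \<in> D \<Longrightarrow> s \<in> V \<Longrightarrow> t \<in> V \<Longrightarrow> 0 \<le> h q s t \<and> h q s t \<le> 1"
    and cut: "\<And>S T. S \<subseteq> V \<Longrightarrow> T \<subseteq> V \<Longrightarrow> \<bar>\<Sum>s\<in>S. \<Sum>t\<in>T. p s * p t * k s t\<bar> \<le> \<delta>"
  shows "\<bar>wsum A V p (\<lambda>x. k (x u) (x v) * (\<Prod>q\<in>D. h q (x (fst q)) (x (snd q))))\<bar> \<le> \<delta>"
    (is "\<bar>wsum A V p ?\<Psi>\<bar> \<le> \<delta>")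
proof -
  define B where "B = A - {u, v}"
  have AB: "A = insert v (insert u B)" "finite B" "u \<notin> B" "v \<notin> insert u B"
    using A uv by (auto simp: B_def)
  define Du where "Du = {q\<in>D. fst q = u \<or> snd q = u}"
  \<comment> \<open>A placeholder for a coordinate that is never read: with both orientations of the
    pair excluded from \<open>D\<close>, the factors in \<open>Du\<close> ignore \<open>v\<close>
    and the others ignore \<open>u\<close>.\<close>
  define w where "w = (SOME s. s \<in> V)"
  have "V \<noteq> {}" using total by auto
  then have w: "w \<in> V" by (simp add: w_def some_in_eq)
  define a where "a z s = (\<Prod>q\<in>Du. h q ((z(u := s, v := w)) (fst q)) ((z(u := s, v := w)) (snd q)))" for z s
  define b where "b z t = (\<Prod>q\<in>D - Du. h q ((z(u := w, v := t)) (fst q)) ((z(u := w, v := t)) (snd q)))" for z t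
  have split: "?\<Psi> (z(u := s, v := t)) = k s t * a z s * b z t" for z s t
  proof -
    let ?x = "z(u := s, v := t)"
    have "(\<Prod>q\<in>D. h q (?x (fst q)) (?x (snd q))) =
        (\<Prod>q\<in>D - Du. h q (?x (fst q)) (?x (snd q))) * (\<Prod>q\<in>Du. h q (?x (fst q)) (?x (snd q)))"
      using D by (intro prod.subset_diff) (auto simp: Du_def)
    also have "(\<Prod>q\<in>Du. h q (?x (fst q)) (?x (snd q))) = a z s"
      unfolding a_def using D uv by (intro prod.cong refl) (auto simp: Du_def)
    also have "(\<Prod>q\<in>D - Du. h q (?x (fst q)) (?x (snd q))) = b z t"
      unfolding b_def by (intro prod.cong refl) (auto simp: Du_def)
    finally show ?thesis using uv by (simp del: fun_upd_apply add: fun_upd_same fun_upd_other)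
  qed
  have inner: "\<bar>\<Sum>s\<in>V. \<Sum>t\<in>V. (p s * p t * k s t) * a z s * b z t\<bar> \<le> \<delta>" if z: "z \<in> B \<rightarrow>\<^sub>E V" for z
  proof (rule bilinear_bound [OF fin])
    have upd: "(z(u := s, v := t)) i \<in> V" if "s \<in> V" "t \<in> V" "i \<in> A" for s t i
      using z that by (auto simp: B_def PiE_iff)
    show "0 \<le> a z s \<and> a z s \<le> 1" if "s \<in> V" for s
      unfolding a_def using that w D(2)
      by (intro conjI prod_nonneg prod_le_1 ballI) (auto intro!: h [THEN conjunct1] h [THEN conjunct2] upd simp: Du_def simp del: fun_upd_apply)
    show "0 \<le> b z s \<and> b z s \<le> 1" if "s \<in> V" for s
      unfolding b_def using that w D(2)
      by (intro conjI prod_nonneg prod_le_1 ballI) (auto intro!: h [THEN conjunct1] h [THEN conjunct2] upd simp: Du_def simp del: fun_upd_apply)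
  qed (rule cut)
  have "wsum A V p ?\<Psi> = (\<Sum>t\<in>V. \<Sum>s\<in>V. p t * (p s * wsum B V p (\<lambda>z. ?\<Psi> (z(u := s, v := t)))))"
    unfolding AB(1) using AB by (simp add: wsum_insert sum_distrib_left)
  also have "\<dots> = wsum B V p (\<lambda>z. \<Sum>s\<in>V. \<Sum>t\<in>V. (p s * p t * k s t) * a z s * b z t)"
    unfolding split wsum_def sum_distrib_left
    by (subst sum.swap, subst (3) sum.swap, subst (2) sum.swap, subst sum.swap, subst (2) sum.swap) (simp add: algebra_simps)
  finally show ?thesis using wsum_abs_le [OF AB(2) inner] by simp
qed

text \<open>The counting lemma: replace \<open>f\<close> by \<open>g\<close> in one edge at a time.\<close>

lemma wdens_diff_le_cut:
  assumes A: "finite A" and D: "D \<subseteq> A \<times> A" "asym D"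
    and f: "\<And>s t. s \<in> V \<Longrightarrow> t \<in> V \<Longrightarrow> 0 \<le> f s t \<and> f s t \<le> 1"
    and g: "\<And>s t. s \<in> V \<Longrightarrow> t \<in> V \<Longrightarrow> 0 \<le> g s t \<and> g s t \<le> 1"
    and cut: "\<And>S T. S \<subseteq> V \<Longrightarrow> T \<subseteq> V \<Longrightarrow> \<bar>\<Sum>s\<in>S. \<Sum>t\<in>T. p s * p t * (f s t - g s t)\<bar> \<le> \<delta>"
  shows "\<bar>wdens A D V p f - wdens A D V p g\<bar> \<le> real (card D) * \<delta>"
proof -
  have finD: "finite D" using A D(1) by (meson finite_SigmaI finite_subset)
  define h where "h E q = (if q \<in> E then f else g)" for E :: "('a \<times> 'a) set" and q
  define \<Psi> where "\<Psi> E x = (\<Prod>q\<in>D. h E q (x (fst q)) (x (snd q)))" for E and x :: "'a \<Rightarrow> 'w"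
  have "\<bar>wsum A V p (\<Psi> E) - wsum A V p (\<Psi> {})\<bar> \<le> real (card E) * \<delta>" if "finite E" "E \<subseteq> D" for E
    using that
  proof (induction E)
    case (insert e E)
    obtain u v where e: "e = (u, v)" by force
    have uv: "(u, v) \<in> D" "(v, u) \<notin> D" using insert.prems e D(2) by (auto dest: asymD)
    then have "u \<noteq> v" by auto
    have diff: "\<Psi> (insert e E) x - \<Psi> E x =
        (f (x u) (x v) - g (x u) (x v)) * (\<Prod>q\<in>D - {e}. h E q (x (fst q)) (x (snd q)))" for x
    proof -
      have "(\<Prod>q\<in>D - {e}. h (insert e E) q (x (fst q)) (x (snd q))) =
          (\<Prod>q\<in>D - {e}. h E q (x (fst q)) (x (snd q)))"
        by (intro prod.cong) (auto simp: h_def)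
      moreover have "e \<in> D" using uv e by simp
      ultimately show ?thesis
        unfolding \<Psi>_def using insert.hyps
        by (simp add: prod.remove [OF finD, of e]) (simp add: h_def e algebra_simps)
    qed
    have "\<bar>wsum A V p (\<Psi> (insert e E)) - wsum A V p (\<Psi> E)\<bar> \<le> \<delta>"
      unfolding wsum_diff [symmetric] diff
      by (rule single_edge_bound)
         (use A D finD uv e \<open>u \<noteq> v\<close> f g cut in \<open>auto simp: h_def\<close>)
    then show ?case using insert by (simp add: algebra_simps)
  qed (simp)
  from this [OF finD order_refl] show ?thesis
    by (simp add: wdens_def edge_prod_def [abs_def] \<Psi>_def [abs_def] h_def case_prod_unfold cong: prod.cong)
qed

end

section \<open>Weak regularity\<close>

definition cls_wt :: "'w set \<Rightarrow> ('w \<Rightarrow> real) \<Rightarrow> ('w \<Rightarrow> nat) \<Rightarrow> nat \<Rightarrow> real" where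
  "cls_wt V p c i = (\<Sum>u\<in>V. of_bool (c u = i) * p u)"

definition cls_mass ::
  "'w set \<Rightarrow> ('w \<Rightarrow> real) \<Rightarrow> ('w \<Rightarrow> 'w \<Rightarrow> real) \<Rightarrow> ('w \<Rightarrow> nat) \<Rightarrow> nat \<Rightarrow> nat \<Rightarrow> real" where
  "cls_mass V p f c i j = (\<Sum>u\<in>V. \<Sum>v\<in>V. of_bool (c u = i) * of_bool (c v = j) * (p u * p v * f u v))"

text \<open>A class of weight 0 receives density 0 through division by zero. The bounds survive, and
  so does the product formula \<open>cls_mass_eq\<close>, because the mass vanishes as well.\<close>

definition cls_dens ::
  "'w set \<Rightarrow> ('w \<Rightarrow> real) \<Rightarrow> ('w \<Rightarrow> 'w \<Rightarrow> real) \<Rightarrow> ('w \<Rightarrow> nat) \<Rightarrow> nat \<Rightarrow> nat \<Rightarrow> real" where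
  "cls_dens V p f c i j = cls_mass V p f c i j / (cls_wt V p c i * cls_wt V p c j)"

text \<open>The squared L2 norm of the step function with block values \<open>d\<close>.\<close>

definition energy :: "nat \<Rightarrow> (nat \<Rightarrow> real) \<Rightarrow> (nat \<Rightarrow> nat \<Rightarrow> real) \<Rightarrow> real" where
  "energy K w d = (\<Sum>i<K. \<Sum>j<K. w i * w j * (d i j)\<^sup>2)"

lemma sum_of_bool_class:
  fixes h :: "nat \<Rightarrow> real"
  assumes "k < K"
  shows "(\<Sum>j<K. of_bool (k = j) * h j) = h k"
proof -
  have "(\<Sum>j<K. of_bool (k = j) * h j) = (\<Sum>j<K. if k = j then h j else 0)"
    by (intro sum.cong) auto
  then show ?thesis using assms by simp
qed

lemma sum_by_class:
  fixes g :: "nat \<Rightarrow> real"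
  assumes "finite V" "\<And>u. u \<in> V \<Longrightarrow> c u < K"
  shows "(\<Sum>u\<in>V. p u * g (c u)) = (\<Sum>i<K. cls_wt V p c i * g i)"
proof -
  have "p u * g (c u) = (\<Sum>i<K. of_bool (c u = i) * p u * g i)" if "u \<in> V" for u
    using sum_of_bool_class [OF assms(2) [OF that], of "\<lambda>i. p u * g i"] by (simp add: mult.assoc)
  then have "(\<Sum>u\<in>V. p u * g (c u)) = (\<Sum>u\<in>V. \<Sum>i<K. of_bool (c u = i) * p u * g i)"
    by simp
  also have "\<dots> = (\<Sum>i<K. \<Sum>u\<in>V. of_bool (c u = i) * p u * g i)" by (rule sum.swap)
  finally show ?thesis by (simp add: cls_wt_def sum_distrib_right)
qed

text \<open>Exactly one labelling \<open>y\<close> agrees with the classes of \<open>x\<close>. The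
  expansion leaves \<open>x\<close> only in products of functions of one coordinate, so that sums
  and integrals over \<open>x\<close> factorise.\<close>

lemma edge_prod_expand:
  fixes d :: "'v \<Rightarrow> 'v \<Rightarrow> real"
  assumes A: "finite A" and D: "D \<subseteq> A \<times> A" and K: "finite K" "\<And>v. v \<in> A \<Longrightarrow> c (x v) \<in> K"
  shows "edge_prod D (\<lambda>s t. d (c s) (c t)) x =
    (\<Sum>y\<in>A \<rightarrow>\<^sub>E K. (\<Prod>v\<in>A. of_bool (c (x v) = y v)) * edge_prod D d y)"
proof -
  define y0 where "y0 = (\<lambda>v\<in>A. c (x v))"
  have y0: "y0 \<in> A \<rightarrow>\<^sub>E K" using K by (auto simp: y0_def)
  have "(\<Sum>y\<in>A \<rightarrow>\<^sub>E K. (\<Prod>v\<in>A. of_bool (c (x v) = y v)) * edge_prod D d y) =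
      (\<Sum>y\<in>A \<rightarrow>\<^sub>E K. if y = y0 then edge_prod D d y else 0)"
  proof (intro sum.cong refl)
    fix y assume y: "y \<in> A \<rightarrow>\<^sub>E K"
    show "(\<Prod>v\<in>A. of_bool (c (x v) = y v)) * edge_prod D d y = (if y = y0 then edge_prod D d y else 0)"
    proof (cases "y = y0")
      case False
      then obtain v where v: "v \<in> A" "y v \<noteq> c (x v)"
        using y y0 by (auto simp: y0_def PiE_def extensional_def fun_eq_iff split: if_splits)
      then show ?thesis using A False by (auto intro!: prod_zero)
    qed (auto simp: y0_def)
  qed
  also have "\<dots> = edge_prod D d y0" using y0 A K by (simp add: finite_PiE)
  also have "\<dots> = edge_prod D (\<lambda>s t. d (c s) (c t)) x"
    unfolding edge_prod_def y0_def using D by (intro prod.cong) auto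
  finally show ?thesis ..
qed

text \<open>The integrand sees a vertex only through its class, and \<open>q\<close> is the law of
  that class. With a bijection as \<open>c\<close> the same statement yields invariance under
  isomorphism.\<close>

lemma wdens_pushforward:
  fixes d :: "'v \<Rightarrow> 'v \<Rightarrow> real"
  assumes A: "finite A" and D: "D \<subseteq> A \<times> A" and V: "finite V" and K: "finite K" "c ` V \<subseteq> K"
    and q: "\<And>i. i \<in> K \<Longrightarrow> q i = (\<Sum>u\<in>V. of_bool (c u = i) * p u)"
  shows "wdens A D V p (\<lambda>s t. d (c s) (c t)) = wdens A D K q d"
proof -
  have "wdens A D V p (\<lambda>s t. d (c s) (c t)) =
      (\<Sum>x\<in>A \<rightarrow>\<^sub>E V. (\<Prod>v\<in>A. p (x v)) * (\<Sum>y\<in>A \<rightarrow>\<^sub>E K. (\<Prod>v\<in>A. of_bool (c (x v) = y v)) * edge_prod D d y))"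
    unfolding wdens_def wsum_def
    by (intro sum.cong refl arg_cong2 [of _ _ _ _ "(*)"] edge_prod_expand A D K) (use K in auto)
  also have "\<dots> = (\<Sum>y\<in>A \<rightarrow>\<^sub>E K. (\<Sum>x\<in>A \<rightarrow>\<^sub>E V. \<Prod>v\<in>A. of_bool (c (x v) = y v) * p (x v)) * edge_prod D d y)"
    unfolding sum_distrib_left sum_distrib_right
    by (subst sum.swap) (simp add: prod.distrib mult_ac)
  also have "\<dots> = wdens A D K q d"
    unfolding wdens_def wsum_def
  proof (intro sum.cong refl arg_cong2 [of _ _ _ _ "(*)"])
    fix y assume y: "y \<in> A \<rightarrow>\<^sub>E K"
    show "(\<Sum>x\<in>A \<rightarrow>\<^sub>E V. \<Prod>v\<in>A. of_bool (c (x v) = y v) * p (x v)) = (\<Prod>v\<in>A. q (y v))"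
      using prod_sum_PiE [of A "\<lambda>_. V" "\<lambda>v s. of_bool (c s = y v) * p s"] A V y
      by (simp add: q PiE_iff)
  qed
  finally show ?thesis .
qed

context weighted_set
begin

lemma cls_wt_nonneg: "0 \<le> cls_wt V p c i"
  unfolding cls_wt_def by (intro sum_nonneg) (auto simp: nonneg)

lemma cls_wt_le_1: "cls_wt V p c i \<le> 1"
proof -
  have "cls_wt V p c i \<le> (\<Sum>u\<in>V. p u)"
    unfolding cls_wt_def by (intro sum_mono) (auto simp: nonneg)
  then show ?thesis by (simp add: total)
qed

lemma cls_wt_total:
  assumes "\<And>u. u \<in> V \<Longrightarrow> c u < K"
  shows "(\<Sum>i<K. cls_wt V p c i) = 1"
  using sum_by_class [of V c K p "\<lambda>_. 1", OF fin assms] total by simp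

lemma cls_mass_le:
  assumes f: "\<And>s t. s \<in> V \<Longrightarrow> t \<in> V \<Longrightarrow> 0 \<le> f s t \<and> f s t \<le> 1"
  shows "0 \<le> cls_mass V p f c i j" "cls_mass V p f c i j \<le> cls_wt V p c i * cls_wt V p c j"
proof -
  show "0 \<le> cls_mass V p f c i j"
    unfolding cls_mass_def using f by (intro sum_nonneg) (auto simp: nonneg)
  have "cls_mass V p f c i j \<le> (\<Sum>u\<in>V. \<Sum>v\<in>V. of_bool (c u = i) * of_bool (c v = j) * (p u * p v))"
    unfolding cls_mass_def using f
    by (intro sum_mono mult_left_mono) (auto simp: nonneg mult_left_le)
  also have "\<dots> = cls_wt V p c i * cls_wt V p c j"
    by (simp add: cls_wt_def sum_product mult_ac)
  finally show "cls_mass V p f c i j \<le> cls_wt V p c i * cls_wt V p c j" .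
qed

lemma cls_dens_bounds:
  assumes f: "\<And>s t. s \<in> V \<Longrightarrow> t \<in> V \<Longrightarrow> 0 \<le> f s t \<and> f s t \<le> 1"
  shows "0 \<le> cls_dens V p f c i j \<and> cls_dens V p f c i j \<le> 1"
  using cls_mass_le [of f c i j, OF f] cls_wt_nonneg [of c]
  by (auto simp: cls_dens_def divide_le_eq_1 less_le)

lemma cls_mass_eq:
  assumes f: "\<And>s t. s \<in> V \<Longrightarrow> t \<in> V \<Longrightarrow> 0 \<le> f s t \<and> f s t \<le> 1"
  shows "cls_mass V p f c i j = cls_wt V p c i * cls_wt V p c j * cls_dens V p f c i j"
  using cls_mass_le [of f c i j, OF f] by (auto simp: cls_dens_def)

lemma cls_dens_sym:
  assumes "\<And>s t. s \<in> V \<Longrightarrow> t \<in> V \<Longrightarrow> f s t = f t s"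
  shows "cls_dens V p f c i j = cls_dens V p f c j i"
proof -
  have "cls_mass V p f c i j = cls_mass V p f c j i"
    unfolding cls_mass_def by (subst sum.swap) (use assms in \<open>simp add: mult_ac\<close>)
  then show ?thesis by (simp add: cls_dens_def mult.commute)
qed

lemma sum_pair_by_class:
  fixes g :: "nat \<Rightarrow> nat \<Rightarrow> real"
  assumes c: "\<And>u. u \<in> V \<Longrightarrow> c u < K"
  shows "(\<Sum>u\<in>V. \<Sum>v\<in>V. p u * p v * g (c u) (c v)) = (\<Sum>i<K. \<Sum>j<K. cls_wt V p c i * cls_wt V p c j * g i j)"
proof -
  have "(\<Sum>u\<in>V. \<Sum>v\<in>V. p u * p v * g (c u) (c v)) = (\<Sum>u\<in>V. p u * (\<Sum>v\<in>V. p v * g (c u) (c v)))"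
    by (simp add: sum_distrib_left mult_ac)
  also have "\<dots> = (\<Sum>u\<in>V. p u * (\<Sum>j<K. cls_wt V p c j * g (c u) j))"
    using sum_by_class [of V c K p, OF fin c] c by simp
  also have "\<dots> = (\<Sum>i<K. cls_wt V p c i * (\<Sum>j<K. cls_wt V p c j * g i j))"
    by (rule sum_by_class [of V c K p, OF fin c])
  finally show ?thesis by (simp add: sum_distrib_left mult_ac)
qed

lemma sum_mass_by_class:
  fixes g :: "nat \<Rightarrow> nat \<Rightarrow> real"
  assumes c: "\<And>u. u \<in> V \<Longrightarrow> c u < K"
  shows "(\<Sum>u\<in>V. \<Sum>v\<in>V. p u * p v * f u v * g (c u) (c v)) = (\<Sum>i<K. \<Sum>j<K. cls_mass V p f c i j * g i j)"
proof -
  have "p u * p v * f u v * g (c u) (c v) =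
      (\<Sum>i<K. \<Sum>j<K. of_bool (c u = i) * of_bool (c v = j) * (p u * p v * f u v) * g i j)"
    if "u \<in> V" "v \<in> V" for u v
  proof -
    have "(\<Sum>i<K. \<Sum>j<K. of_bool (c u = i) * of_bool (c v = j) * (p u * p v * f u v) * g i j) =
       (\<Sum>i<K. of_bool (c u = i) * (\<Sum>j<K. of_bool (c v = j) * (p u * p v * f u v * g i j)))"
      unfolding sum_distrib_left mult.assoc ..
    also have "\<dots> = p u * p v * f u v * g (c u) (c v)"
      using c that by (simp add: sum_of_bool_class)
    finally show ?thesis ..
  qed
  then have "(\<Sum>u\<in>V. \<Sum>v\<in>V. p u * p v * f u v * g (c u) (c v)) =
      (\<Sum>u\<in>V. \<Sum>v\<in>V. \<Sum>i<K. \<Sum>j<K. of_bool (c u = i) * of_bool (c v = j) * (p u * p v * f u v) * g i j)"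
    by simp
  also have "\<dots> = (\<Sum>i<K. \<Sum>j<K. \<Sum>u\<in>V. \<Sum>v\<in>V. of_bool (c u = i) * of_bool (c v = j) * (p u * p v * f u v) * g i j)"
    by (simp only: sum.swap [of _ "{..<K}" V])
  finally show ?thesis by (simp add: cls_mass_def sum_distrib_right)
qed

text \<open>The class density is the conditional expectation of \<open>f\<close> given the two
  classes, so it may replace \<open>f\<close> when tested against a function constant on
  blocks.\<close>

lemma sum_dens_by_class:
  fixes g :: "nat \<Rightarrow> nat \<Rightarrow> real"
  assumes c: "\<And>u. u \<in> V \<Longrightarrow> c u < K"
    and f: "\<And>s t. s \<in> V \<Longrightarrow> t \<in> V \<Longrightarrow> 0 \<le> f s t \<and> f s t \<le> 1"
  shows "(\<Sum>u\<in>V. \<Sum>v\<in>V. p u * p v * f u v * g (c u) (c v)) =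
    (\<Sum>u\<in>V. \<Sum>v\<in>V. p u * p v * cls_dens V p f c (c u) (c v) * g (c u) (c v))"
  using sum_pair_by_class [of c K "\<lambda>i j. cls_dens V p f c i j * g i j", OF c]
    sum_mass_by_class [of c K f g, OF c]
  by (simp add: cls_mass_eq [of f, OF f] mult.assoc)

text \<open>The other factor is the indicator of the rectangle, of norm at most 1 since the weights
  sum to 1. Thus the L2 norm dominates the cut norm.\<close>

lemma weighted_Cauchy_Schwarz:
  assumes "S \<subseteq> V" "T \<subseteq> V"
  shows "(\<Sum>s\<in>S. \<Sum>t\<in>T. p s * p t * h s t)\<^sup>2 \<le> (\<Sum>s\<in>V. \<Sum>t\<in>V. p s * p t * (h s t)\<^sup>2)"
proof -
  let ?P = "S \<times> T"
  have fin2: "finite S" "finite T" using assms fin by (auto intro: finite_subset)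
  have "(\<Sum>s\<in>S. \<Sum>t\<in>T. p s * p t * h s t) =
      (\<Sum>(s, t)\<in>?P. sqrt (p s * p t) * (sqrt (p s * p t) * h s t))"
    unfolding sum.cartesian_product
    by (intro sum.cong refl) (use assms nonneg in \<open>auto simp: mult.assoc [symmetric] subset_iff\<close>)
  then have "(\<Sum>s\<in>S. \<Sum>t\<in>T. p s * p t * h s t)\<^sup>2 \<le>
      (\<Sum>(s, t)\<in>?P. (sqrt (p s * p t))\<^sup>2) * (\<Sum>(s, t)\<in>?P. (sqrt (p s * p t) * h s t)\<^sup>2)"
    using Cauchy_Schwarz_ineq_sum [of "\<lambda>(s, t). sqrt (p s * p t)" "\<lambda>(s, t). sqrt (p s * p t) * h s t" ?P]
    by (simp add: case_prod_unfold)
  also have "(\<Sum>(s, t)\<in>?P. (sqrt (p s * p t))\<^sup>2) = (\<Sum>s\<in>S. p s) * (\<Sum>t\<in>T. p t)"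
    unfolding sum_product sum.cartesian_product
    by (intro sum.cong refl) (use assms nonneg in \<open>auto simp: subset_iff\<close>)
  also have "(\<Sum>(s, t)\<in>?P. (sqrt (p s * p t) * h s t)\<^sup>2) = (\<Sum>s\<in>S. \<Sum>t\<in>T. p s * p t * (h s t)\<^sup>2)"
    unfolding sum.cartesian_product
    by (intro sum.cong refl) (use assms nonneg in \<open>auto simp: subset_iff power_mult_distrib\<close>)
  also have "(\<Sum>s\<in>S. p s) * (\<Sum>t\<in>T. p t) * (\<Sum>s\<in>S. \<Sum>t\<in>T. p s * p t * (h s t)\<^sup>2) \<le>
      1 * (\<Sum>s\<in>V. \<Sum>t\<in>V. p s * p t * (h s t)\<^sup>2)"
  proof (intro mult_mono)
    have le: "(\<Sum>s\<in>S. p s) \<le> 1" if "S \<subseteq> V" for S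
      using that sum_mono2 [OF fin, of S p] nonneg total by auto
    show "(\<Sum>s\<in>S. p s) * (\<Sum>t\<in>T. p t) \<le> 1"
      using le assms nonneg by (intro mult_le_one sum_nonneg) auto
    have "(\<Sum>s\<in>S. \<Sum>t\<in>T. p s * p t * (h s t)\<^sup>2) \<le> (\<Sum>s\<in>S. \<Sum>t\<in>V. p s * p t * (h s t)\<^sup>2)"
      using assms nonneg fin by (intro sum_mono sum_mono2) auto
    also have "\<dots> \<le> (\<Sum>s\<in>V. \<Sum>t\<in>V. p s * p t * (h s t)\<^sup>2)"
      using assms nonneg fin by (intro sum_mono2 sum_nonneg) auto
    finally show "(\<Sum>s\<in>S. \<Sum>t\<in>T. p s * p t * (h s t)\<^sup>2) \<le> (\<Sum>s\<in>V. \<Sum>t\<in>V. p s * p t * (h s t)\<^sup>2)" .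
  qed (use assms nonneg in \<open>auto intro!: sum_nonneg mult_nonneg_nonneg\<close>)
  finally show ?thesis by simp
qed

section \<open>Energy increment\<close>

definition cut_dev :: "('w \<Rightarrow> 'w \<Rightarrow> real) \<Rightarrow> ('w \<Rightarrow> nat) \<Rightarrow> 'w set \<Rightarrow> 'w set \<Rightarrow> real" where
  "cut_dev f c S T = \<bar>\<Sum>s\<in>S. \<Sum>t\<in>T. p s * p t * (f s t - cls_dens V p f c (c s) (c t))\<bar>"

text \<open>One step of the Frieze--Kannan energy increment argument: splitting the classes along a
  pair \<open>(S, T)\<close> with the largest deviation increases the energy by at least its square.\<close>

lemma regularity_step:
  assumes c: "\<And>u. u \<in> V \<Longrightarrow> c u < K"
    and f: "\<And>s t. s \<in> V \<Longrightarrow> t \<in> V \<Longrightarrow> 0 \<le> f s t \<and> f s t \<le> 1"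
  obtains c' where "\<And>u. u \<in> V \<Longrightarrow> c' u < 4 * K" "\<And>u. c' u div 4 = c u"
    "\<And>S T. S \<subseteq> V \<Longrightarrow> T \<subseteq> V \<Longrightarrow> cut_dev f c S T \<le>
        sqrt (energy (4 * K) (cls_wt V p c') (cls_dens V p f c') - energy K (cls_wt V p c) (cls_dens V p f c))"
proof -
  \<comment> \<open>A maximal pair, rather than one above a threshold, makes the refinement
    unconditional and bounds all other pairs by the same energy increment.\<close>
  have "\<exists>Q\<in>Pow V \<times> Pow V. \<forall>R\<in>Pow V \<times> Pow V. case_prod (cut_dev f c) R \<le> case_prod (cut_dev f c) Q"
  proof -
    let ?R = "case_prod (cut_dev f c) ` (Pow V \<times> Pow V)"
    have R: "finite ?R" "?R \<noteq> {}" using fin by auto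
    from Max_in [OF R] obtain Q where Q: "Q \<in> Pow V \<times> Pow V" "Max ?R = case_prod (cut_dev f c) Q" by blast
    show ?thesis
    proof (intro bexI [OF _ Q(1)] ballI)
      fix R assume "R \<in> Pow V \<times> Pow V"
      then have "case_prod (cut_dev f c) R \<in> ?R" by (rule imageI)
      then show "case_prod (cut_dev f c) R \<le> case_prod (cut_dev f c) Q"
        using Max_ge [OF R(1)] Q(2) by simp
    qed
  qed
  then obtain S T where ST: "S \<subseteq> V" "T \<subseteq> V"
    and max: "\<And>S' T'. S' \<subseteq> V \<Longrightarrow> T' \<subseteq> V \<Longrightarrow> cut_dev f c S' T' \<le> cut_dev f c S T"
    by auto
  \<comment> \<open>The two bits of the new base-4 digit record membership in \<open>S\<close> and
    in \<open>T\<close>; both sets become unions of new classes.\<close>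
  define c' where "c' u = 4 * c u + 2 * of_bool (u \<in> S) + of_bool (u \<in> T)" for u
  have c'K: "c' u < 4 * K" if "u \<in> V" for u
    using c [OF that] by (simp add: c'_def)
  have c'div: "c' u div 4 = c u" for u unfolding c'_def of_bool_def by (cases "u \<in> S"; cases "u \<in> T"; simp; presburger?)
  define F where "F u v = cls_dens V p f c (c u) (c v)" for u v
  define F' where "F' u v = cls_dens V p f c' (c' u) (c' v)" for u v
  define g where "g i j = cls_dens V p f c (i div 4) (j div 4)" for i j
  have Fg: "F u v = g (c' u) (c' v)" for u v by (simp add: F_def g_def c'div)
  have E: "energy K (cls_wt V p c) (cls_dens V p f c) = (\<Sum>u\<in>V. \<Sum>v\<in>V. p u * p v * (F u v)\<^sup>2)"
    unfolding energy_def F_def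
    by (rule sum_pair_by_class [of c K "\<lambda>i j. (cls_dens V p f c i j)\<^sup>2", OF c, symmetric])
  have E': "energy (4 * K) (cls_wt V p c') (cls_dens V p f c') = (\<Sum>u\<in>V. \<Sum>v\<in>V. p u * p v * (F' u v)\<^sup>2)"
    unfolding energy_def F'_def
    by (rule sum_pair_by_class [of c' "4 * K" "\<lambda>i j. (cls_dens V p f c' i j)\<^sup>2", OF c'K, symmetric])
  \<comment> \<open>Both sides equal the sum of \<open>f\<close> times \<open>F\<close>: the
    function \<open>F\<close> is constant on the new blocks as well as on the old ones. This
    orthogonality turns the squared distance into a difference of energies.\<close>
  have "(\<Sum>u\<in>V. \<Sum>v\<in>V. p u * p v * F' u v * F u v) = (\<Sum>u\<in>V. \<Sum>v\<in>V. p u * p v * F u v * F u v)"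
    using sum_dens_by_class [of c' "4 * K" f g, OF c'K f] sum_dens_by_class [of c K f "cls_dens V p f c", OF c f]
    by (simp add: Fg [symmetric] F'_def [symmetric]) (simp add: F_def)
  then have "(\<Sum>u\<in>V. \<Sum>v\<in>V. p u * p v * (F' u v - F u v)\<^sup>2) =
      energy (4 * K) (cls_wt V p c') (cls_dens V p f c') - energy K (cls_wt V p c) (cls_dens V p f c)"
  proof -
    assume eq: "(\<Sum>u\<in>V. \<Sum>v\<in>V. p u * p v * F' u v * F u v) = (\<Sum>u\<in>V. \<Sum>v\<in>V. p u * p v * F u v * F u v)"
    have "(\<Sum>u\<in>V. \<Sum>v\<in>V. p u * p v * (F' u v - F u v)\<^sup>2) =
        (\<Sum>u\<in>V. \<Sum>v\<in>V. p u * p v * (F' u v)\<^sup>2 - 2 * (p u * p v * F' u v * F u v) + p u * p v * F u v * F u v)"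
      by (intro sum.cong refl) (simp add: power2_eq_square algebra_simps)
    also have "\<dots> = (\<Sum>u\<in>V. \<Sum>v\<in>V. p u * p v * (F' u v)\<^sup>2) - (\<Sum>u\<in>V. \<Sum>v\<in>V. p u * p v * F u v * F u v)"
      unfolding sum.distrib sum_subtractf sum_distrib_left [symmetric] eq by simp
    finally show ?thesis unfolding E E' by (simp only: power2_eq_square mult.assoc)
  qed
  moreover have "cut_dev f c S T \<le> sqrt (\<Sum>u\<in>V. \<Sum>v\<in>V. p u * p v * (F' u v - F u v)\<^sup>2)"
  proof -
    have restr: "(\<Sum>s\<in>S. \<Sum>t\<in>T. p s * p t * h s t) =
        (\<Sum>s\<in>V. \<Sum>t\<in>V. p s * p t * h s t * (of_bool (odd (c' s div 2)) * of_bool (odd (c' t))))" for h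
    proof -
      have odd: "odd (c' s div 2) \<longleftrightarrow> s \<in> S" "odd (c' s) \<longleftrightarrow> s \<in> T" for s
        by (auto simp: c'_def)
      have "(\<Sum>s\<in>V. \<Sum>t\<in>V. p s * p t * h s t * (of_bool (s \<in> S) * of_bool (t \<in> T))) =
          (\<Sum>s\<in>V. if s \<in> S then \<Sum>t\<in>V. if t \<in> T then p s * p t * h s t else 0 else 0)"
        by (intro sum.cong refl) (auto intro!: sum.cong)
      also have "\<dots> = (\<Sum>s\<in>S. \<Sum>t\<in>T. p s * p t * h s t)"
        using ST fin by (simp add: sum.inter_restrict [symmetric] Int_absorb1)
      finally show ?thesis unfolding odd by simp
    qed
    \<comment> \<open>The rectangle is a union of new blocks, and averaging over blocks preserves
      its mass; so the deviation of \<open>f\<close> from \<open>F\<close> is that of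
      \<open>F'\<close> from \<open>F\<close>.\<close>
    have "(\<Sum>s\<in>S. \<Sum>t\<in>T. p s * p t * f s t) = (\<Sum>s\<in>S. \<Sum>t\<in>T. p s * p t * F' s t)"
      unfolding restr F'_def
      by (rule sum_dens_by_class [of c' "4 * K" f "\<lambda>i j. of_bool (odd (i div 2)) * of_bool (odd j)", OF c'K f])
    then have "cut_dev f c S T = \<bar>\<Sum>s\<in>S. \<Sum>t\<in>T. p s * p t * (F' s t - F s t)\<bar>"
      by (simp add: cut_dev_def F_def right_diff_distrib sum_subtractf)
    then show ?thesis
      using weighted_Cauchy_Schwarz [OF ST, of "\<lambda>s t. F' s t - F s t"]
      by (intro real_le_rsqrt) simp
  qed
  ultimately have "cut_dev f c S T \<le> sqrt (energy (4 * K) (cls_wt V p c') (cls_dens V p f c')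
      - energy K (cls_wt V p c) (cls_dens V p f c))" by simp
  with max show thesis by (intro that [OF c'K c'div]) (auto intro: order_trans)
qed

text \<open>The codes at level \<open>m\<close> are base-4 numerals with \<open>m\<close> digits; a class is refined by appending
  a digit.\<close>

lemma regularity:
  assumes f: "\<And>s t. s \<in> V \<Longrightarrow> t \<in> V \<Longrightarrow> 0 \<le> f s t \<and> f s t \<le> 1"
  obtains c where "\<And>m u. u \<in> V \<Longrightarrow> c m u < 4 ^ m" "\<And>m u. c (Suc m) u div 4 = c m u"
    "\<And>m S T. S \<subseteq> V \<Longrightarrow> T \<subseteq> V \<Longrightarrow> cut_dev f (c m) S T \<le>
        sqrt (energy (4 ^ Suc m) (cls_wt V p (c (Suc m))) (cls_dens V p f (c (Suc m)))
          - energy (4 ^ m) (cls_wt V p (c m)) (cls_dens V p f (c m)))"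
proof -
  have "\<exists>c. \<forall>m. (\<forall>u\<in>V. c m u < 4 ^ m) \<and> ((\<forall>u. c (Suc m) u div 4 = c m u) \<and>
      (\<forall>S\<subseteq>V. \<forall>T\<subseteq>V. cut_dev f (c m) S T \<le>
        sqrt (energy (4 ^ Suc m) (cls_wt V p (c (Suc m))) (cls_dens V p f (c (Suc m)))
          - energy (4 ^ m) (cls_wt V p (c m)) (cls_dens V p f (c m)))))"
  proof (rule dependent_nat_choice, goal_cases)
    case 1
    show ?case by (rule exI [of _ "\<lambda>_. 0"]) simp
  next
    case (2 c m)
    then have c: "\<And>u. u \<in> V \<Longrightarrow> c u < 4 ^ m" by simp
    show ?case
    proof (rule regularity_step [of c "4 ^ m" f], goal_cases)
      case 1 then show ?case by (rule c)
    next
      case 2 then show ?case using f by simp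
    next
      case (3 c')
      then show ?case by (intro exI [of _ c']) simp
    qed
  qed
  then obtain c where "\<And>m. (\<forall>u\<in>V. c m u < 4 ^ m) \<and> ((\<forall>u. c (Suc m) u div 4 = c m u) \<and>
      (\<forall>S\<subseteq>V. \<forall>T\<subseteq>V. cut_dev f (c m) S T \<le>
        sqrt (energy (4 ^ Suc m) (cls_wt V p (c (Suc m))) (cls_dens V p f (c (Suc m)))
          - energy (4 ^ m) (cls_wt V p (c m)) (cls_dens V p f (c m)))))"
    by auto
  then show thesis by (intro that [of c]) auto
qed

end

section \<open>Limits of regular partitions\<close>

text \<open>Splits the indicator of a class into those of its four children.\<close>

lemma of_bool_div_4:
  "of_bool (k div 4 = i) = (\<Sum>a<4. of_bool (k = 4 * i + a) :: real)" for k i :: nat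
proof -
  have "k = 4 * i + a \<longleftrightarrow> k div 4 = i \<and> k mod 4 = a" if "a < 4" for a
  proof
    assume k: "k = 4 * i + a"
    have "k div 4 = i" using that k by (intro div_nat_eqI) auto
    moreover have "k mod 4 = a" using that k by simp
    ultimately show "k div 4 = i \<and> k mod 4 = a" ..
  qed (use mult_div_mod_eq [of 4 k] in auto)
  then have "(\<Sum>a<4. of_bool (k = 4 * i + a) :: real) = of_bool (k div 4 = i) * (\<Sum>a<4. of_bool (k mod 4 = a) * 1)"
    unfolding sum_distrib_left by (intro sum.cong refl) simp
  then show ?thesis by (simp only: sum_of_bool_class [of "k mod 4" 4])
qed

lemma cls_wt_refine:
  assumes "\<And>u. c' u div 4 = c u"
  shows "cls_wt V p c i = (\<Sum>a<4. cls_wt V p c' (4 * i + a))"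
proof -
  show ?thesis
    unfolding cls_wt_def assms [symmetric] of_bool_div_4 sum_distrib_right by (rule sum.swap)
qed

text \<open>Masses are additive under refinement while densities are not. The mass form also passes
  to the limit without dividing by weights that may tend to 0.\<close>

lemma cls_mass_refine:
  assumes "\<And>u. c' u div 4 = c u"
  shows "cls_mass V p f c i j = (\<Sum>a<4. \<Sum>b<4. cls_mass V p f c' (4 * i + a) (4 * j + b))"
proof -
  have "(\<Sum>a<4. \<Sum>b<4. cls_mass V p f c' (4 * i + a) (4 * j + b)) =
      (\<Sum>u\<in>V. \<Sum>v\<in>V. \<Sum>a<4. \<Sum>b<4. of_bool (c' u = 4 * i + a) * of_bool (c' v = 4 * j + b) * (p u * p v * f u v))"
    unfolding cls_mass_def by (simp only: sum.swap [of _ V "{..<4}"])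
  also have "\<dots> = cls_mass V p f c i j"
    unfolding cls_mass_def assms [symmetric] of_bool_div_4 unfolding sum_product unfolding sum_distrib_right ..
  finally show ?thesis ..
qed

lemma convergent_subsequence_countable:
  fixes g :: "nat \<Rightarrow> 'i::countable \<Rightarrow> real"
  assumes "\<And>n i. 0 \<le> g n i \<and> g n i \<le> 1"
  obtains r where "strict_mono r" "\<And>i. convergent (\<lambda>n. g (r n) i)"
proof -
  interpret subseqs "\<lambda>k s. convergent (\<lambda>n. g (s n) (from_nat k))"
  proof
    fix k and s :: "nat \<Rightarrow> nat"
    have "\<exists>l\<in>{0..1}. \<exists>r. strict_mono r \<and> ((\<lambda>n. g (s n) (from_nat k)) \<circ> r) \<longlonglongrightarrow> l"
      using compact_Icc [of "0::real" 1] assms unfolding compact_eq_seq_compact_metric seq_compact_def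
      by simp
    then show "\<exists>r'. strict_mono r' \<and> convergent (\<lambda>n. g ((s \<circ> r') n) (from_nat k))"
      by (auto simp: convergent_def o_def)
  qed
  have "convergent (\<lambda>n. g (diagseq n) i)" for i
  proof -
    \<comment> \<open>The diagonal sequence runs inside the subsequence chosen for this index only
      from some term on, hence the shift.\<close>
    have "convergent (\<lambda>n. g ((diagseq \<circ> ((+) (Suc (to_nat i)))) n) (from_nat (to_nat i)))"
      by (rule diagseq_holds) (use convergent_subseq_convergent in \<open>force simp: o_def\<close>)
    then have "convergent (\<lambda>n. g (diagseq (n + Suc (to_nat i))) i)"
      by (simp add: add.commute)
    then show ?thesis
      by (rule iffD1 [OF convergent_ignore_initial_segment])
  qed
  with subseq_diagseq show thesis by (rule that)
qed

text \<open>Choosing between \<open>W\<close> and \<open>1 - W\<close> by a flag lets one proof of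
  each limit and sampling result serve both terms of the functional.\<close>

definition toggle :: "bool \<Rightarrow> real \<Rightarrow> real" where
  "toggle b z = (if b then 1 - z else z)"

lemma toggle_bounds: "0 \<le> z \<and> z \<le> 1 \<Longrightarrow> 0 \<le> toggle b z \<and> toggle b z \<le> 1"
  by (auto simp: toggle_def)

lemma tendsto_toggle: "(f \<longlongrightarrow> l) F \<Longrightarrow> ((\<lambda>x. toggle b (f x)) \<longlongrightarrow> toggle b l) F"
  by (auto simp: toggle_def intro: tendsto_intros)

lemma tendsto_wdens:
  assumes "\<And>i. (\<lambda>n. w n i) \<longlonglongrightarrow> w' i" "\<And>i j. (\<lambda>n. d n i j) \<longlonglongrightarrow> d' i j"
  shows "(\<lambda>n. wdens A D V (w n) (d n)) \<longlonglongrightarrow> wdens A D V w' d'"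
  unfolding wdens_def wsum_def edge_prod_def case_prod_unfold
  by (intro tendsto_intros assms)

text \<open>Complementing both functions merely changes the sign of their difference, so one cut
  bound serves both flags. The density of the averaged function is then read off from the classes
  alone.\<close>

lemma (in weighted_set) wdens_class_dens_diff_le:
  assumes A: "finite A" and D: "D \<subseteq> A \<times> A" "asym D"
    and f: "\<And>s t. s \<in> V \<Longrightarrow> t \<in> V \<Longrightarrow> 0 \<le> f s t \<and> f s t \<le> 1"
    and c: "\<And>u. u \<in> V \<Longrightarrow> c u < K"
    and cut: "\<And>S T. S \<subseteq> V \<Longrightarrow> T \<subseteq> V \<Longrightarrow> cut_dev f c S T \<le> \<delta>"
  shows "\<bar>wdens A D V p (\<lambda>s t. toggle b (f s t)) -
      wdens A D {..<K} (cls_wt V p c) (\<lambda>i j. toggle b (cls_dens V p f c i j))\<bar> \<le> real (card D) * \<delta>"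
proof -
  have "wdens A D V p (\<lambda>s t. toggle b (cls_dens V p f c (c s) (c t))) =
      wdens A D {..<K} (cls_wt V p c) (\<lambda>i j. toggle b (cls_dens V p f c i j))"
    using c by (intro wdens_pushforward A D fin) (auto simp: cls_wt_def)
  moreover have "\<bar>wdens A D V p (\<lambda>s t. toggle b (f s t)) -
      wdens A D V p (\<lambda>s t. toggle b (cls_dens V p f c (c s) (c t)))\<bar> \<le> real (card D) * \<delta>"
  proof (rule wdens_diff_le_cut [OF A D])
    fix S T assume ST: "S \<subseteq> V" "T \<subseteq> V"
    have "\<bar>\<Sum>s\<in>S. \<Sum>t\<in>T. p s * p t * (toggle b (f s t) - toggle b (cls_dens V p f c (c s) (c t)))\<bar> =
        cut_dev f c S T"
    proof (cases b)
      case True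
      have "(\<Sum>s\<in>S. \<Sum>t\<in>T. p s * p t * (toggle b (f s t) - toggle b (cls_dens V p f c (c s) (c t)))) =
          - (\<Sum>s\<in>S. \<Sum>t\<in>T. p s * p t * (f s t - cls_dens V p f c (c s) (c t)))"
        unfolding sum_negf [symmetric] by (intro sum.cong refl) (simp add: True toggle_def algebra_simps)
      then show ?thesis by (simp only: cut_dev_def abs_minus_cancel)
    qed (simp add: toggle_def cut_dev_def)
    with cut [OF ST] show "\<bar>\<Sum>s\<in>S. \<Sum>t\<in>T. p s * p t * (toggle b (f s t) - toggle b (cls_dens V p f c (c s) (c t)))\<bar> \<le> \<delta>"
      by (simp only:)
  next
    show "0 \<le> toggle b (f s t) \<and> toggle b (f s t) \<le> 1" if "s \<in> V" "t \<in> V" for s t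
      by (rule toggle_bounds [OF f [OF that]])
    show "0 \<le> toggle b (cls_dens V p f c (c s) (c t)) \<and> toggle b (cls_dens V p f c (c s) (c t)) \<le> 1" for s t
      by (rule toggle_bounds [OF cls_dens_bounds [of f, OF f]])
  qed
  ultimately show ?thesis by simp
qed

text \<open>What remains of nested partitions in the limit: weights and densities on the tree of
  base-4 numerals. The last equation is the martingale property of the step functions, multiplied by
  the weights.\<close>

locale step_limit =
  fixes w :: "nat \<Rightarrow> nat \<Rightarrow> real" and d :: "nat \<Rightarrow> nat \<Rightarrow> nat \<Rightarrow> real"
  assumes w_nonneg: "0 \<le> w m i"
    and w_total: "(\<Sum>i<4 ^ m. w m i) = 1"
    and w_refine: "w m i = (\<Sum>a<4. w (Suc m) (4 * i + a))"
    and d_bounds: "0 \<le> d m i j \<and> d m i j \<le> 1"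
    and d_sym: "d m i j = d m j i"
    and d_refine: "w m i * w m j * d m i j =
      (\<Sum>a<4. \<Sum>b<4. w (Suc m) (4 * i + a) * w (Suc m) (4 * j + b) * d (Suc m) (4 * i + a) (4 * j + b))"

definition (in step_limit) E :: "nat \<Rightarrow> real" where
  "E m = energy (4 ^ m) (w m) (d m)"

text \<open>The codings are bound inside, so that later statements mention only the limits
  \<open>w\<close> and \<open>d\<close>. Nestedness of the codings reappears as the refinement
  equations of \<open>step_limit\<close>.\<close>

definition step_converges ::
  "(nat \<Rightarrow> 'w set) \<Rightarrow> (nat \<Rightarrow> 'w \<Rightarrow> real) \<Rightarrow> (nat \<Rightarrow> 'w \<Rightarrow> 'w \<Rightarrow> real) \<Rightarrow>
    (nat \<Rightarrow> nat \<Rightarrow> real) \<Rightarrow> (nat \<Rightarrow> nat \<Rightarrow> nat \<Rightarrow> real) \<Rightarrow> bool" where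
  "step_converges V p f w d \<longleftrightarrow> (\<exists>c. (\<forall>n m. \<forall>u\<in>V n. c n m u < 4 ^ m) \<and>
    (\<forall>n m. \<forall>S\<subseteq>V n. \<forall>T\<subseteq>V n. weighted_set.cut_dev (V n) (p n) (f n) (c n m) S T \<le>
        sqrt (energy (4 ^ Suc m) (cls_wt (V n) (p n) (c n (Suc m))) (cls_dens (V n) (p n) (f n) (c n (Suc m)))
          - energy (4 ^ m) (cls_wt (V n) (p n) (c n m)) (cls_dens (V n) (p n) (f n) (c n m)))) \<and>
    (\<forall>m i. (\<lambda>n. cls_wt (V n) (p n) (c n m) i) \<longlonglongrightarrow> w m i) \<and>
    (\<forall>m i j. (\<lambda>n. cls_dens (V n) (p n) (f n) (c n m) i j) \<longlonglongrightarrow> d m i j))"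

text \<open>The shape of level \<open>m\<close> does not depend on \<open>n\<close>, so all weights
  and densities form a countable family of sequences in the unit interval. The refinement equations
  are polynomial and survive the limit.\<close>

lemma step_limit_exists:
  fixes V :: "nat \<Rightarrow> 'w set"
  assumes wt: "\<And>n. weighted_set (V n) (p n)"
    and f: "\<And>n s t. s \<in> V n \<Longrightarrow> t \<in> V n \<Longrightarrow> 0 \<le> f n s t \<and> f n s t \<le> 1"
    and sym: "\<And>n s t. s \<in> V n \<Longrightarrow> t \<in> V n \<Longrightarrow> f n s t = f n t s"
  obtains r w d where "strict_mono r" "step_limit w d"
    "step_converges (V \<circ> r) (p \<circ> r) (f \<circ> r) w d"
proof -
  define good where "good n c \<longleftrightarrow> (\<forall>m. \<forall>u\<in>V n. c m u < 4 ^ m) \<and> (\<forall>m u. c (Suc m) u div 4 = c m u) \<and>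
    (\<forall>m. \<forall>S\<subseteq>V n. \<forall>T\<subseteq>V n. weighted_set.cut_dev (V n) (p n) (f n) (c m) S T \<le>
        sqrt (energy (4 ^ Suc m) (cls_wt (V n) (p n) (c (Suc m))) (cls_dens (V n) (p n) (f n) (c (Suc m)))
          - energy (4 ^ m) (cls_wt (V n) (p n) (c m)) (cls_dens (V n) (p n) (f n) (c m))))" for n c
  have "\<exists>c. good n c" for n
  proof (rule weighted_set.regularity [OF wt, of n "f n"], goal_cases)
    case (2 c)
    then show ?case unfolding good_def by (intro exI [of _ c]) simp
  qed (use f in simp)
  then obtain c where c: "\<And>n. good n (c n)" by metis
  define W where "W n m i = cls_wt (V n) (p n) (c n m) i" for n m i
  define M where "M n m i j = cls_mass (V n) (p n) (f n) (c n m) i j" for n m i j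
  define X where "X n m i j = cls_dens (V n) (p n) (f n) (c n m) i j" for n m i j
  have W: "0 \<le> W n m i" "W n m i \<le> 1" for n m i
    unfolding W_def by (rule weighted_set.cls_wt_nonneg [OF wt] weighted_set.cls_wt_le_1 [OF wt])+
  have X: "0 \<le> X n m i j \<and> X n m i j \<le> 1" for n m i j
    unfolding X_def by (rule weighted_set.cls_dens_bounds [OF wt, of n "f n", OF f])
  \<comment> \<open>A sum type indexes weights and densities together, so that one subsequence works
    for both.\<close>
  define g where "g n q = (case q of Inl (m, i) \<Rightarrow> W n m i | Inr (m, i, j) \<Rightarrow> X n m i j)" for n q
  have "0 \<le> g n q \<and> g n q \<le> 1" for n q
    using W X by (auto simp: g_def split: sum.split)
  then obtain r where r: "strict_mono r" and conv: "\<And>q. convergent (\<lambda>n. g (r n) q)"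
    using convergent_subsequence_countable [of g] by blast
  define w where "w m i = lim (\<lambda>n. W (r n) m i)" for m i
  define d where "d m i j = lim (\<lambda>n. X (r n) m i j)" for m i j
  have w: "(\<lambda>n. W (r n) m i) \<longlonglongrightarrow> w m i" for m i
    using conv [of "Inl (m, i)"] by (simp add: g_def w_def convergent_LIMSEQ_iff)
  have d: "(\<lambda>n. X (r n) m i j) \<longlonglongrightarrow> d m i j" for m i j
    using conv [of "Inr (m, i, j)"] by (simp add: g_def d_def convergent_LIMSEQ_iff)
  have step: "step_limit w d"
  proof
    fix m i j
    show "0 \<le> w m i" using w W by (intro LIMSEQ_le_const [OF w]) auto
    have "(\<lambda>n. \<Sum>i<4 ^ m. W (r n) m i) \<longlonglongrightarrow> (\<Sum>i<4 ^ m. w m i)" by (intro tendsto_intros w)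
    moreover have "(\<Sum>i<4 ^ m. W n m i) = 1" for n
      unfolding W_def using c [of n] by (intro weighted_set.cls_wt_total [OF wt]) (auto simp: good_def)
    ultimately show "(\<Sum>i<4 ^ m. w m i) = 1" by (simp add: LIMSEQ_const_iff)
    have "(\<lambda>n. \<Sum>a<4. W (r n) (Suc m) (4 * i + a)) \<longlonglongrightarrow> (\<Sum>a<4. w (Suc m) (4 * i + a))"
      by (intro tendsto_intros w)
    moreover have "(\<Sum>a<4. W n (Suc m) (4 * i + a)) = W n m i" for n
      unfolding W_def using c [of n] by (intro cls_wt_refine [symmetric]) (auto simp: good_def)
    ultimately show "w m i = (\<Sum>a<4. w (Suc m) (4 * i + a))"
      using LIMSEQ_unique [OF w] by simp
    show "0 \<le> d m i j \<and> d m i j \<le> 1"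
      using X by (auto intro!: LIMSEQ_le_const [OF d] LIMSEQ_le_const2 [OF d])
    have "X n m i j = X n m j i" for n m
      unfolding X_def using sym by (intro weighted_set.cls_dens_sym [OF wt]) auto
    then show "d m i j = d m j i" by (simp add: d_def)
    have mass: "M n m i j = W n m i * W n m j * X n m i j" for n m i j
      unfolding M_def W_def X_def by (rule weighted_set.cls_mass_eq [OF wt, of n "f n", OF f])
    have "M n m i j = (\<Sum>a<4. \<Sum>b<4. M n (Suc m) (4 * i + a) (4 * j + b))" for n
      unfolding M_def using c [of n] by (intro cls_mass_refine) (auto simp: good_def)
    then have eq: "W n m i * W n m j * X n m i j = (\<Sum>a<4. \<Sum>b<4.
        W n (Suc m) (4 * i + a) * W n (Suc m) (4 * j + b) * X n (Suc m) (4 * i + a) (4 * j + b))" for n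
      unfolding mass .
    have "(\<lambda>n. W (r n) m i * W (r n) m j * X (r n) m i j) \<longlonglongrightarrow> w m i * w m j * d m i j"
      by (intro tendsto_intros w d)
    moreover have "(\<lambda>n. W (r n) m i * W (r n) m j * X (r n) m i j) \<longlonglongrightarrow> (\<Sum>a<4. \<Sum>b<4.
        w (Suc m) (4 * i + a) * w (Suc m) (4 * j + b) * d (Suc m) (4 * i + a) (4 * j + b))"
      unfolding eq by (intro tendsto_intros w d)
    ultimately show "w m i * w m j * d m i j = (\<Sum>a<4. \<Sum>b<4.
        w (Suc m) (4 * i + a) * w (Suc m) (4 * j + b) * d (Suc m) (4 * i + a) (4 * j + b))"
      by (rule LIMSEQ_unique)
  qed
  have "step_converges (V \<circ> r) (p \<circ> r) (f \<circ> r) w d"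
    unfolding step_converges_def
    by (rule exI [of _ "c \<circ> r"]) (use c w d in \<open>simp add: good_def W_def X_def\<close>)
  with r step show thesis by (rule that)
qed

text \<open>At a fixed level the estimate for finite graphs involves finitely many weights and
  densities, all continuously, so \<open>n\<close> may tend to infinity. The error left is the
  increment of the limit energy.\<close>

lemma (in step_limit) wdens_limit_diff_le:
  assumes wt: "\<And>n. weighted_set (V n) (p n)"
    and f: "\<And>n s t. s \<in> V n \<Longrightarrow> t \<in> V n \<Longrightarrow> 0 \<le> f n s t \<and> f n s t \<le> 1"
    and conv: "step_converges V p f w d"
    and A: "finite A" and D: "D \<subseteq> A \<times> A" "asym D"
    and x: "(\<lambda>n. wdens A D (V n) (p n) (\<lambda>s t. toggle b (f n s t))) \<longlonglongrightarrow> x"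
  shows "\<bar>x - wdens A D {..<4 ^ m} (w m) (\<lambda>i j. toggle b (d m i j))\<bar> \<le> real (card D) * sqrt (E (Suc m) - E m)"
proof -
  from conv [unfolded step_converges_def] obtain c where
    "\<forall>n m. \<forall>u\<in>V n. c n m u < 4 ^ m"
    "\<forall>n m. \<forall>S\<subseteq>V n. \<forall>T\<subseteq>V n. weighted_set.cut_dev (V n) (p n) (f n) (c n m) S T \<le>
        sqrt (energy (4 ^ Suc m) (cls_wt (V n) (p n) (c n (Suc m))) (cls_dens (V n) (p n) (f n) (c n (Suc m)))
          - energy (4 ^ m) (cls_wt (V n) (p n) (c n m)) (cls_dens (V n) (p n) (f n) (c n m)))"
    and w: "\<forall>m i. (\<lambda>n. cls_wt (V n) (p n) (c n m) i) \<longlonglongrightarrow> w m i"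
    and d: "\<forall>m i j. (\<lambda>n. cls_dens (V n) (p n) (f n) (c n m) i j) \<longlonglongrightarrow> d m i j"
    by (elim exE conjE)
  then have c: "\<And>n m u. u \<in> V n \<Longrightarrow> c n m u < 4 ^ m"
    and cut: "\<And>n m S T. S \<subseteq> V n \<Longrightarrow> T \<subseteq> V n \<Longrightarrow> weighted_set.cut_dev (V n) (p n) (f n) (c n m) S T \<le>
        sqrt (energy (4 ^ Suc m) (cls_wt (V n) (p n) (c n (Suc m))) (cls_dens (V n) (p n) (f n) (c n (Suc m)))
          - energy (4 ^ m) (cls_wt (V n) (p n) (c n m)) (cls_dens (V n) (p n) (f n) (c n m)))"
    by simp_all
  define W where "W n m i = cls_wt (V n) (p n) (c n m) i" for n m i
  define X where "X n m i j = cls_dens (V n) (p n) (f n) (c n m) i j" for n m i j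
  note w = w [folded W_def, rule_format] and d = d [folded X_def, rule_format]
  have lim_E: "(\<lambda>n. energy (4 ^ m) (W n m) (X n m)) \<longlonglongrightarrow> E m" for m
    unfolding E_def energy_def by (intro tendsto_intros w d)
  have le: "\<bar>wdens A D (V n) (p n) (\<lambda>s t. toggle b (f n s t)) -
      wdens A D {..<4 ^ m} (W n m) (\<lambda>i j. toggle b (X n m i j))\<bar> \<le>
      real (card D) * sqrt (energy (4 ^ Suc m) (W n (Suc m)) (X n (Suc m)) - energy (4 ^ m) (W n m) (X n m))" for n
    unfolding W_def [abs_def] X_def [abs_def]
    by (rule weighted_set.wdens_class_dens_diff_le [OF wt A D f c cut])
  show ?thesis
  proof (rule LIMSEQ_le)
    show "(\<lambda>n. real (card D) * sqrt (energy (4 ^ Suc m) (W n (Suc m)) (X n (Suc m)) - energy (4 ^ m) (W n m) (X n m)))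
        \<longlonglongrightarrow> real (card D) * sqrt (E (Suc m) - E m)"
      by (intro tendsto_intros lim_E)
    show "(\<lambda>n. \<bar>wdens A D (V n) (p n) (\<lambda>s t. toggle b (f n s t)) -
        wdens A D {..<4 ^ m} (W n m) (\<lambda>i j. toggle b (X n m i j))\<bar>) \<longlonglongrightarrow>
        \<bar>x - wdens A D {..<4 ^ m} (w m) (\<lambda>i j. toggle b (d m i j))\<bar>"
      by (intro tendsto_intros x tendsto_wdens w tendsto_toggle d)
  qed (use le in blast)
qed

section \<open>Densities over the unit interval\<close>

abbreviation unit_measure :: "real measure" where
  "unit_measure \<equiv> restrict_space lborel {0..1}"

lemma prob_space_unit_measure: "prob_space unit_measure"
  by (rule prob_spaceI) (simp add: emeasure_restrict_space space_restrict_space)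

interpretation unit: prob_space unit_measure by (rule prob_space_unit_measure)

interpretation unit_pair: pair_prob_space unit_measure unit_measure ..

interpretation unit_product: product_sigma_finite "\<lambda>_ :: 'i. unit_measure" by unfold_locales

text \<open>Homomorphism density for a Borel integrand: edges are oriented and the product measure
  is not completed. The link to \<open>graphon_density\<close> is
  \<open>graphon_density_eq_pdens\<close>.\<close>

definition pdens :: "'a set \<Rightarrow> ('a \<times> 'a) set \<Rightarrow> (real \<times> real \<Rightarrow> real) \<Rightarrow> real" where
  "pdens A D W = (\<integral>x. edge_prod D (\<lambda>s t. W (s, t)) x \<partial>(\<Pi>\<^sub>M v\<in>A. unit_measure))"

lemma distr_PiM_pair:
  assumes M: "prob_space M" and uv: "u \<in> A" "v \<in> A" "u \<noteq> v"
  shows "distr (Pi\<^sub>M A (\<lambda>_. M)) (M \<Otimes>\<^sub>M M) (\<lambda>x. (x u, x v)) = M \<Otimes>\<^sub>M M"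
proof (rule sym, rule pair_measure_eqI)
  interpret prob_space M by fact
  show "sigma_finite_measure M" "sigma_finite_measure M" by unfold_locales
  show "sets (M \<Otimes>\<^sub>M M) = sets (distr (Pi\<^sub>M A (\<lambda>_. M)) (M \<Otimes>\<^sub>M M) (\<lambda>x. (x u, x v)))" by simp
  fix B C assume BC: "B \<in> sets M" "C \<in> sets M"
  have [measurable]: "(\<lambda>x. (x u, x v)) \<in> Pi\<^sub>M A (\<lambda>_. M) \<rightarrow>\<^sub>M M \<Otimes>\<^sub>M M"
    using uv by (intro measurable_Pair measurable_component_singleton)
  have "(\<lambda>x. (x u, x v)) -` (B \<times> C) \<inter> space (Pi\<^sub>M A (\<lambda>_. M)) =
      prod_emb A (\<lambda>_. M) {u, v} (Pi\<^sub>E {u, v} (\<lambda>i. if i = u then B else C))"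
    using uv BC by (auto simp: prod_emb_def space_PiM PiE_iff extensional_def split: if_splits)
  then have "emeasure (distr (Pi\<^sub>M A (\<lambda>_. M)) (M \<Otimes>\<^sub>M M) (\<lambda>x. (x u, x v))) (B \<times> C) =
      emeasure (Pi\<^sub>M A (\<lambda>_. M)) (prod_emb A (\<lambda>_. M) {u, v} (Pi\<^sub>E {u, v} (\<lambda>i. if i = u then B else C)))"
    using BC by (simp add: emeasure_distr)
  also have "\<dots> = (\<Prod>i\<in>{u, v}. emeasure M (if i = u then B else C))"
    by (rule emeasure_PiM_emb) (use uv BC M in auto)
  also have "\<dots> = emeasure M B * emeasure M C" using uv by simp
  finally show "emeasure M B * emeasure M C = emeasure (distr (Pi\<^sub>M A (\<lambda>_. M)) (M \<Otimes>\<^sub>M M) (\<lambda>x. (x u, x v))) (B \<times> C)" ..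
qed

lemma measurable_PiM_pair [measurable (raw)]:
  assumes "u \<in> A" "v \<in> A"
  shows "(\<lambda>x. (x u, x v)) \<in> Pi\<^sub>M A (\<lambda>_. M) \<rightarrow>\<^sub>M M \<Otimes>\<^sub>M M"
  using assms by (intro measurable_Pair measurable_component_singleton)

text \<open>Two distinct coordinates are jointly distributed as the product, so null sets of the
  square pull back to null sets of the cube. Equal coordinates would land on the diagonal, about
  which nothing is known.\<close>

lemma AE_PiM_pair:
  assumes M: "prob_space M" and uv: "u \<in> A" "v \<in> A" "u \<noteq> v" and P: "AE z in M \<Otimes>\<^sub>M M. P z"
  shows "AE x in Pi\<^sub>M A (\<lambda>_. M). P (x u, x v)"
proof (rule AE_distrD [OF measurable_PiM_pair [OF uv(1,2)]])
  show "AE z in distr (Pi\<^sub>M A (\<lambda>_. M)) (M \<Otimes>\<^sub>M M) (\<lambda>x. (x u, x v)). P z"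
    unfolding distr_PiM_pair [OF M uv] by (rule P)
qed

lemma asym_neq: "asym D \<Longrightarrow> (u, v) \<in> D \<Longrightarrow> u \<noteq> v"
  by (auto dest: asymD)

lemma borel_measurable_edge_prod:
  assumes "D \<subseteq> A \<times> A" and [measurable]: "W \<in> borel_measurable (unit_measure \<Otimes>\<^sub>M unit_measure)"
  shows "edge_prod D (\<lambda>s t. W (s, t)) \<in> borel_measurable (\<Pi>\<^sub>M v\<in>A. unit_measure)"
  unfolding edge_prod_def [abs_def] case_prod_unfold
proof (rule borel_measurable_prod)
  fix q assume "q \<in> D"
  then have "fst q \<in> A" "snd q \<in> A" using assms(1) by auto
  then have "(\<lambda>x. (x (fst q), x (snd q))) \<in> (\<Pi>\<^sub>M v\<in>A. unit_measure) \<rightarrow>\<^sub>M unit_measure \<Otimes>\<^sub>M unit_measure"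
    by (rule measurable_PiM_pair)
  from measurable_compose [OF this assms(2)]
  show "(\<lambda>x. W (x (fst q), x (snd q))) \<in> borel_measurable (\<Pi>\<^sub>M v\<in>A. unit_measure)" .
qed

lemma edge_prod_bounds:
  assumes "\<And>u v. (u, v) \<in> D \<Longrightarrow> 0 \<le> f (x u) (x v) \<and> f (x u) (x v) \<le> 1"
  shows "0 \<le> edge_prod D f x \<and> edge_prod D f x \<le> 1"
  unfolding edge_prod_def using assms
  by (intro conjI prod_nonneg prod_le_1 ballI) (auto simp: case_prod_unfold)

text \<open>Each of the finitely many edges transports the almost sure convergence from the square
  to the cube; dominated convergence applies since all products lie between 0 and 1.\<close>

lemma pdens_tendsto:
  assumes A: "finite A" and D: "D \<subseteq> A \<times> A" "asym D"
    and [measurable]: "\<And>n. W n \<in> borel_measurable (unit_measure \<Otimes>\<^sub>M unit_measure)"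
      "W' \<in> borel_measurable (unit_measure \<Otimes>\<^sub>M unit_measure)"
    and W: "\<And>n z. 0 \<le> W n z \<and> W n z \<le> 1"
    and lim: "AE z in unit_measure \<Otimes>\<^sub>M unit_measure. (\<lambda>n. W n z) \<longlonglongrightarrow> W' z"
  shows "(\<lambda>n. pdens A D (W n)) \<longlonglongrightarrow> pdens A D W'"
  unfolding pdens_def
proof (rule integral_dominated_convergence [where w = "\<lambda>_. 1"])
  have finD: "finite D" using A D by (meson finite_SigmaI finite_subset)
  have "AE x in \<Pi>\<^sub>M v\<in>A. unit_measure. \<forall>q\<in>D. (\<lambda>n. W n (x (fst q), x (snd q))) \<longlonglongrightarrow> W' (x (fst q), x (snd q))"
  proof (rule AE_finite_allI [OF finD])
    fix q assume q: "q \<in> D"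
    then have "fst q \<noteq> snd q" using asym_neq [OF D(2), of "fst q" "snd q"] by simp
    then show "AE x in \<Pi>\<^sub>M v\<in>A. unit_measure. (\<lambda>n. W n (x (fst q), x (snd q))) \<longlonglongrightarrow> W' (x (fst q), x (snd q))"
      using q D by (intro AE_PiM_pair [OF prob_space_unit_measure _ _ _ lim]) auto
  qed
  then show "AE x in \<Pi>\<^sub>M v\<in>A. unit_measure. (\<lambda>n. edge_prod D (\<lambda>s t. W n (s, t)) x) \<longlonglongrightarrow> edge_prod D (\<lambda>s t. W' (s, t)) x"
    unfolding edge_prod_def case_prod_unfold by eventually_elim (intro tendsto_prod, blast)
  show "AE x in \<Pi>\<^sub>M v\<in>A. unit_measure. norm (edge_prod D (\<lambda>s t. W n (s, t)) x) \<le> 1" for n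
    using edge_prod_bounds [of D "\<lambda>s t. W n (s, t)"] W by (intro AE_I2) auto
  interpret P: prob_space "\<Pi>\<^sub>M v\<in>A. unit_measure"
    by (intro prob_space_PiM prob_space_unit_measure)
  show "integrable (\<Pi>\<^sub>M v\<in>A. unit_measure) (\<lambda>_. 1 :: real)" by simp
qed (use borel_measurable_edge_prod [OF D(1)] in auto)

text \<open>The counterpart of \<open>wdens_pushforward\<close> for the interval: after
  \<open>edge_prod_expand\<close>, the integral of each product is a product of class
  probabilities.\<close>

lemma pdens_step:
  fixes c :: "real \<Rightarrow> nat"
  assumes A: "finite A" and D: "D \<subseteq> A \<times> A"
    and c: "c \<in> unit_measure \<rightarrow>\<^sub>M count_space UNIV" "\<And>s. s \<in> {0..1} \<Longrightarrow> c s < K"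
    and w: "\<And>i. i < K \<Longrightarrow> unit.prob {s\<in>{0..1}. c s = i} = w i"
  shows "pdens A D (\<lambda>z. g (c (fst z)) (c (snd z))) = wdens A D {..<K} w g"
proof -
  let ?P = "\<Pi>\<^sub>M v\<in>A. unit_measure"
  have ind: "(\<lambda>s. of_bool (c s = i) :: real) \<in> borel_measurable unit_measure" for i
    using c(1) by measurable
  have int: "integrable unit_measure (\<lambda>s. of_bool (c s = i) :: real)" for i
    by (rule unit.integrable_const_bound [where B = 1]) (auto intro: ind)
  have prob: "(\<integral>s. of_bool (c s = i) \<partial>unit_measure) = w i" if "i < K" for i
  proof -
    have "(\<integral>s. of_bool (c s = i) \<partial>unit_measure) = (\<integral>s. indicator {s\<in>{0..1}. c s = i} s \<partial>unit_measure)"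
      by (intro Bochner_Integration.integral_cong) (auto simp: space_restrict_space)
    also have "\<dots> = unit.prob ({s\<in>{0..1}. c s = i} \<inter> space unit_measure)" by simp
    also have "{s\<in>{0..1}. c s = i} \<inter> space unit_measure = {s\<in>{0..1}. c s = i}"
      by (auto simp: space_restrict_space)
    finally show ?thesis using w [OF that] by simp
  qed
  have "pdens A D (\<lambda>z. g (c (fst z)) (c (snd z))) =
      (\<integral>x. (\<Sum>y\<in>A \<rightarrow>\<^sub>E {..<K}. (\<Prod>v\<in>A. of_bool (c (x v) = y v)) * edge_prod D g y) \<partial>?P)"
    unfolding pdens_def fst_conv snd_conv
    by (intro Bochner_Integration.integral_cong refl edge_prod_expand A D)
       (use c in \<open>auto simp: space_PiM space_restrict_space PiE_iff\<close>)
  also have "\<dots> = (\<Sum>y\<in>A \<rightarrow>\<^sub>E {..<K}. (\<integral>x. (\<Prod>v\<in>A. of_bool (c (x v) = y v)) \<partial>?P) * edge_prod D g y)"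
    by (subst Bochner_Integration.integral_sum)
       (use unit_product.product_integrable_prod [OF A int] in auto)
  also have "\<dots> = wdens A D {..<K} w g"
    unfolding wdens_def wsum_def
  proof (intro sum.cong refl arg_cong2 [of _ _ _ _ "(*)"])
    fix y assume y: "y \<in> A \<rightarrow>\<^sub>E {..<K}"
    have "(\<integral>x. (\<Prod>v\<in>A. of_bool (c (x v) = y v) :: real) \<partial>?P) = (\<Prod>v\<in>A. \<integral>s. of_bool (c s = y v) \<partial>unit_measure)"
      by (rule unit_product.product_integral_prod [OF A int])
    also have "\<dots> = (\<Prod>v\<in>A. w (y v))" using y by (intro prod.cong prob) auto
    finally show "(\<integral>x. (\<Prod>v\<in>A. of_bool (c (x v) = y v) :: real) \<partial>?P) = (\<Prod>v\<in>A. w (y v))" .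
  qed
  finally show ?thesis .
qed

text \<open>A double integral is the density of a single oriented edge, here from
  \<open>False\<close> to \<open>True\<close>, so \<open>pdens_step\<close> already computes
  it.\<close>

lemma integral_pair_step:
  fixes c :: "real \<Rightarrow> nat" and g :: "nat \<Rightarrow> nat \<Rightarrow> real"
  assumes c: "c \<in> unit_measure \<rightarrow>\<^sub>M count_space UNIV" "\<And>s. s \<in> {0..1} \<Longrightarrow> c s < K"
    and w: "\<And>i. i < K \<Longrightarrow> unit.prob {s\<in>{0..1}. c s = i} = w i"
  shows "(\<integral>z. g (c (fst z)) (c (snd z)) \<partial>(unit_measure \<Otimes>\<^sub>M unit_measure)) = (\<Sum>i<K. \<Sum>j<K. w i * w j * g i j)"
proof -
  let ?P = "\<Pi>\<^sub>M v\<in>UNIV :: bool set. unit_measure"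
  let ?h = "\<lambda>z. g (c (fst z)) (c (snd z))"
  have [measurable]: "c \<in> unit_measure \<rightarrow>\<^sub>M count_space UNIV" by (rule c)
  have g: "(\<lambda>(i, j). g i j) \<in> count_space UNIV \<rightarrow>\<^sub>M borel" by simp
  have cc: "(\<lambda>z. (c (fst z), c (snd z))) \<in> unit_measure \<Otimes>\<^sub>M unit_measure \<rightarrow>\<^sub>M count_space (UNIV :: (nat \<times> nat) set)"
    unfolding UNIV_Times_UNIV [symmetric] pair_measure_countable [symmetric, OF countableI_type countableI_type]
    by measurable
  have h: "?h \<in> borel_measurable (unit_measure \<Otimes>\<^sub>M unit_measure)"
    using measurable_compose [OF cc g] by simp
  have "(\<integral>z. ?h z \<partial>(unit_measure \<Otimes>\<^sub>M unit_measure)) = (\<integral>z. ?h z \<partial>(distr ?P (unit_measure \<Otimes>\<^sub>M unit_measure) (\<lambda>x. (x False, x True))))"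
    by (subst distr_PiM_pair [OF prob_space_unit_measure]) auto
  also have "\<dots> = pdens UNIV {(False, True)} ?h"
    unfolding pdens_def by (subst integral_distr) (auto simp: edge_prod_def [abs_def] h intro!: measurable_PiM_pair)
  also have "\<dots> = wdens UNIV {(False, True)} {..<K} w g"
    by (rule pdens_step [OF _ _ c w]) auto
  also have "\<dots> = wsum {False, True} {..<K} w (\<lambda>x. g (x False) (x True))"
    by (simp add: wdens_def edge_prod_def [abs_def] UNIV_bool)
  also have "\<dots> = (\<Sum>i<K. \<Sum>j<K. w i * w j * g i j)"
    by (simp add: wsum_insert sum_distrib_left mult.assoc) (simp add: wsum_def)
  finally show ?thesis .
qed

lemma measurable_unit_pair:
  assumes "f \<in> borel_measurable (borel \<Otimes>\<^sub>M borel)"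
  shows "f \<in> borel_measurable (unit_measure \<Otimes>\<^sub>M unit_measure)"
proof -
  have [measurable]: "(\<lambda>x. x) \<in> unit_measure \<rightarrow>\<^sub>M borel" by (rule measurable_restrict_space1) simp
  have "(\<lambda>z. (fst z, snd z)) \<in> unit_measure \<Otimes>\<^sub>M unit_measure \<rightarrow>\<^sub>M borel \<Otimes>\<^sub>M borel" by measurable
  from measurable_compose [OF this assms] show ?thesis by simp
qed

lemma integrable_unit_pair:
  fixes f :: "real \<times> real \<Rightarrow> real"
  assumes "f \<in> borel_measurable (borel \<Otimes>\<^sub>M borel)" "\<And>z. \<bar>f z\<bar> \<le> c"
  shows "integrable (unit_measure \<Otimes>\<^sub>M unit_measure) f"
  by (rule unit_pair.integrable_const_bound [where B = c])
     (use assms measurable_unit_pair in auto)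

section \<open>The martingale of step graphons\<close>

lemma sum_blocks_4:
  fixes h :: "nat \<Rightarrow> real"
  shows "(\<Sum>i<4 * n. h i) = (\<Sum>i<n. \<Sum>a<4. h (4 * i + a))"
proof -
  have "(\<Sum>a<4. h (4 * i + a)) = (\<Sum>j = i * 4..<i * 4 + 4. h j)" for i
    using sum.shift_bounds_nat_ivl [of h 0 "i * 4" 4] by (simp add: atLeast0LessThan mult.commute add.commute)
  then show ?thesis using sum.nat_group [of h 4 n] by (simp add: mult.commute)
qed

context step_limit
begin

text \<open>Left end point of the interval that represents class \<open>i\<close>. Intervals follow
  the order of the codes, so the four children of a class tile its interval.\<close>

definition left :: "nat \<Rightarrow> nat \<Rightarrow> real" where
  "left m i = (\<Sum>j<i. w m j)"

lemma left_refine: "left (Suc m) (4 * i) = left m i"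
  unfolding left_def sum_blocks_4 w_refine [symmetric] ..

lemma left_mono: "i \<le> j \<Longrightarrow> left m i \<le> left m j"
  unfolding left_def by (rule sum_mono2) (auto simp: w_nonneg)

lemma left_0: "left m 0 = 0" by (simp add: left_def)

lemma left_top: "left m (4 ^ m) = 1" by (simp add: left_def w_total)

text \<open>\<open>LEAST\<close> passes over classes of weight 0, whose half-open intervals are
  empty. The point 1 lies in no interval; the default 0 there and outside the unit interval keeps
  \<open>code_less\<close> and \<open>code_refine\<close> valid for every \<open>x\<close>.\<close>

definition code :: "nat \<Rightarrow> real \<Rightarrow> nat" where
  "code m x = (if x \<in> {0..<1} then LEAST i. x < left m (Suc i) else 0)"

lemma code_measurable: "code m \<in> unit_measure \<rightarrow>\<^sub>M count_space UNIV"
proof -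
  have "code m \<in> lborel \<rightarrow>\<^sub>M count_space UNIV" unfolding code_def [abs_def] by measurable
  then show ?thesis by (rule measurable_restrict_space1)
qed

lemma code_unique:
  assumes "0 \<le> x" "x < 1" "left m i \<le> x" "x < left m (Suc i)"
  shows "code m x = i"
proof -
  have "(LEAST i. x < left m (Suc i)) = i"
  proof (rule Least_equality)
    fix j assume "x < left m (Suc j)"
    then show "i \<le> j" using assms(3) left_mono [of "Suc j" i m] by (force simp: not_le [symmetric])
  qed fact
  then show ?thesis using assms by (simp add: code_def)
qed

lemma code_bounds:
  assumes "0 \<le> x" "x < 1"
  shows "left m (code m x) \<le> x" "x < left m (Suc (code m x))"
proof -
  have ex: "x < left m (Suc (4 ^ m - 1))" using assms by (simp add: left_top)
  then show "x < left m (Suc (code m x))"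
    using LeastI [of "\<lambda>i. x < left m (Suc i)", OF ex] assms by (simp add: code_def)
  show "left m (code m x) \<le> x"
  proof (cases "code m x")
    case (Suc j)
    then have "j < (LEAST i. x < left m (Suc i))" using assms by (simp add: code_def)
    from not_less_Least [OF this] Suc show ?thesis by simp
  qed (use assms in \<open>simp add: left_0\<close>)
qed

lemma code_less: "code m x < 4 ^ m"
proof (cases "x \<in> {0..<1}")
  case True
  show ?thesis
  proof (rule ccontr)
    assume "\<not> code m x < 4 ^ m"
    then have "left m (4 ^ m) \<le> left m (code m x)" by (intro left_mono) simp
    also have "\<dots> \<le> x" using True by (intro code_bounds) auto
    finally show False using True by (simp add: left_top)
  qed
qed (auto simp: code_def)

lemma code_refine: "code (Suc m) x div 4 = code m x"
proof (cases "x \<in> {0..<1}")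
  case True
  then have x: "0 \<le> x" "x < 1" by auto
  let ?i = "code (Suc m) x"
  have "left m (?i div 4) \<le> left (Suc m) ?i"
    unfolding left_refine [of m "?i div 4", symmetric] by (rule left_mono) simp
  also have "\<dots> \<le> x" by (rule code_bounds [OF x])
  finally have 1: "left m (?i div 4) \<le> x" .
  have "x < left (Suc m) (Suc ?i)" by (rule code_bounds [OF x])
  also have "\<dots> \<le> left m (Suc (?i div 4))"
    unfolding left_refine [of m "Suc (?i div 4)", symmetric] by (rule left_mono) simp
  finally have 2: "x < left m (Suc (?i div 4))" .
  from code_unique [OF x 1 2] show ?thesis by simp
qed (auto simp: code_def)

lemma code_div: "code (m + k) x div 4 ^ k = code m x"
proof (induction k)
  case (Suc k)
  have "code (m + Suc k) x div 4 ^ Suc k = code (Suc (m + k)) x div 4 div 4 ^ k"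
    by (simp add: div_mult2_eq)
  then show ?case by (simp add: code_refine Suc)
qed simp

lemma prob_code:
  assumes i: "i < 4 ^ m"
  shows "unit.prob {x\<in>{0..1}. code m x = i} = w m i"
proof -
  have le1: "left m (Suc i) \<le> 1" using left_mono [of "Suc i" "4 ^ m" m] i by (simp add: left_top)
  have ge0: "0 \<le> left m i" using left_mono [of 0 i m] by (simp add: left_0)
  have sets: "{x\<in>{0..1}. code m x = i} \<in> sets lborel"
    using measurable_sets [OF code_measurable [of m], of "{i}"]
    by (auto simp: sets_restrict_space space_restrict_space vimage_def Int_def conj_ac image_iff)
  have "unit.prob {x\<in>{0..1}. code m x = i} = measure lborel {x\<in>{0..1}. code m x = i}"
    by (rule measure_restrict_space) auto
  also have "\<dots> = measure lborel {left m i..<left m (Suc i)}"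
  proof (rule measure_eq_AE)
    \<comment> \<open>The point 1 has the default code 0 without lying in the interval of class 0;
      everywhere else the two sets agree.\<close>
    have "AE x in lborel. x \<noteq> (1 :: real)" by (rule AE_lborel_singleton)
    then show "AE x in lborel. (x \<in> {x\<in>{0..1}. code m x = i}) = (x \<in> {left m i..<left m (Suc i)})"
    proof eventually_elim
      case (elim x)
      show ?case
      proof
        assume "x \<in> {x\<in>{0..1}. code m x = i}"
        then show "x \<in> {left m i..<left m (Suc i)}"
          using code_bounds [of x m] elim by auto
      next
        assume x: "x \<in> {left m i..<left m (Suc i)}"
        then have "0 \<le> x" "x < 1" using le1 ge0 by auto
        then show "x \<in> {x\<in>{0..1}. code m x = i}"
          using code_unique [of x m i] x by auto
      qed
    qed
  qed (use sets in auto)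
  also have "\<dots> = w m i"
    using left_mono [of i "Suc i" m] by (simp add: left_def w_nonneg)
  finally show ?thesis .
qed

section \<open>Step functions and orthogonality of their increments\<close>

definition step :: "nat \<Rightarrow> real \<times> real \<Rightarrow> real" where
  "step m z = d m (code m (fst z)) (code m (snd z))"

lemma step_bounds: "0 \<le> step m z \<and> step m z \<le> 1"
  by (simp add: step_def d_bounds)

lemma code_pair_measurable:
  fixes g :: "nat \<Rightarrow> nat \<Rightarrow> real"
  shows "(\<lambda>z. g (code m (fst z)) (code m (snd z))) \<in> borel_measurable (borel \<Otimes>\<^sub>M borel)"
proof -
  have [measurable]: "code m \<in> borel \<rightarrow>\<^sub>M count_space UNIV" unfolding code_def [abs_def] by measurable
  have "(\<lambda>z. (code m (fst z), code m (snd z))) \<in> borel \<Otimes>\<^sub>M borel \<rightarrow>\<^sub>M count_space (UNIV :: (nat \<times> nat) set)"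
    unfolding UNIV_Times_UNIV [symmetric] pair_measure_countable [symmetric, OF countableI_type countableI_type]
    by measurable
  from measurable_compose [OF this, of "\<lambda>(i, j). g i j" borel] show ?thesis by simp
qed

lemma step_measurable: "step m \<in> borel_measurable (borel \<Otimes>\<^sub>M borel)"
  unfolding step_def [abs_def] by (rule code_pair_measurable)

lemma pdens_step_toggle:
  assumes "finite A" "D \<subseteq> A \<times> A"
  shows "pdens A D (\<lambda>z. toggle b (step m z)) = wdens A D {..<4 ^ m} (w m) (\<lambda>i j. toggle b (d m i j))"
  unfolding step_def by (rule pdens_step [OF assms code_measurable code_less prob_code])

lemma integral_code_pair:
  fixes g :: "nat \<Rightarrow> nat \<Rightarrow> real"
  shows "(\<integral>z. g (code m (fst z)) (code m (snd z)) \<partial>(unit_measure \<Otimes>\<^sub>M unit_measure)) =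
    (\<Sum>i<4 ^ m. \<Sum>j<4 ^ m. w m i * w m j * g i j)"
  by (rule integral_pair_step [OF code_measurable code_less prob_code])

text \<open>The martingale property in weak form: consecutive step functions have equal integrals
  against every function constant on the coarser blocks.\<close>

lemma sum_dens_refine:
  fixes g :: "nat \<Rightarrow> nat \<Rightarrow> real"
  shows "(\<Sum>i<4 ^ Suc m. \<Sum>j<4 ^ Suc m. w (Suc m) i * w (Suc m) j * d (Suc m) i j * g (i div 4) (j div 4)) =
    (\<Sum>i<4 ^ m. \<Sum>j<4 ^ m. w m i * w m j * d m i j * g i j)"
proof -
  have div: "(4 * i + a) div 4 = i" if "a < 4" for i a :: nat
    using that by (intro div_nat_eqI) auto
  have "(\<Sum>i<4 ^ Suc m. \<Sum>j<4 ^ Suc m. w (Suc m) i * w (Suc m) j * d (Suc m) i j * g (i div 4) (j div 4)) =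
    (\<Sum>i<4 ^ m. \<Sum>a<4. \<Sum>j<4 ^ m. \<Sum>b<4.
      w (Suc m) (4 * i + a) * w (Suc m) (4 * j + b) * d (Suc m) (4 * i + a) (4 * j + b) * g i j)"
    unfolding power_Suc sum_blocks_4 by (intro sum.cong refl) (simp add: div)
  also have "\<dots> = (\<Sum>i<4 ^ m. \<Sum>j<4 ^ m. (\<Sum>a<4. \<Sum>b<4.
      w (Suc m) (4 * i + a) * w (Suc m) (4 * j + b) * d (Suc m) (4 * i + a) (4 * j + b)) * g i j)"
    unfolding sum_distrib_right by (rule sum.cong [OF refl]) (rule sum.swap)
  finally show ?thesis by (simp add: d_refine [symmetric])
qed

lemma sum_dens_refine_iterated:
  fixes g :: "nat \<Rightarrow> nat \<Rightarrow> real"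
  shows "(\<Sum>i<4 ^ (m + k). \<Sum>j<4 ^ (m + k). w (m + k) i * w (m + k) j * d (m + k) i j * g (i div 4 ^ k) (j div 4 ^ k)) =
    (\<Sum>i<4 ^ m. \<Sum>j<4 ^ m. w m i * w m j * d m i j * g i j)"
proof (induction k)
  case (Suc k)
  then show ?case
    using sum_dens_refine [of "m + k" "\<lambda>i j. g (i div 4 ^ k) (j div 4 ^ k)"]
    by (simp only: add_Suc_right power_Suc div_mult2_eq)
qed simp

lemma integral_step_square: "(\<integral>z. (step m z)\<^sup>2 \<partial>(unit_measure \<Otimes>\<^sub>M unit_measure)) = E m"
  unfolding step_def E_def energy_def by (rule integral_code_pair [of "\<lambda>i j. (d m i j)\<^sup>2"])

text \<open>Here the coarse step function is its own test function. The inner product is independent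
  of \<open>k\<close>, which makes squared L2 distances equal to energy differences.\<close>

lemma integral_step_mult:
  "(\<integral>z. step (m + k) z * step m z \<partial>(unit_measure \<Otimes>\<^sub>M unit_measure)) = E m"
proof -
  have "step (m + k) z * step m z = d (m + k) (code (m + k) (fst z)) (code (m + k) (snd z)) *
      d m (code (m + k) (fst z) div 4 ^ k) (code (m + k) (snd z) div 4 ^ k)" for z
    by (simp add: step_def code_div)
  then have "(\<integral>z. step (m + k) z * step m z \<partial>(unit_measure \<Otimes>\<^sub>M unit_measure)) =
      (\<Sum>i<4 ^ (m + k). \<Sum>j<4 ^ (m + k). w (m + k) i * w (m + k) j * (d (m + k) i j * d m (i div 4 ^ k) (j div 4 ^ k)))"
    by (simp only: integral_code_pair [of "\<lambda>i j. d (m + k) i j * d m (i div 4 ^ k) (j div 4 ^ k)" "m + k"])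
  also have "\<dots> = E m"
    using sum_dens_refine_iterated [where g = "d m", of m k]
    by (simp only: mult.assoc E_def energy_def power2_eq_square)
  finally show ?thesis .
qed

lemma integral_step_diff_square:
  "(\<integral>z. (step (m + k) z - step m z)\<^sup>2 \<partial>(unit_measure \<Otimes>\<^sub>M unit_measure)) = E (m + k) - E m"
proof -
  note [measurable] = step_measurable
  have b: "\<bar>step m z\<bar> \<le> 1" for m z using step_bounds [of m z] by simp
  have sq: "integrable (unit_measure \<Otimes>\<^sub>M unit_measure) (\<lambda>z. (step m z)\<^sup>2)" for m
    by (rule integrable_unit_pair [where c = 1]) (use b in \<open>auto simp: abs_square_le_1\<close>)
  have mult: "integrable (unit_measure \<Otimes>\<^sub>M unit_measure) (\<lambda>z. step l z * step m z)" for l m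
    by (rule integrable_unit_pair [where c = 1]) (use b in \<open>auto simp: abs_mult intro: mult_le_one\<close>)
  have "(\<integral>z. (step (m + k) z - step m z)\<^sup>2 \<partial>(unit_measure \<Otimes>\<^sub>M unit_measure)) =
    (\<integral>z. (step (m + k) z)\<^sup>2 - 2 * (step (m + k) z * step m z) + (step m z)\<^sup>2 \<partial>(unit_measure \<Otimes>\<^sub>M unit_measure))"
    by (simp add: power2_diff algebra_simps)
  also have "\<dots> = E (m + k) - 2 * E m + E m"
    using sq mult by (simp add: integral_step_square integral_step_mult)
  finally show ?thesis by simp
qed

lemma E_mono: "m \<le> n \<Longrightarrow> E m \<le> E n"
proof -
  assume "m \<le> n"
  then obtain k where "n = m + k" using le_Suc_ex by blast
  moreover have "0 \<le> (\<integral>z. (step (m + k) z - step m z)\<^sup>2 \<partial>(unit_measure \<Otimes>\<^sub>M unit_measure))"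
    by (rule Bochner_Integration.integral_nonneg) simp
  ultimately show ?thesis using integral_step_diff_square [of m k] by simp
qed

lemma E_le_1: "E m \<le> 1"
proof -
  have "E m \<le> (\<integral>z. 1 \<partial>(unit_measure \<Otimes>\<^sub>M unit_measure))"
    unfolding integral_step_square [symmetric]
  proof (rule integral_mono)
    show "integrable (unit_measure \<Otimes>\<^sub>M unit_measure) (\<lambda>z. (step m z)\<^sup>2)"
      using step_bounds step_measurable
      by (intro integrable_unit_pair [where c = 1]) (auto simp: abs_square_le_1)
  qed (use step_bounds in \<open>auto simp: abs_square_le_1\<close>)
  then show ?thesis by (simp add: unit_pair.prob_space)
qed

lemma E_nonneg: "0 \<le> E m"
  by (subst integral_step_square [symmetric], rule Bochner_Integration.integral_nonneg) simp

lemma E_convergent: "convergent E"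
proof (rule Bseq_mono_convergent)
  show "Bseq E" by (rule BseqI' [of _ 1]) (simp add: E_le_1 E_nonneg)
  show "\<forall>m n. m \<le> n \<longrightarrow> E m \<le> E n" by (blast intro: E_mono)
qed

end

section \<open>The limit graphon\<close>

lemma (in prob_space) expectation_abs_le_sqrt:
  fixes X :: "'a \<Rightarrow> real"
  assumes "integrable M X" "integrable M (\<lambda>x. (X x)\<^sup>2)"
  shows "expectation (\<lambda>x. \<bar>X x\<bar>) \<le> sqrt (expectation (\<lambda>x. (X x)\<^sup>2))"
proof -
  have "variance (\<lambda>x. \<bar>X x\<bar>) = expectation (\<lambda>x. (X x)\<^sup>2) - (expectation (\<lambda>x. \<bar>X x\<bar>))\<^sup>2"
    by (subst variance_eq) (use assms in auto)
  then show ?thesis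
    using variance_positive [of "\<lambda>x. \<bar>X x\<bar>"] by (intro real_le_rsqrt) simp
qed

context step_limit
begin

lemma integral_step_abs_diff_le:
  "(\<integral>z. \<bar>step m z - step n z\<bar> \<partial>(unit_measure \<Otimes>\<^sub>M unit_measure)) \<le> sqrt \<bar>E m - E n\<bar>"
proof -
  note [measurable] = step_measurable
  have le: "(\<integral>z. \<bar>step (m + k) z - step m z\<bar> \<partial>(unit_measure \<Otimes>\<^sub>M unit_measure)) \<le> sqrt \<bar>E (m + k) - E m\<bar>" for m k
  proof -
    have bound: "\<bar>step (m + k) z - step m z\<bar> \<le> 1" for z
      using step_bounds [of m z] step_bounds [of "m + k" z] by (auto simp: abs_if)
    have "(\<integral>z. \<bar>step (m + k) z - step m z\<bar> \<partial>(unit_measure \<Otimes>\<^sub>M unit_measure)) \<le>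
        sqrt (\<integral>z. (step (m + k) z - step m z)\<^sup>2 \<partial>(unit_measure \<Otimes>\<^sub>M unit_measure))"
    proof (rule unit_pair.expectation_abs_le_sqrt)
      show "integrable (unit_measure \<Otimes>\<^sub>M unit_measure) (\<lambda>z. step (m + k) z - step m z)"
        by (rule integrable_unit_pair [where c = 1]) (use bound in auto)
      show "integrable (unit_measure \<Otimes>\<^sub>M unit_measure) (\<lambda>z. (step (m + k) z - step m z)\<^sup>2)"
        by (rule integrable_unit_pair [where c = 1]) (use bound in \<open>auto simp: abs_square_le_1\<close>)
    qed
    also have "\<dots> = sqrt \<bar>E (m + k) - E m\<bar>"
      using E_mono [of m "m + k"] by (simp add: integral_step_diff_square)
    finally show ?thesis .
  qed
  show ?thesis
  proof (cases "n \<le> m")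
    case True
    then obtain k where "m = n + k" using le_Suc_ex by blast
    then show ?thesis using le by simp
  next
    case False
    then obtain k where "n = m + k" using le_Suc_ex by (metis nat_le_linear)
    then show ?thesis using le [of m k] by (simp add: abs_minus_commute)
  qed
qed

text \<open>Energies are monotone and bounded, so the step functions are Cauchy in L2 and hence in
  L1. A subsequence converging almost everywhere is all that is wanted of martingale
  convergence.\<close>

lemma step_Cauchy_subseq:
  "\<exists>s. strict_mono s \<and> (AE z in unit_measure \<Otimes>\<^sub>M unit_measure. Cauchy (\<lambda>i. step (s i) z))"
proof (rule cauchy_L1_AE_cauchy_subseq [of "unit_measure \<Otimes>\<^sub>M unit_measure" step])
  show "integrable (unit_measure \<Otimes>\<^sub>M unit_measure) (step m)" for m
    by (rule integrable_unit_pair [where c = 1]) (use step_bounds step_measurable in auto)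
  fix e :: real assume "e > 0"
  then have "e\<^sup>2 > 0" by simp
  with E_convergent obtain N where N: "\<And>m n. m \<ge> N \<Longrightarrow> n \<ge> N \<Longrightarrow> \<bar>E m - E n\<bar> < e\<^sup>2"
    by (metis CauchyD real_norm_def Cauchy_convergent_iff)
  have "(\<integral>z. norm (step m z - step n z) \<partial>(unit_measure \<Otimes>\<^sub>M unit_measure)) < e" if "m \<ge> N" "n \<ge> N" for m n
  proof -
    have "sqrt \<bar>E m - E n\<bar> < sqrt (e\<^sup>2)" using N [OF that] by (rule real_sqrt_less_mono)
    then show ?thesis using integral_step_abs_diff_le [of m n] \<open>e > 0\<close> by simp
  qed
  then show "\<exists>N. \<forall>i\<ge>N. \<forall>j\<ge>N. (\<integral>z. norm (step i z - step j z) \<partial>(unit_measure \<Otimes>\<^sub>M unit_measure)) < e"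
    by blast
qed auto

definition sub :: "nat \<Rightarrow> nat" where
  "sub = (SOME s. strict_mono s \<and> (AE z in unit_measure \<Otimes>\<^sub>M unit_measure. Cauchy (\<lambda>i. step (s i) z)))"

text \<open>Where the sequence does not converge, the value of \<open>lim\<close> is unspecified; the truncation keeps
  it in the unit interval.\<close>

definition limit :: "real \<times> real \<Rightarrow> real" where
  "limit z = max 0 (min 1 (lim (\<lambda>i. step (sub i) z)))"

lemma sub: "strict_mono sub" "AE z in unit_measure \<Otimes>\<^sub>M unit_measure. Cauchy (\<lambda>i. step (sub i) z)"
  unfolding sub_def using someI_ex [OF step_Cauchy_subseq] by auto

lemma limit_bounds: "0 \<le> limit z \<and> limit z \<le> 1"
  by (simp add: limit_def)

text \<open>This holds even where the step functions diverge, because both sides apply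
  \<open>lim\<close> to the same sequence.\<close>

lemma limit_sym: "limit (x, y) = limit (y, x)"
  by (simp add: limit_def step_def d_sym)

lemma limit_measurable: "limit \<in> borel_measurable (borel \<Otimes>\<^sub>M borel)"
proof -
  note [measurable] = step_measurable
  show ?thesis unfolding limit_def [abs_def] by measurable
qed

lemma AE_tendsto_limit: "AE z in unit_measure \<Otimes>\<^sub>M unit_measure. (\<lambda>i. step (sub i) z) \<longlonglongrightarrow> limit z"
  using sub(2)
proof eventually_elim
  case (elim z)
  then have L: "(\<lambda>i. step (sub i) z) \<longlonglongrightarrow> lim (\<lambda>i. step (sub i) z)"
    by (simp add: Cauchy_convergent_iff convergent_LIMSEQ_iff)
  have "0 \<le> lim (\<lambda>i. step (sub i) z)" "lim (\<lambda>i. step (sub i) z) \<le> 1"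
    using step_bounds [of _ z] by (auto intro!: LIMSEQ_le_const [OF L] LIMSEQ_le_const2 [OF L])
  with L show ?case by (simp add: limit_def)
qed

lemma graphon_limit: "graphon limit"
proof -
  have "limit \<in> borel_measurable borel" using limit_measurable by (simp add: borel_prod)
  then have "limit \<in> borel_measurable (lebesgue_on ({0..1} \<times> {0..1}))"
    by (intro measurable_restrict_space1 measurable_completion) simp
  then show ?thesis
    unfolding graphon_def using limit_bounds limit_sym by blast
qed

text \<open>Energy increments tend to 0, so the densities of the step functions tend to
  \<open>x\<close>; along \<open>sub\<close> they also tend to the density of
  \<open>limit\<close>.\<close>

lemma pdens_limit_eq:
  assumes A: "finite A" and D: "D \<subseteq> A \<times> A" "asym D"
    and x: "\<And>m. \<bar>x - wdens A D {..<4 ^ m} (w m) (\<lambda>i j. toggle b (d m i j))\<bar> \<le> real (card D) * sqrt (E (Suc m) - E m)"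
  shows "pdens A D (\<lambda>z. toggle b (limit z)) = x"
proof -
  have [measurable]: "toggle b \<in> borel_measurable borel"
    unfolding toggle_def [abs_def] by measurable
  note [measurable] = measurable_unit_pair [OF step_measurable] measurable_unit_pair [OF limit_measurable]
  have "(\<lambda>i. pdens A D (\<lambda>z. toggle b (step (sub i) z))) \<longlonglongrightarrow> pdens A D (\<lambda>z. toggle b (limit z))"
  proof (rule pdens_tendsto [OF A D])
    show "0 \<le> toggle b (step (sub i) z) \<and> toggle b (step (sub i) z) \<le> 1" for i z
      by (rule toggle_bounds [OF step_bounds])
    show "AE z in unit_measure \<Otimes>\<^sub>M unit_measure. (\<lambda>i. toggle b (step (sub i) z)) \<longlonglongrightarrow> toggle b (limit z)"
      using AE_tendsto_limit by eventually_elim (rule tendsto_toggle)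
  qed measurable
  moreover have "(\<lambda>m. pdens A D (\<lambda>z. toggle b (step m z))) \<longlonglongrightarrow> x"
  proof -
    obtain l where l: "E \<longlonglongrightarrow> l" using E_convergent by (auto simp: convergent_def)
    have "(\<lambda>m. real (card D) * sqrt (E (Suc m) - E m)) \<longlonglongrightarrow> real (card D) * sqrt (l - l)"
      by (intro tendsto_intros l LIMSEQ_Suc)
    then have "(\<lambda>m. real (card D) * sqrt (E (Suc m) - E m)) \<longlonglongrightarrow> 0" by simp
    then have "(\<lambda>m. pdens A D (\<lambda>z. toggle b (step m z)) - x) \<longlonglongrightarrow> 0"
    proof (rule Lim_null_comparison [rotated], intro always_eventually allI)
      show "norm (pdens A D (\<lambda>z. toggle b (step m z)) - x) \<le> real (card D) * sqrt (E (Suc m) - E m)" for m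
        using x [of m] by (simp add: pdens_step_toggle [OF A D(1)] abs_minus_commute)
    qed
    then show ?thesis by (simp add: LIM_zero_iff)
  qed
  from LIMSEQ_subseq_LIMSEQ [OF this sub(1)]
  have "(\<lambda>i. pdens A D (\<lambda>z. toggle b (step (sub i) z))) \<longlonglongrightarrow> x" by (simp add: o_def)
  ultimately show ?thesis by (rule LIMSEQ_unique)
qed

end

text \<open>There are two index types, so that the same limit serves a pair of graphs with different
  vertex types.\<close>

lemma graphon_compactness:
  fixes V :: "nat \<Rightarrow> 'w set" and A1 :: "'a set" and A2 :: "'b set"
  assumes wt: "\<And>n. weighted_set (V n) (p n)"
    and f: "\<And>n s t. s \<in> V n \<Longrightarrow> t \<in> V n \<Longrightarrow> 0 \<le> f n s t \<and> f n s t \<le> 1"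
    and sym: "\<And>n s t. s \<in> V n \<Longrightarrow> t \<in> V n \<Longrightarrow> f n s t = f n t s"
    and D1: "finite A1" "D1 \<subseteq> A1 \<times> A1" "asym D1"
    and D2: "finite A2" "D2 \<subseteq> A2 \<times> A2" "asym D2"
    and x1: "(\<lambda>n. wdens A1 D1 (V n) (p n) (f n)) \<longlonglongrightarrow> x1"
    and x2: "(\<lambda>n. wdens A2 D2 (V n) (p n) (\<lambda>s t. 1 - f n s t)) \<longlonglongrightarrow> x2"
  obtains W where "graphon W" "W \<in> borel_measurable (borel \<Otimes>\<^sub>M borel)"
    "pdens A1 D1 W = x1" "pdens A2 D2 (\<lambda>z. 1 - W z) = x2"
proof -
  obtain r w d where r: "strict_mono r" and "step_limit w d"
    and conv: "step_converges (V \<circ> r) (p \<circ> r) (f \<circ> r) w d"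
    by (rule step_limit_exists [of V p f]) (use wt f sym in auto)
  then interpret step_limit w d by simp
  have "pdens A1 D1 (\<lambda>z. toggle False (limit z)) = x1"
    using LIMSEQ_subseq_LIMSEQ [OF x1 r]
    by (intro pdens_limit_eq [OF D1] wdens_limit_diff_le [OF _ _ conv D1])
       (use wt f in \<open>auto simp: o_def toggle_def\<close>)
  moreover have "pdens A2 D2 (\<lambda>z. toggle True (limit z)) = x2"
    using LIMSEQ_subseq_LIMSEQ [OF x2 r]
    by (intro pdens_limit_eq [OF D2] wdens_limit_diff_le [OF _ _ conv D2])
       (use wt f in \<open>auto simp: o_def toggle_def\<close>)
  ultimately show thesis
    using that [OF graphon_limit limit_measurable] by (simp add: toggle_def)
qed

section \<open>Graphon densities as product integrals\<close>

text \<open>Measurability of \<open>f\<close> comes from completeness: each of its preimages differs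
  from one of \<open>g\<close> by a null set.\<close>

lemma integral_completion_AE:
  fixes f g :: "'a \<Rightarrow> real"
  assumes g: "g \<in> borel_measurable M" and ae: "AE x in M. f x = g x"
  shows "integral\<^sup>L (completion M) f = integral\<^sup>L M g"
proof -
  have ae': "AE x in completion M. f x = g x" using ae by (rule AE_completion)
  have g': "g \<in> borel_measurable (completion M)" using g by (rule measurable_completion)
  have "f \<in> borel_measurable (completion M)"
  proof (rule measurableI)
    fix S :: "real set" assume S: "S \<in> sets borel"
    show "f -` S \<inter> space (completion M) \<in> sets (completion M)"
    proof (rule completion.in_sets_AE)
      show "g -` S \<inter> space (completion M) \<in> sets (completion M)"
        using g' S by (rule measurable_sets)
      show "AE x in completion M. (x \<in> g -` S \<inter> space (completion M)) = (x \<in> f -` S \<inter> space (completion M))"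
        using ae' by eventually_elim auto
    qed auto
  qed simp
  then have "integral\<^sup>L (completion M) f = integral\<^sup>L (completion M) g"
    using ae' g' by (intro integral_cong_AE) auto
  then show ?thesis by (simp add: integral_completion [OF g])
qed

text \<open>Argue by sections: almost every section of a Borel null set of the plane is null,
  restriction to the unit interval preserves this in each coordinate, and the product of the
  restricted measures sees a null set again.\<close>

lemma AE_unit_pair:
  assumes "AE z in lborel. P z"
  shows "AE z in unit_measure \<Otimes>\<^sub>M unit_measure. P z"
proof -
  have "AE z in lborel \<Otimes>\<^sub>M lborel. P z" using assms by (subst lborel_prod)
  then obtain N where N: "{z \<in> space (lborel \<Otimes>\<^sub>M lborel). \<not> P z} \<subseteq> N" "N \<in> null_sets (lborel \<Otimes>\<^sub>M lborel)"
    unfolding eventually_ae_filter by blast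
  have "AE x in lborel. AE y in lborel. (x, y) \<notin> N"
    by (rule lborel_pair.AE_pair [OF AE_not_in [OF N(2)]])
  then have "AE x in lborel. AE y in unit_measure. (x, y) \<notin> N"
    by eventually_elim (auto simp: AE_restrict_space_iff)
  then have ae: "AE x in unit_measure. AE y in unit_measure. (x, y) \<notin> N"
    by (auto simp: AE_restrict_space_iff)
  have "AE z in unit_measure \<Otimes>\<^sub>M unit_measure. z \<notin> N"
  proof (rule unit_pair.AE_pair_measure [OF _ ae])
    have "N \<in> sets (borel \<Otimes>\<^sub>M borel)"
      using N(2) by (metis null_setsD2 sets_lborel sets_pair_measure_cong)
    then have "(indicator N :: real \<times> real \<Rightarrow> real) \<in> borel_measurable (borel \<Otimes>\<^sub>M borel)" by simp
    then have "(indicator N :: real \<times> real \<Rightarrow> real) \<in> borel_measurable (unit_measure \<Otimes>\<^sub>M unit_measure)"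
      by (rule measurable_unit_pair)
    then have "space (unit_measure \<Otimes>\<^sub>M unit_measure) - N \<inter> space (unit_measure \<Otimes>\<^sub>M unit_measure)
        \<in> sets (unit_measure \<Otimes>\<^sub>M unit_measure)"
      unfolding borel_measurable_indicator_iff by (rule sets.compl_sets)
    moreover have "{z \<in> space (unit_measure \<Otimes>\<^sub>M unit_measure). z \<notin> N} =
        space (unit_measure \<Otimes>\<^sub>M unit_measure) - N \<inter> space (unit_measure \<Otimes>\<^sub>M unit_measure)" by blast
    ultimately show "{z \<in> space (unit_measure \<Otimes>\<^sub>M unit_measure). z \<notin> N} \<in> sets (unit_measure \<Otimes>\<^sub>M unit_measure)"
      by (simp only:)
  qed
  then show ?thesis by eventually_elim (use N(1) in \<open>auto simp: space_pair_measure\<close>)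
qed

lemma AE_unit_pair_swap:
  assumes "AE z in unit_measure \<Otimes>\<^sub>M unit_measure. P z"
  shows "AE z in unit_measure \<Otimes>\<^sub>M unit_measure. P (snd z, fst z)"
proof -
  have "AE z in distr (unit_measure \<Otimes>\<^sub>M unit_measure) (unit_measure \<Otimes>\<^sub>M unit_measure) (\<lambda>(x, y). (y, x)). P z"
    using assms by (subst unit_pair.distr_pair_swap [symmetric])
  then have "AE z in unit_measure \<Otimes>\<^sub>M unit_measure. P (case z of (x, y) \<Rightarrow> (y, x))"
    by (rule AE_distrD [rotated]) measurable
  then show ?thesis by (simp add: case_prod_unfold)
qed

lemma graphon_Borel_version:
  assumes "graphon W"
  obtains W' where "W' \<in> borel_measurable (borel \<Otimes>\<^sub>M borel)"
    "\<And>x y. W' (x, y) = W' (y, x)" "\<And>z. 0 \<le> W' z \<and> W' z \<le> 1"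
    "AE z in unit_measure \<Otimes>\<^sub>M unit_measure. W z = W' z"
proof -
  let ?S = "{0..1} \<times> {0..1} :: (real \<times> real) set"
  define W1 where "W1 z = (if z \<in> ?S then W z else 0)" for z
  have "W1 \<in> borel_measurable lebesgue"
    unfolding W1_def [abs_def]
    using assms by (subst borel_measurable_if) (auto simp: graphon_def intro: lmeasurable_compact [THEN fmeasurableD] compact_Times)
  from completion_ex_borel_measurable_real [OF this]
  obtain W0 where [measurable]: "W0 \<in> borel_measurable lborel" and ae: "AE z in lborel. W1 z = W0 z" by blast
  have [measurable]: "W0 \<in> borel_measurable (borel \<Otimes>\<^sub>M borel)"
    unfolding borel_prod using \<open>W0 \<in> borel_measurable lborel\<close> by simp
  \<comment> \<open>Averaging over the two orders and truncating make symmetry and bounds hold at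
    every point, as sampling needs. Where \<open>W0\<close> is correct at a point and at its mirror
    image, neither operation changes the value.\<close>
  define W' where "W' z = max 0 (min 1 ((W0 (fst z, snd z) + W0 (snd z, fst z)) / 2))" for z
  show thesis
  proof (rule that)
    show "W' \<in> borel_measurable (borel \<Otimes>\<^sub>M borel)" unfolding W'_def [abs_def] by measurable
    show "W' (x, y) = W' (y, x)" for x y by (simp add: W'_def add.commute)
    show "0 \<le> W' z \<and> W' z \<le> 1" for z by (simp add: W'_def)
    have ae1: "AE z in unit_measure \<Otimes>\<^sub>M unit_measure. W1 z = W0 z" using ae by (rule AE_unit_pair)
    have "AE z in unit_measure \<Otimes>\<^sub>M unit_measure. z \<in> ?S"
      by (rule AE_I2) (auto simp: space_pair_measure space_restrict_space)
    with ae1 AE_unit_pair_swap [OF ae1] show "AE z in unit_measure \<Otimes>\<^sub>M unit_measure. W z = W' z"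
    proof eventually_elim
      case (elim z)
      obtain x y where z: "z = (x, y)" by force
      from elim z assms have "W (x, y) = W (y, x)" "0 \<le> W (x, y)" "W (x, y) \<le> 1"
        by (auto simp: graphon_def)
      with elim z show ?case by (simp add: W1_def W'_def)
    qed
  qed
qed

text \<open>Replaces unordered edges by one ordered pair each. Asymmetry rules out loops and
  opposite pairs, as replacing one edge at a time requires.\<close>

definition orientation :: "'a ugraph \<Rightarrow> ('a \<times> 'a) set \<Rightarrow> bool" where
  "orientation H D \<longleftrightarrow> D \<subseteq> verts H \<times> verts H \<and> asym D \<and> bij_betw (\<lambda>(u, v). {u, v}) D (edges H)"

lemma orientation_exists:
  assumes "finite_graph H"
  obtains D where "orientation H D"
proof -
  have "\<forall>e\<in>edges H. \<exists>q. fst q \<noteq> snd q \<and> e = {fst q, snd q}"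
  proof
    fix e assume "e \<in> edges H"
    then have "card e = 2" using assms by (auto simp: finite_graph_def all_pairs_def)
    then obtain u v where "e = {u, v}" "u \<noteq> v" by (auto simp: card_2_iff)
    then show "\<exists>q. fst q \<noteq> snd q \<and> e = {fst q, snd q}" by (intro exI [of _ "(u, v)"]) auto
  qed
  then obtain pick where pick: "\<And>e. e \<in> edges H \<Longrightarrow> fst (pick e) \<noteq> snd (pick e) \<and> e = {fst (pick e), snd (pick e)}"
    by metis
  have "orientation H (pick ` edges H)"
    unfolding orientation_def
  proof (intro conjI)
    show "pick ` edges H \<subseteq> verts H \<times> verts H"
    proof (rule image_subsetI)
      fix e assume e: "e \<in> edges H"
      then have "e \<subseteq> verts H" using assms by (auto simp: finite_graph_def all_pairs_def)
      with pick [OF e] show "pick e \<in> verts H \<times> verts H" by (metis insert_subset mem_Times_iff)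
    qed
    show "asym (pick ` edges H)"
    proof (rule asymI)
      fix u v assume "(u, v) \<in> pick ` edges H"
      then obtain e where e: "e \<in> edges H" "pick e = (u, v)" by auto
      show "(v, u) \<notin> pick ` edges H"
      proof
        assume "(v, u) \<in> pick ` edges H"
        then obtain e' where e': "e' \<in> edges H" "pick e' = (v, u)" by auto
        have "e = {u, v}" using conjunct2 [OF pick [OF e(1)]] unfolding e(2) fst_conv snd_conv .
        moreover have "e' = {v, u}" using conjunct2 [OF pick [OF e'(1)]] unfolding e'(2) fst_conv snd_conv .
        ultimately have "e = e'" by (metis insert_commute)
        then have "pick e = pick e'" by (rule arg_cong)
        then have "u = v" unfolding e(2) e'(2) prod.inject by (rule conjunct1)
        then show False using e(2) conjunct1 [OF pick [OF e(1)]] by simp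
      qed
    qed
    show "bij_betw (\<lambda>(u, v). {u, v}) (pick ` edges H) (edges H)"
    proof (rule bij_betw_imageI)
      have inv: "(case pick e of (u, v) \<Rightarrow> {u, v}) = e" if "e \<in> edges H" for e
        unfolding case_prod_unfold by (rule conjunct2 [OF pick [OF that], symmetric])
      show "inj_on (\<lambda>(u, v). {u, v}) (pick ` edges H)"
        by (rule inj_on_imageI, rule inj_on_inverseI [where g = id], unfold comp_apply id_apply) (rule inv)
      show "(\<lambda>(u, v). {u, v}) ` pick ` edges H = edges H"
        unfolding image_image
        by (rule trans [OF image_cong [OF refl inv] image_ident])
    qed
  qed
  then show thesis by (rule that)
qed

text \<open>A graphon is only Lebesgue measurable and controlled only on the unit square, so the
  integrand is exchanged for an almost everywhere equal Borel function. Stated for general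
  \<open>W\<close>, it also covers \<open>1 - W\<close>.\<close>

lemma graphon_density_eq_pdens:
  assumes H: "finite_graph H" and D: "orientation H D"
    and sym: "\<And>x y. x \<in> {0..1} \<Longrightarrow> y \<in> {0..1} \<Longrightarrow> W (x, y) = W (y, x)"
    and W': "W' \<in> borel_measurable (borel \<Otimes>\<^sub>M borel)"
    and ae: "AE z in unit_measure \<Otimes>\<^sub>M unit_measure. W z = W' z"
  shows "graphon_density H W = pdens (verts H) D W'"
proof -
  let ?P = "\<Pi>\<^sub>M v\<in>verts H. unit_measure"
  have D': "D \<subseteq> verts H \<times> verts H" "asym D" and bij: "bij_betw (\<lambda>(u, v). {u, v}) D (edges H)"
    using D by (auto simp: orientation_def)
  have "finite (verts H)" using H by (simp add: finite_graph_def)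
  then have finD: "finite D" using D'(1) by (meson finite_SigmaI finite_subset)
  have "graphon_density H W = (\<integral>x. edge_prod D (\<lambda>s t. W (s, t)) x \<partial>completion ?P)"
    unfolding graphon_density_def unit_cube_def
  proof (intro Bochner_Integration.integral_cong refl)
    fix x assume "x \<in> space (completion ?P)"
    then have x: "x u \<in> {0..1}" if "u \<in> verts H" for u
      using that by (auto simp: space_PiM space_restrict_space PiE_iff)
    have "(\<Prod>e\<in>edges H. edge_weight W x e) = (\<Prod>q\<in>D. edge_weight W x (case q of (u, v) \<Rightarrow> {u, v}))"
      by (rule prod.reindex_bij_betw [OF bij, symmetric])
    also have "\<dots> = edge_prod D (\<lambda>s t. W (s, t)) x"
      unfolding edge_prod_def
    proof (intro prod.cong refl)
      fix q assume "q \<in> D"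
      then obtain u v where q: "q = (u, v)" "u \<in> verts H" "v \<in> verts H" using D'(1) by auto
      show "edge_weight W x (case q of (u, v) \<Rightarrow> {u, v}) = (case q of (u, v) \<Rightarrow> W (x u, x v))"
        using q x by (simp add: edge_weight_doubleton sym)
    qed
    finally show "(\<Prod>e\<in>edges H. edge_weight W x e) = edge_prod D (\<lambda>s t. W (s, t)) x" .
  qed
  also have "\<dots> = pdens (verts H) D W'"
    unfolding pdens_def
  proof (rule integral_completion_AE)
    show "edge_prod D (\<lambda>s t. W' (s, t)) \<in> borel_measurable ?P"
      by (rule borel_measurable_edge_prod [OF D'(1) measurable_unit_pair [OF W']])
    have "AE x in ?P. \<forall>q\<in>D. W (x (fst q), x (snd q)) = W' (x (fst q), x (snd q))"
    proof (rule AE_finite_allI [OF finD])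
      fix q assume q: "q \<in> D"
      then have "fst q \<noteq> snd q" using asym_neq [OF D'(2), of "fst q" "snd q"] by simp
      then show "AE x in ?P. W (x (fst q), x (snd q)) = W' (x (fst q), x (snd q))"
        using q D' by (intro AE_PiM_pair [OF prob_space_unit_measure _ _ _ ae]) auto
    qed
    then show "AE x in ?P. edge_prod D (\<lambda>s t. W (s, t)) x = edge_prod D (\<lambda>s t. W' (s, t)) x"
      unfolding edge_prod_def case_prod_unfold by eventually_elim (intro prod.cong, auto)
  qed
  finally show ?thesis .
qed

section \<open>Homomorphism densities of finite graphs\<close>

definition adj :: "'w ugraph \<Rightarrow> 'w \<Rightarrow> 'w \<Rightarrow> real" where
  "adj G u v = of_bool ({u, v} \<in> edges G)"

definition unif :: "'w set \<Rightarrow> 'w \<Rightarrow> real" where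
  "unif V _ = 1 / real (card V)"

lemma weighted_set_unif: "finite V \<Longrightarrow> V \<noteq> {} \<Longrightarrow> weighted_set V (unif V)"
  by unfold_locales (auto simp: unif_def)

lemma adj_bounds: "0 \<le> adj G u v \<and> adj G u v \<le> 1"
  by (simp add: adj_def)

lemma adj_sym: "adj G u v = adj G v u"
  by (simp add: adj_def insert_commute)

lemma finite_graph_complement: "finite_graph G \<Longrightarrow> finite_graph (complement G)"
  by (auto simp: finite_graph_def complement_def)

lemma edge_prod_adj:
  assumes H: "finite_graph H" and D: "orientation H D" and x: "x \<in> verts H \<rightarrow>\<^sub>E verts G"
  shows "edge_prod D (adj G) x = of_bool (is_hom x H G)"
proof -
  have D': "D \<subseteq> verts H \<times> verts H" and im: "(\<lambda>(u, v). {u, v}) ` D = edges H"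
    using D by (auto simp: orientation_def bij_betw_def)
  have "finite D" using D' H by (auto simp: finite_graph_def intro: finite_subset)
  moreover have "is_hom x H G \<longleftrightarrow> (\<forall>(u, v)\<in>D. {x u, x v} \<in> edges G)"
  proof
    assume "is_hom x H G"
    moreover have "{u, v} \<in> edges H" if "(u, v) \<in> D" for u v
      unfolding im [symmetric] using that by (rule rev_image_eqI) simp
    ultimately show "\<forall>(u, v)\<in>D. {x u, x v} \<in> edges G" by (auto simp: is_hom_def)
  next
    assume *: "\<forall>(u, v)\<in>D. {x u, x v} \<in> edges G"
    have "{x u, x v} \<in> edges G" if "{u, v} \<in> edges H" for u v
    proof -
      from that obtain u' v' where uv: "(u', v') \<in> D" "{u, v} = {u', v'}"
        unfolding im [symmetric] by auto
      then have "{x u', x v'} \<in> edges G" using * by auto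
      moreover have "x ` {u, v} = x ` {u', v'}" using uv(2) by (rule arg_cong)
      ultimately show ?thesis by simp
    qed
    then show "is_hom x H G" using x by (auto simp: is_hom_def)
  qed
  ultimately show ?thesis
    by (auto simp: edge_prod_def adj_def case_prod_unfold intro!: prod.neutral prod_zero)
qed

lemma hom_density_eq_wdens:
  assumes H: "finite_graph H" and G: "finite_graph G" and D: "orientation H D"
  shows "hom_density H G = wdens (verts H) D (verts G) (unif (verts G)) (adj G)"
proof -
  let ?S = "verts H \<rightarrow>\<^sub>E verts G"
  have fin: "finite (verts H)" "finite (verts G)" "verts G \<noteq> {}" using H G by (auto simp: finite_graph_def)
  have S: "finite ?S" "?S \<noteq> {}" using fin by (auto simp: finite_PiE PiE_eq_empty_iff)
  have "hom_density H G = real (card (?S \<inter> {f. is_hom f H G})) / real (card ?S)"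
    unfolding hom_density_def by (rule measure_pmf_of_set [OF S(2,1)])
  also have "real (card (?S \<inter> {f. is_hom f H G})) = (\<Sum>x\<in>?S. of_bool (is_hom x H G))"
    using S(1) by (simp add: sum_of_bool_eq Int_def)
  also have "(\<Sum>x\<in>?S. of_bool (is_hom x H G)) / real (card ?S) =
      (\<Sum>x\<in>?S. (\<Prod>v\<in>verts H. unif (verts G) (x v)) * edge_prod D (adj G) x)"
    using fin by (simp add: edge_prod_adj [OF H D] unif_def card_PiE sum_divide_distrib power_one_over)
  finally show ?thesis by (simp add: wdens_def wsum_def)
qed

text \<open>The diagonal has mass 1/n in the uniform square. The bound is applied to the loops that
  separate a complement from \<open>1 - adj G\<close>, and to collisions of random vertices.\<close>

lemma unif_diag_bound:
  assumes V: "finite V" "V \<noteq> {}" and ST: "S \<subseteq> V" "T \<subseteq> V"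
  shows "\<bar>\<Sum>s\<in>S. \<Sum>t\<in>T. unif V s * unif V t * of_bool (s = t)\<bar> \<le> 1 / real (card V)"
proof -
  have fin: "finite S" "finite T" using V ST by (auto intro: finite_subset)
  have card: "real (card V) > 0" using V by (simp add: card_gt_0_iff)
  have row: "(\<Sum>t\<in>T. unif V s * unif V t * of_bool (s = t)) \<le> 1 / (real (card V))\<^sup>2" for s
  proof -
    have "(\<Sum>t\<in>T. unif V s * unif V t * of_bool (s = t)) = (\<Sum>t\<in>T. if s = t then 1 / (real (card V))\<^sup>2 else 0)"
      by (intro sum.cong) (auto simp: unif_def power2_eq_square)
    then show ?thesis using fin by simp
  qed
  have "(\<Sum>s\<in>S. \<Sum>t\<in>T. unif V s * unif V t * of_bool (s = t)) \<le> (\<Sum>s\<in>S. 1 / (real (card V))\<^sup>2)"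
    by (rule sum_mono) (rule row)
  also have "\<dots> \<le> real (card V) * (1 / (real (card V))\<^sup>2)"
    using card_mono [OF V(1) ST(1)] by (simp add: divide_right_mono)
  also have "\<dots> = 1 / real (card V)" using card by (simp add: power2_eq_square)
  finally show ?thesis by (subst abs_of_nonneg) (auto intro!: sum_nonneg simp: unif_def)
qed

text \<open>The two kernels differ only on the diagonal, where \<open>1 - adj G\<close> has a loop
  at each vertex. The diagonal is small in cut norm, so the counting lemma applies.\<close>

lemma hom_density_complement_approx:
  assumes H: "finite_graph H" and G: "finite_graph G" and D: "orientation H D"
  shows "\<bar>hom_density H (complement G) - wdens (verts H) D (verts G) (unif (verts G)) (\<lambda>s t. 1 - adj G s t)\<bar>
    \<le> real (card D) / real (card (verts G))"
proof -
  let ?V = "verts G"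
  have V: "finite ?V" "?V \<noteq> {}" using G by (auto simp: finite_graph_def)
  interpret weighted_set ?V "unif ?V" by (rule weighted_set_unif [OF V])
  have diff: "adj (complement G) s t - (1 - adj G s t) = - of_bool (s = t)" if "s \<in> ?V" "t \<in> ?V" for s t
    using that G by (auto simp: adj_def complement_def all_pairs_def finite_graph_def card_2_iff)
  have "\<bar>wdens (verts H) D ?V (unif ?V) (adj (complement G)) - wdens (verts H) D ?V (unif ?V) (\<lambda>s t. 1 - adj G s t)\<bar>
    \<le> real (card D) * (1 / real (card ?V))"
  proof (rule wdens_diff_le_cut)
    show "finite (verts H)" "D \<subseteq> verts H \<times> verts H" "asym D"
      using H D by (auto simp: finite_graph_def orientation_def)
    fix S T assume ST: "S \<subseteq> ?V" "T \<subseteq> ?V"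
    have "(\<Sum>s\<in>S. \<Sum>t\<in>T. unif ?V s * unif ?V t * (adj (complement G) s t - (1 - adj G s t))) =
        - (\<Sum>s\<in>S. \<Sum>t\<in>T. unif ?V s * unif ?V t * of_bool (s = t))"
      unfolding sum_negf [symmetric]
    proof (intro sum.cong refl)
      fix s t assume "s \<in> S" "t \<in> T"
      then show "unif ?V s * unif ?V t * (adj (complement G) s t - (1 - adj G s t)) = - (unif ?V s * unif ?V t * of_bool (s = t))"
        using ST by (subst diff) auto
    qed
    then show "\<bar>\<Sum>s\<in>S. \<Sum>t\<in>T. unif ?V s * unif ?V t * (adj (complement G) s t - (1 - adj G s t))\<bar> \<le> 1 / real (card ?V)"
      using unif_diag_bound [OF V ST] by simp
  qed (use adj_bounds [of "complement G"] adj_bounds [of G] in auto)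
  then show ?thesis
    using hom_density_eq_wdens [OF H finite_graph_complement [OF G] D] by (simp add: complement_def)
qed

text \<open>Growing orders make the loop correction vanish, so the complement may be traded for
  \<open>1 - adj\<close> before compactness is applied.\<close>

lemma graphon_of_hom_density_limit:
  fixes G :: "nat \<Rightarrow> 'w ugraph" and H1 :: "'a ugraph" and H2 :: "'b ugraph"
  assumes G: "\<And>n. finite_graph (G n)" and card: "filterlim (\<lambda>n. card (verts (G n))) at_top sequentially"
    and H1: "finite_graph H1" and H2: "finite_graph H2"
    and x: "(\<lambda>n. hom_density H1 (G n)) \<longlonglongrightarrow> x" and y: "(\<lambda>n. hom_density H2 (complement (G n))) \<longlonglongrightarrow> y"
  obtains W where "graphon W" "graphon_density H1 W = x" "graphon_density H2 (\<lambda>z. 1 - W z) = y"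
proof -
  obtain D1 D2 where D1: "orientation H1 D1" and D2: "orientation H2 D2"
    using orientation_exists [OF H1] orientation_exists [OF H2] by metis
  let ?p = "\<lambda>n. unif (verts (G n))"
  have x': "(\<lambda>n. wdens (verts H1) D1 (verts (G n)) (?p n) (adj (G n))) \<longlonglongrightarrow> x"
    using x by (simp add: hom_density_eq_wdens [OF H1 G D1])
  have card': "filterlim (\<lambda>n. real (card (verts (G n)))) at_top sequentially"
    by (rule filterlim_compose [OF filterlim_real_sequentially card])
  have "(\<lambda>n. hom_density H2 (complement (G n)) -
      wdens (verts H2) D2 (verts (G n)) (?p n) (\<lambda>s t. 1 - adj (G n) s t)) \<longlonglongrightarrow> 0"
  proof (rule Lim_null_comparison, intro always_eventually allI)
    show "norm (hom_density H2 (complement (G n)) -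
        wdens (verts H2) D2 (verts (G n)) (?p n) (\<lambda>s t. 1 - adj (G n) s t)) \<le>
        real (card D2) / real (card (verts (G n)))" for n
      using hom_density_complement_approx [OF H2 G D2] by simp
    show "(\<lambda>n. real (card D2) / real (card (verts (G n)))) \<longlonglongrightarrow> 0"
      by (rule tendsto_divide_0 [OF tendsto_const filterlim_at_top_imp_at_infinity [OF card']])
  qed
  from tendsto_diff [OF y this]
  have y': "(\<lambda>n. wdens (verts H2) D2 (verts (G n)) (?p n) (\<lambda>s t. 1 - adj (G n) s t)) \<longlonglongrightarrow> y"
    by simp
  obtain W where W: "graphon W" "W \<in> borel_measurable (borel \<Otimes>\<^sub>M borel)"
    "pdens (verts H1) D1 W = x" "pdens (verts H2) D2 (\<lambda>z. 1 - W z) = y"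
  proof (rule graphon_compactness [of "\<lambda>n. verts (G n)" ?p "\<lambda>n. adj (G n)" "verts H1" D1 "verts H2" D2 x y])
    show "weighted_set (verts (G n)) (?p n)" for n
      using G [of n] by (intro weighted_set_unif) (auto simp: finite_graph_def)
    show "adj (G n) s t = adj (G n) t s" for n s t by (rule adj_sym)
    show "0 \<le> adj (G n) s t \<and> adj (G n) s t \<le> 1" for n s t by (rule adj_bounds)
  qed (use H1 H2 D1 D2 x' y' in \<open>auto simp: finite_graph_def orientation_def\<close>)
  have sym: "W (s, t) = W (t, s)" if "s \<in> {0..1}" "t \<in> {0..1}" for s t
    using W(1) that by (auto simp: graphon_def)
  have "graphon_density H1 W = x"
    using graphon_density_eq_pdens [of H1 D1 W W, OF H1 D1 sym W(2)] W(3) by simp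
  moreover have "graphon_density H2 (\<lambda>z. 1 - W z) = y"
  proof -
    have "(\<lambda>z. 1 - W z) \<in> borel_measurable (borel \<Otimes>\<^sub>M borel)" using W(2) by measurable
    from graphon_density_eq_pdens [of H2 D2 "\<lambda>z. 1 - W z" "\<lambda>z. 1 - W z", OF H2 D2 _ this] sym W(4)
    show ?thesis by simp
  qed
  ultimately show thesis using W(1) by (intro that)
qed

section \<open>Invariance under isomorphism\<close>

lemma doubleton_in_all_pairs_iff: "{u, v} \<in> all_pairs V \<longleftrightarrow> u \<in> V \<and> v \<in> V \<and> u \<noteq> v"
  by (auto simp: all_pairs_def card_2_iff doubleton_eq_iff)

lemma isomorphic_complement:
  assumes "isomorphic F G"
  shows "isomorphic (complement F) (complement G)"
proof -
  from assms obtain f where f: "bij_betw f (verts F) (verts G)"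
    "\<And>u v. u \<in> verts F \<Longrightarrow> v \<in> verts F \<Longrightarrow> {u, v} \<in> edges F \<longleftrightarrow> {f u, f v} \<in> edges G"
    by (auto simp: isomorphic_def)
  have "{u, v} \<in> edges (complement F) \<longleftrightarrow> {f u, f v} \<in> edges (complement G)"
    if "u \<in> verts F" "v \<in> verts F" for u v
    using that f bij_betw_apply [OF f(1)] inj_on_eq_iff [OF bij_betw_imp_inj_on [OF f(1)], of u v]
    by (simp add: complement_def doubleton_in_all_pairs_iff)
  then show ?thesis
    unfolding isomorphic_def using f(1) by (intro exI [of _ f]) (auto simp: complement_def)
qed

text \<open>A bijection carries uniform weights to uniform weights, so
  \<open>wdens_pushforward\<close> applies with singleton classes.\<close>

lemma hom_density_isomorphic:
  assumes H: "finite_graph H" and F: "finite_graph F" and G: "finite_graph G" and iso: "isomorphic F G"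
  shows "hom_density H F = hom_density H G"
proof -
  obtain D where D: "orientation H D" using orientation_exists [OF H] by blast
  from iso obtain f where f: "bij_betw f (verts F) (verts G)"
    "\<And>u v. u \<in> verts F \<Longrightarrow> v \<in> verts F \<Longrightarrow> {u, v} \<in> edges F \<longleftrightarrow> {f u, f v} \<in> edges G"
    by (auto simp: isomorphic_def)
  have fin: "finite (verts H)" "finite (verts F)" "finite (verts G)" and D': "D \<subseteq> verts H \<times> verts H"
    using H F G D by (auto simp: finite_graph_def orientation_def)
  have "wdens (verts H) D (verts F) (unif (verts F)) (adj F) =
      wdens (verts H) D (verts F) (unif (verts F)) (\<lambda>s t. adj G (f s) (f t))"
    by (rule wdens_cong [OF D']) (simp add: adj_def f(2))
  also have "\<dots> = wdens (verts H) D (verts G) (unif (verts G)) (adj G)"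
  proof (rule wdens_pushforward [OF fin(1) D' fin(2,3)])
    show "f ` verts F \<subseteq> verts G" using f(1) by (simp add: bij_betw_def)
    fix i assume "i \<in> verts G"
    then have "i \<in> f ` verts F" using f(1) by (simp add: bij_betw_def)
    then obtain v where v: "v \<in> verts F" "f v = i" by blast
    have "of_bool (f u = i) * unif (verts F) u = (if u = v then unif (verts G) i else 0)" if "u \<in> verts F" for u
    proof -
      have "f u = i \<longleftrightarrow> u = v"
        using inj_on_eq_iff [OF bij_betw_imp_inj_on [OF f(1)] that v(1)] unfolding v(2) .
      then show ?thesis using bij_betw_same_card [OF f(1)] by (simp add: unif_def)
    qed
    then have "(\<Sum>u\<in>verts F. of_bool (f u = i) * unif (verts F) u) = (\<Sum>u\<in>verts F. if u = v then unif (verts G) i else 0)"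
      by (intro sum.cong refl) blast
    also have "\<dots> = unif (verts G) i" using fin v by simp
    finally show "unif (verts G) i = (\<Sum>u\<in>verts F. of_bool (f u = i) * unif (verts F) u)" ..
  qed
  finally show ?thesis by (simp add: hom_density_eq_wdens [OF H _ D] F G)
qed

section \<open>Random graphs sampled from a graphon\<close>

lemma sum_Pow_prod_If:
  fixes \<alpha> \<beta> :: "'e \<Rightarrow> real"
  assumes "finite P"
  shows "(\<Sum>E\<in>Pow P. \<Prod>e\<in>P. if e \<in> E then \<alpha> e else \<beta> e) = (\<Prod>e\<in>P. \<alpha> e + \<beta> e)"
proof -
  have "(\<Prod>e\<in>P. if e \<in> E then \<alpha> e else \<beta> e) = (\<Prod>e\<in>E. \<alpha> e) * (\<Prod>e\<in>P - E. \<beta> e)" if "E \<subseteq> P" for E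
    using that assms by (simp add: prod.If_cases Int_absorb1 Diff_eq [symmetric] flip: Collect_mem_eq)
  then show ?thesis unfolding prod_add [OF assms] by (intro sum.cong) auto
qed

text \<open>Probability of the edge set \<open>E\<close> when the pairs are chosen independently
  with probabilities \<open>a\<close>. Taking numbers as vertices lets \<open>Min\<close> and
  \<open>Max\<close> order each pair.\<close>

definition sample_prob :: "(nat \<Rightarrow> nat \<Rightarrow> real) \<Rightarrow> nat set \<Rightarrow> nat set set \<Rightarrow> real" where
  "sample_prob a V E = (\<Prod>e\<in>all_pairs V. if e \<in> E then a (Min e) (Max e) else 1 - a (Min e) (Max e))"

lemma finite_all_pairs: "finite V \<Longrightarrow> finite (all_pairs V)"
  by (rule finite_subset [of _ "Pow V"]) (auto simp: all_pairs_def)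

lemma sample_prob_bounds:
  assumes "\<And>u v. 0 \<le> a u v \<and> a u v \<le> 1"
  shows "0 \<le> sample_prob a V E" "sample_prob a V E \<le> 1"
  unfolding sample_prob_def by (auto intro!: prod_nonneg prod_le_1 simp: assms)

lemma sum_sample_prob:
  assumes "finite V"
  shows "(\<Sum>E\<in>Pow (all_pairs V). sample_prob a V E) = 1"
  unfolding sample_prob_def sum_Pow_prod_If [OF finite_all_pairs [OF assms]] by simp

lemma Min_Max_doubleton:
  fixes a :: "nat \<Rightarrow> nat \<Rightarrow> real"
  assumes "\<And>u v. a u v = a v u"
  shows "a (Min {u, v}) (Max {u, v}) = a u v"
  using assms by (cases "u \<le> v") (auto simp: min_def max_def)

text \<open>Distinct edges of \<open>H\<close> are sent by an injective map to distinct pairs, so their presence in the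
  sampled graph is independent.\<close>

lemma sum_sample_prob_edge_prod:
  assumes V: "finite V" and a: "\<And>u v. a u v = a v u"
    and D: "D \<subseteq> A \<times> A" "asym D" "finite D" and x: "x \<in> A \<rightarrow> V" "inj_on x A"
  shows "(\<Sum>E\<in>Pow (all_pairs V). sample_prob a V E *
      edge_prod D (\<lambda>s t. toggle b (adj \<lparr>verts = V, edges = E\<rparr> s t)) x) =
    edge_prod D (\<lambda>s t. toggle b (a s t)) x"
proof -
  let ?P = "all_pairs V"
  define m where "m q = {x (fst q), x (snd q)}" for q
  define T where "T = m ` D"
  have neq: "x (fst q) \<noteq> x (snd q)" if "q \<in> D" for q
  proof -
    obtain u v where q: "q = (u, v)" by force
    then have "u \<in> A" "v \<in> A" "u \<noteq> v" using that D(1) asym_neq [OF D(2), of u v] by auto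
    then show ?thesis using inj_onD [OF x(2), of u v] q by auto
  qed
  have inj: "inj_on m D"
  proof (rule inj_onI)
    fix q q' assume q: "q \<in> D" "q' \<in> D" and eq: "m q = m q'"
    obtain u v u' v' where uv: "q = (u, v)" "q' = (u', v')" by force
    have A: "u \<in> A" "v \<in> A" "u' \<in> A" "v' \<in> A" using q D(1) uv by auto
    from eq consider "x u = x u'" "x v = x v'" | "x u = x v'" "x v = x u'"
      unfolding m_def uv fst_conv snd_conv doubleton_eq_iff by blast
    then show "q = q'"
    proof cases
      case 1
      then have "u = u'" "v = v'" using A inj_onD [OF x(2)] by blast+
      then show ?thesis unfolding uv by simp
    next
      case 2
      then have "u = v'" "v = u'" using A inj_onD [OF x(2)] by blast+
      then have "q' = (v, u)" unfolding uv by (simp only:)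
      then show ?thesis using q uv(1) asymD [OF D(2), of u v] by simp
    qed
  qed
  have TP: "T \<subseteq> ?P"
    unfolding T_def
  proof (rule image_subsetI)
    fix q assume q: "q \<in> D"
    then have "fst q \<in> A" "snd q \<in> A" using D(1) by auto
    then have "x (fst q) \<in> V" "x (snd q) \<in> V" using x(1) by (auto dest: funcset_mem)
    then show "m q \<in> ?P" using neq [OF q] by (simp add: m_def doubleton_in_all_pairs_iff)
  qed
  have T: "finite ?P" using V by (rule finite_all_pairs)
  define p where "p e = a (Min e) (Max e)" for e
  have edge: "edge_prod D (\<lambda>s t. toggle b (adj \<lparr>verts = V, edges = E\<rparr> s t)) x = (\<Prod>e\<in>T. toggle b (of_bool (e \<in> E)))" for E
    unfolding T_def prod.reindex [OF inj] edge_prod_def adj_def m_def case_prod_unfold comp_def by simp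
  have "edge_prod D (\<lambda>s t. toggle b (a s t)) x = (\<Prod>e\<in>T. toggle b (p e))"
    unfolding T_def prod.reindex [OF inj] edge_prod_def m_def p_def case_prod_unfold comp_def Min_Max_doubleton [of a, OF a] ..
  also have "\<dots> = (\<Prod>e\<in>?P. if e \<in> T then toggle b (p e) else 1)"
    using T TP by (simp add: prod.inter_restrict [symmetric] Int_absorb1)
  \<comment> \<open>Each factor becomes an average over presence and absence of the pair; outside
    \<open>T\<close> this is \<open>p e + (1 - p e) = 1\<close>. Expanding the product then produces
    the sum over edge sets.\<close>
  also have "\<dots> = (\<Prod>e\<in>?P. p e * (if e \<in> T then toggle b 1 else 1) + (1 - p e) * (if e \<in> T then toggle b 0 else 1))"
    by (intro prod.cong) (auto simp: toggle_def)
  also have "\<dots> = (\<Sum>E\<in>Pow ?P. \<Prod>e\<in>?P. if e \<in> E then p e * (if e \<in> T then toggle b 1 else 1)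
      else (1 - p e) * (if e \<in> T then toggle b 0 else 1))"
    by (rule sum_Pow_prod_If [OF T, symmetric])
  also have "\<dots> = (\<Sum>E\<in>Pow ?P. sample_prob a V E * (\<Prod>e\<in>T. toggle b (of_bool (e \<in> E))))"
  proof (intro sum.cong refl)
    fix E
    have "(\<Prod>e\<in>T. toggle b (of_bool (e \<in> E))) = (\<Prod>e\<in>?P. if e \<in> T then toggle b (of_bool (e \<in> E)) else 1)"
      using T TP by (simp add: prod.inter_restrict [symmetric] Int_absorb1)
    then have "sample_prob a V E * (\<Prod>e\<in>T. toggle b (of_bool (e \<in> E))) =
        (\<Prod>e\<in>?P. (if e \<in> E then p e else 1 - p e) * (if e \<in> T then toggle b (of_bool (e \<in> E)) else 1))"
      unfolding sample_prob_def p_def prod.distrib by (rule arg_cong)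
    also have "\<dots> = (\<Prod>e\<in>?P. if e \<in> E then p e * (if e \<in> T then toggle b 1 else 1)
      else (1 - p e) * (if e \<in> T then toggle b 0 else 1))"
      by (intro prod.cong) auto
    finally show "(\<Prod>e\<in>?P. if e \<in> E then p e * (if e \<in> T then toggle b 1 else 1)
      else (1 - p e) * (if e \<in> T then toggle b 0 else 1)) =
      sample_prob a V E * (\<Prod>e\<in>T. toggle b (of_bool (e \<in> E)))" ..
  qed
  finally show ?thesis by (simp add: edge)
qed

text \<open>A union bound over pairs of indices. A single collision is
  \<open>single_edge_bound\<close> for the equality kernel with no further edges.\<close>

lemma (in weighted_set) wsum_not_inj_le:
  fixes A :: "'i set"
  assumes A: "finite A"
    and diag: "\<And>S T. S \<subseteq> V \<Longrightarrow> T \<subseteq> V \<Longrightarrow> \<bar>\<Sum>s\<in>S. \<Sum>t\<in>T. p s * p t * of_bool (s = t)\<bar> \<le> \<delta>"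
  shows "wsum A V p (\<lambda>x. of_bool (\<not> inj_on x A)) \<le> (real (card A))\<^sup>2 * \<delta>"
proof -
  let ?Q = "{q \<in> A \<times> A. fst q \<noteq> snd q}"
  have Q: "finite ?Q" using A by (simp add: finite_cartesian_product)
  have "0 \<le> \<delta>" using diag [of "{}" "{}"] by simp
  have "of_bool (\<not> inj_on x A) \<le> (\<Sum>q\<in>?Q. of_bool (x (fst q) = x (snd q)) :: real)" for x :: "'i \<Rightarrow> 'w"
  proof (cases "inj_on x A")
    case False
    then obtain u v where uv: "u \<in> A" "v \<in> A" "u \<noteq> v" "x u = x v"
      unfolding inj_on_def by blast
    then have "(u, v) \<in> ?Q" by simp
    have "of_bool (x (fst (u, v)) = x (snd (u, v))) \<le> (\<Sum>q\<in>?Q. of_bool (x (fst q) = x (snd q)) :: real)"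
      by (rule member_le_sum [OF \<open>(u, v) \<in> ?Q\<close> _ Q]) simp
    then show ?thesis using uv(4) False by simp
  qed (simp add: sum_nonneg)
  then have "wsum A V p (\<lambda>x. of_bool (\<not> inj_on x A)) \<le> wsum A V p (\<lambda>x. \<Sum>q\<in>?Q. of_bool (x (fst q) = x (snd q)))"
    unfolding wsum_def by (intro sum_mono mult_left_mono prod_nonneg) (auto simp: PiE_iff nonneg)
  also have "\<dots> = (\<Sum>q\<in>?Q. wsum A V p (\<lambda>x. of_bool (x (fst q) = x (snd q))))"
    unfolding wsum_def sum_distrib_left by (rule sum.swap)
  also have "\<dots> \<le> (\<Sum>q\<in>?Q. \<delta>)"
  proof (rule sum_mono)
    fix q assume "q \<in> ?Q"
    then have q: "fst q \<in> A" "snd q \<in> A" "fst q \<noteq> snd q" by auto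
    have "\<bar>wsum A V p (\<lambda>x. of_bool (x (fst q) = x (snd q)) * (\<Prod>e\<in>({} :: ('i \<times> 'i) set). 1))\<bar> \<le> \<delta>"
      by (rule single_edge_bound [where k = "\<lambda>s t. of_bool (s = t)" and h = "\<lambda>_ _ _. 1" and D = "{}", OF A q])
         (use diag in auto)
    then show "wsum A V p (\<lambda>x. of_bool (x (fst q) = x (snd q))) \<le> \<delta>" by simp
  qed
  also have "\<dots> \<le> (real (card A))\<^sup>2 * \<delta>"
  proof -
    have "card ?Q \<le> card (A \<times> A)" using A by (intro card_mono) auto
    then have "real (card ?Q) \<le> (real (card A))\<^sup>2"
      by (simp add: card_cartesian_product power2_eq_square flip: of_nat_mult)
    then show ?thesis using \<open>0 \<le> \<delta>\<close> by (simp add: mult_right_mono)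
  qed
  finally show ?thesis .
qed

text \<open>The law of the random graph sampled from \<open>W\<close>: each vertex has an
  independent uniform position in the unit interval.\<close>

definition mean_sample_prob :: "(real \<times> real \<Rightarrow> real) \<Rightarrow> nat set \<Rightarrow> nat set set \<Rightarrow> real" where
  "mean_sample_prob W V E = (\<integral>x. sample_prob (\<lambda>u v. W (x u, x v)) V E \<partial>(\<Pi>\<^sub>M v\<in>V. unit_measure))"

context
  fixes W :: "real \<times> real \<Rightarrow> real" and V :: "nat set"
  assumes V: "finite V" "V \<noteq> {}"
    and W: "W \<in> borel_measurable (borel \<Otimes>\<^sub>M borel)"
    and W_sym: "\<And>s t. W (s, t) = W (t, s)"
    and W_bounds: "\<And>z. 0 \<le> W z \<and> W z \<le> 1"
begin

interpretation cube: prob_space "\<Pi>\<^sub>M v\<in>V. unit_measure"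
  by (intro prob_space_PiM prob_space_unit_measure)

lemma sample_prob_integrable:
  "integrable (\<Pi>\<^sub>M v\<in>V. unit_measure) (\<lambda>x. sample_prob (\<lambda>u v. W (x u, x v)) V E)"
proof (rule cube.integrable_const_bound [where B = 1])
  show "(\<lambda>x. sample_prob (\<lambda>u v. W (x u, x v)) V E) \<in> borel_measurable (\<Pi>\<^sub>M v\<in>V. unit_measure)"
    unfolding sample_prob_def
  proof (rule borel_measurable_prod)
    fix e assume e: "e \<in> all_pairs V"
    then have "e \<subseteq> V" "finite e" "e \<noteq> {}" using card_gt_0_iff [of e] by (auto simp: all_pairs_def)
    then have "Min e \<in> V" "Max e \<in> V" using Min_in Max_in by blast+
    then have "(\<lambda>x. (x (Min e), x (Max e))) \<in> (\<Pi>\<^sub>M v\<in>V. unit_measure) \<rightarrow>\<^sub>M unit_measure \<Otimes>\<^sub>M unit_measure"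
      by (rule measurable_PiM_pair)
    from measurable_compose [OF this measurable_unit_pair [OF W]]
    show "(\<lambda>x. if e \<in> E then W (x (Min e), x (Max e)) else 1 - W (x (Min e), x (Max e)))
        \<in> borel_measurable (\<Pi>\<^sub>M v\<in>V. unit_measure)" by (cases "e \<in> E") auto
  qed
  show "AE x in \<Pi>\<^sub>M v\<in>V. unit_measure. norm (sample_prob (\<lambda>u v. W (x u, x v)) V E) \<le> 1"
    using sample_prob_bounds [of "\<lambda>u v. W (x u, x v)" for x] W_bounds by (intro AE_I2) auto
qed

lemma mean_sample_prob_nonneg: "0 \<le> mean_sample_prob W V E"
  unfolding mean_sample_prob_def
  by (rule Bochner_Integration.integral_nonneg) (rule sample_prob_bounds, rule W_bounds)

lemma sum_mean_sample_prob: "(\<Sum>E\<in>Pow (all_pairs V). mean_sample_prob W V E) = 1"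
proof -
  have "(\<Sum>E\<in>Pow (all_pairs V). mean_sample_prob W V E) =
      (\<integral>x. (\<Sum>E\<in>Pow (all_pairs V). sample_prob (\<lambda>u v. W (x u, x v)) V E) \<partial>(\<Pi>\<^sub>M v\<in>V. unit_measure))"
    unfolding mean_sample_prob_def using sample_prob_integrable
    by (intro Bochner_Integration.integral_sum [symmetric])
  also have "\<dots> = 1" by (simp add: sum_sample_prob [OF V(1)] cube.prob_space)
  finally show ?thesis .
qed

text \<open>Along an injective \<open>y\<close> the positions \<open>x (y v)\<close> are again
  independent and uniform.\<close>

lemma integral_edge_prod_inj:
  assumes A: "finite A" and D: "D \<subseteq> A \<times> A" and y: "y \<in> A \<rightarrow> V" "inj_on y A"
  shows "(\<integral>x. edge_prod D (\<lambda>s t. toggle b (W (s, t))) (\<lambda>v. x (y v)) \<partial>(\<Pi>\<^sub>M v\<in>V. unit_measure)) =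
    pdens A D (\<lambda>z. toggle b (W z))"
proof -
  have [measurable]: "toggle b \<in> borel_measurable borel"
    unfolding toggle_def [abs_def] by measurable
  have [measurable]: "W \<in> borel_measurable (unit_measure \<Otimes>\<^sub>M unit_measure)"
    by (rule measurable_unit_pair [OF W])
  have meas: "edge_prod D (\<lambda>s t. toggle b (W (s, t))) \<in> borel_measurable (\<Pi>\<^sub>M v\<in>A. unit_measure)"
    using borel_measurable_edge_prod [OF D, of "\<lambda>z. toggle b (W z)"] by simp
  have distr: "distr (\<Pi>\<^sub>M v\<in>V. unit_measure) (\<Pi>\<^sub>M v\<in>A. unit_measure) (\<lambda>x. \<lambda>v\<in>A. x (y v)) = (\<Pi>\<^sub>M v\<in>A. unit_measure)"
    using distr_PiM_reindex [of V "\<lambda>_. unit_measure" y A] y prob_space_unit_measure by simp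
  have "(\<lambda>x. \<lambda>v\<in>A. x (y v)) \<in> (\<Pi>\<^sub>M v\<in>V. unit_measure) \<rightarrow>\<^sub>M (\<Pi>\<^sub>M v\<in>A. unit_measure)"
    using y by (intro measurable_restrict measurable_component_singleton) auto
  from integral_distr [OF this meas]
  have "pdens A D (\<lambda>z. toggle b (W z)) =
      (\<integral>x. edge_prod D (\<lambda>s t. toggle b (W (s, t))) (\<lambda>v\<in>A. x (y v)) \<partial>(\<Pi>\<^sub>M v\<in>V. unit_measure))"
    unfolding pdens_def distr .
  also have "\<dots> = (\<integral>x. edge_prod D (\<lambda>s t. toggle b (W (s, t))) (\<lambda>v. x (y v)) \<partial>(\<Pi>\<^sub>M v\<in>V. unit_measure))"
    unfolding edge_prod_def using D by (intro Bochner_Integration.integral_cong prod.cong) auto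
  finally show ?thesis ..
qed

text \<open>Exact for injective \<open>y\<close>; otherwise the expectation is at most 1. An
  inequality is enough because sampling serves only for upper bounds.\<close>

lemma sum_mean_sample_prob_edge_prod_le:
  assumes A: "finite A" and D: "D \<subseteq> A \<times> A" "asym D" and y: "y \<in> A \<rightarrow> V"
  shows "(\<Sum>E\<in>Pow (all_pairs V). mean_sample_prob W V E *
      edge_prod D (\<lambda>s t. toggle b (adj \<lparr>verts = V, edges = E\<rparr> s t)) y) \<le>
    pdens A D (\<lambda>z. toggle b (W z)) + of_bool (\<not> inj_on y A)"
proof (cases "inj_on y A")
  case True
  have finD: "finite D" using A D(1) by (meson finite_SigmaI finite_subset)
  have "(\<Sum>E\<in>Pow (all_pairs V). mean_sample_prob W V E *
      edge_prod D (\<lambda>s t. toggle b (adj \<lparr>verts = V, edges = E\<rparr> s t)) y) =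
    (\<integral>x. (\<Sum>E\<in>Pow (all_pairs V). sample_prob (\<lambda>u v. W (x u, x v)) V E *
      edge_prod D (\<lambda>s t. toggle b (adj \<lparr>verts = V, edges = E\<rparr> s t)) y) \<partial>(\<Pi>\<^sub>M v\<in>V. unit_measure))"
    unfolding mean_sample_prob_def using sample_prob_integrable
    by (subst Bochner_Integration.integral_sum) auto
  also have "\<dots> = (\<integral>x. edge_prod D (\<lambda>s t. toggle b (W (s, t))) (\<lambda>v. x (y v)) \<partial>(\<Pi>\<^sub>M v\<in>V. unit_measure))"
    by (subst sum_sample_prob_edge_prod [OF V(1) W_sym D finD y True]) (simp add: edge_prod_def)
  also have "\<dots> = pdens A D (\<lambda>z. toggle b (W z))"
    by (rule integral_edge_prod_inj [OF A D(1) y True])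
  finally show ?thesis using True by simp
next
  case False
  have "(\<Sum>E\<in>Pow (all_pairs V). mean_sample_prob W V E *
      edge_prod D (\<lambda>s t. toggle b (adj \<lparr>verts = V, edges = E\<rparr> s t)) y) \<le> (\<Sum>E\<in>Pow (all_pairs V). mean_sample_prob W V E)"
  proof (rule sum_mono)
    fix E
    have "edge_prod D (\<lambda>s t. toggle b (adj \<lparr>verts = V, edges = E\<rparr> s t)) y \<le> 1"
      by (rule conjunct2 [OF edge_prod_bounds]) (rule toggle_bounds [OF adj_bounds])
    then show "mean_sample_prob W V E * edge_prod D (\<lambda>s t. toggle b (adj \<lparr>verts = V, edges = E\<rparr> s t)) y \<le> mean_sample_prob W V E"
      by (rule mult_left_le [OF _ mean_sample_prob_nonneg])
  qed
  moreover have "0 \<le> pdens A D (\<lambda>z. toggle b (W z))"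
    unfolding pdens_def
    by (rule Bochner_Integration.integral_nonneg, rule conjunct1 [OF edge_prod_bounds]) (rule toggle_bounds [OF W_bounds])
  ultimately show ?thesis using False by (simp add: sum_mean_sample_prob)
qed

lemma sum_mean_sample_prob_wdens_le:
  assumes A: "finite A" and D: "D \<subseteq> A \<times> A" "asym D"
  shows "(\<Sum>E\<in>Pow (all_pairs V). mean_sample_prob W V E *
      wdens A D V (unif V) (\<lambda>s t. toggle b (adj \<lparr>verts = V, edges = E\<rparr> s t))) \<le>
    pdens A D (\<lambda>z. toggle b (W z)) + (real (card A))\<^sup>2 / real (card V)"
proof -
  interpret weighted_set V "unif V" by (rule weighted_set_unif [OF V])
  have "(\<Sum>E\<in>Pow (all_pairs V). mean_sample_prob W V E *
      wdens A D V (unif V) (\<lambda>s t. toggle b (adj \<lparr>verts = V, edges = E\<rparr> s t))) =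
    wsum A V (unif V) (\<lambda>y. \<Sum>E\<in>Pow (all_pairs V). mean_sample_prob W V E *
      edge_prod D (\<lambda>s t. toggle b (adj \<lparr>verts = V, edges = E\<rparr> s t)) y)"
    unfolding wdens_def wsum_def sum_distrib_left by (subst sum.swap) (simp only: mult.left_commute)
  also have "\<dots> \<le> wsum A V (unif V) (\<lambda>y. pdens A D (\<lambda>z. toggle b (W z)) + of_bool (\<not> inj_on y A))"
    unfolding wsum_def
    by (intro sum_mono mult_left_mono prod_nonneg sum_mean_sample_prob_edge_prod_le [OF A D])
       (auto simp: unif_def)
  also have "\<dots> = wsum A V (unif V) (\<lambda>y. pdens A D (\<lambda>z. toggle b (W z))) + wsum A V (unif V) (\<lambda>y. of_bool (\<not> inj_on y A))"
    unfolding wsum_def by (simp only: distrib_left sum.distrib)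
  also have "\<dots> \<le> pdens A D (\<lambda>z. toggle b (W z)) + (real (card A))\<^sup>2 * (1 / real (card V))"
    using wsum_const [OF A] wsum_not_inj_le [OF A unif_diag_bound [OF V]] by simp
  finally show ?thesis by simp
qed

end

section \<open>The minimax argument\<close>

lemma labelled_copy:
  fixes F :: "'w ugraph"
  assumes "finite_graph F"
  obtains E where "E \<subseteq> all_pairs {..<card (verts F)}"
    "isomorphic \<lparr>verts = {..<card (verts F)}, edges = E\<rparr> F"
proof -
  have fin: "finite (verts F)" and card2: "\<And>e. e \<in> edges F \<Longrightarrow> card e = 2"
    using assms by (auto simp: finite_graph_def all_pairs_def)
  obtain h where h: "bij_betw h {..<card (verts F)} (verts F)"
    using ex_bij_betw_nat_finite [OF fin] by (auto simp: atLeast0LessThan)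
  define E where "E = {e \<in> all_pairs {..<card (verts F)}. h ` e \<in> edges F}"
  have "{u, v} \<in> E \<longleftrightarrow> {h u, h v} \<in> edges F" if "u < card (verts F)" "v < card (verts F)" for u v
  proof (cases "u = v")
    case True
    then show ?thesis using card2 [of "{h u, h v}"] by (auto simp: E_def doubleton_in_all_pairs_iff)
  qed (use that in \<open>simp add: E_def doubleton_in_all_pairs_iff\<close>)
  then have "isomorphic \<lparr>verts = {..<card (verts F)}, edges = E\<rparr> F"
    unfolding isomorphic_def using h by (intro exI [of _ h]) simp
  then show thesis by (rule that [rotated]) (auto simp: E_def)
qed

text \<open>Below a given order there are finitely many edge sets on initial segments of the
  numbers, and uniqueness in the enumeration lets each be the copy of only one member.\<close>

lemma card_verts_filterlim:
  assumes G: "enumerates_graphs G"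
  shows "filterlim (\<lambda>n. card (verts (G n))) at_top sequentially"
proof -
  have fin: "finite_graph (G n)" for n using G by (simp add: enumerates_graphs_def)
  have unique: "n = n'" if "finite_graph F" "isomorphic F (G n)" "isomorphic F (G n')" for F :: "nat ugraph" and n n'
  proof -
    have "\<exists>!n. isomorphic F (G n)" using G that(1) by (simp add: enumerates_graphs_def)
    then show ?thesis using that(2,3) by (elim ex1E) blast
  qed
  have "finite {n. card (verts (G n)) < K}" for K
  proof -
    let ?k = "\<lambda>n. card (verts (G n))"
    have "\<forall>n. \<exists>E. E \<subseteq> all_pairs {..<?k n} \<and> isomorphic \<lparr>verts = {..<?k n}, edges = E\<rparr> (G n)"
      by (rule allI, rule labelled_copy [OF fin]) blast
    from choice [OF this] obtain E where E: "\<And>n. E n \<subseteq> all_pairs {..<?k n}"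
      "\<And>n. isomorphic \<lparr>verts = {..<?k n}, edges = E n\<rparr> (G n)"
      by blast
    have "inj_on (\<lambda>n. (?k n, E n)) {n. ?k n < K}"
    proof (rule inj_onI)
      fix n n' assume eq: "(?k n, E n) = (?k n', E n')"
      have "?k n \<noteq> 0" using fin [of n] by (simp add: finite_graph_def)
      then have "finite_graph \<lparr>verts = {..<?k n}, edges = E n\<rparr>"
        using E(1) by (auto simp: finite_graph_def)
      then show "n = n'" by (rule unique) (use E(2) [of n] E(2) [of n'] eq in auto)
    qed
    moreover have "(\<lambda>n. (?k n, E n)) ` {n. ?k n < K} \<subseteq> {..<K} \<times> Pow (Pow {..<K})"
      using E(1) by (fastforce simp: all_pairs_def)
    ultimately show ?thesis by (rule inj_on_finite) auto
  qed
  then have "eventually (\<lambda>n. K \<le> card (verts (G n))) sequentially" for K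
    by (simp add: eventually_cofinite not_le flip: cofinite_eq_sequentially)
  then show ?thesis unfolding filterlim_at_top ..
qed

section \<open>Linear functionals and the sampling bound\<close>

definition val :: "real \<Rightarrow> real \<times> real \<Rightarrow> real" where
  "val l q = l * fst q + (2 - l) * snd q"

text \<open>The slope in the parameter is the difference of the coordinates, so the two comparison
  conditions of a certificate prescribe the sign of a slope.\<close>

lemma val_diff: "val l q - val \<mu> q = (l - \<mu>) * (fst q - snd q)"
  by (simp add: val_def algebra_simps)

lemma weighted_average_witness:
  fixes \<omega> g :: "'e \<Rightarrow> real"
  assumes "finite S" "\<And>E. E \<in> S \<Longrightarrow> 0 \<le> \<omega> E" "(\<Sum>E\<in>S. \<omega> E) = 1"
  obtains E where "E \<in> S" "g E \<le> (\<Sum>E\<in>S. \<omega> E * g E)"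
proof -
  have "S \<noteq> {}" using assms(3) by auto
  then have "Min (g ` S) \<in> g ` S" using assms(1) by (intro Min_in) auto
  then obtain E where E: "E \<in> S" "g E = Min (g ` S)" by force
  have "g E = (\<Sum>E'\<in>S. \<omega> E' * g E)" by (simp add: sum_distrib_right [symmetric] assms(3))
  also have "\<dots> \<le> (\<Sum>E'\<in>S. \<omega> E' * g E')"
    using assms E by (intro sum_mono mult_left_mono) auto
  finally show thesis using E(1) by (rule that [rotated])
qed

text \<open>Some graph does no worse than the average of the one functional at hand. The error
  collects the non-injective maps for both graphs and the loops for the second; the factor 2 bounds
  both \<open>l\<close> and \<open>2 - l\<close>.\<close>

lemma exists_sampled_graph:
  assumes H1: "finite_graph H1" and D1: "orientation H1 D1" and H2: "finite_graph H2" and D2: "orientation H2 D2"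
    and W: "graphon W" and N: "0 < N" and l: "0 \<le> l" "l \<le> 2"
  obtains F :: "nat ugraph" where "finite_graph F" "card (verts F) = N"
    "val l (hom_density H1 F, hom_density H2 (complement F)) \<le>
      val l (graphon_density H1 W, graphon_density H2 (\<lambda>z. 1 - W z)) +
      2 * ((real (card (verts H1)))\<^sup>2 + (real (card (verts H2)))\<^sup>2 + real (card D2)) / real N"
proof -
  obtain W' where W': "W' \<in> borel_measurable (borel \<Otimes>\<^sub>M borel)" "\<And>x y. W' (x, y) = W' (y, x)"
    "\<And>z. 0 \<le> W' z \<and> W' z \<le> 1" and ae: "AE z in unit_measure \<Otimes>\<^sub>M unit_measure. W z = W' z"
    using graphon_Borel_version [OF W] by blast
  have sym: "W (s, t) = W (t, s)" if "s \<in> {0..1}" "t \<in> {0..1}" for s t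
    using W that by (auto simp: graphon_def)
  have t1: "graphon_density H1 W = pdens (verts H1) D1 (\<lambda>z. toggle False (W' z))"
    using graphon_density_eq_pdens [of H1 D1 W W', OF H1 D1 sym W'(1) ae] by (simp add: toggle_def)
  have t2: "graphon_density H2 (\<lambda>z. 1 - W z) = pdens (verts H2) D2 (\<lambda>z. toggle True (W' z))"
  proof -
    have "(\<lambda>z. 1 - W' z) \<in> borel_measurable (borel \<Otimes>\<^sub>M borel)" using W'(1) by measurable
    moreover have "AE z in unit_measure \<Otimes>\<^sub>M unit_measure. 1 - W z = 1 - W' z"
      using ae by eventually_elim simp
    ultimately show ?thesis
      using graphon_density_eq_pdens [of H2 D2 "\<lambda>z. 1 - W z" "\<lambda>z. 1 - W' z", OF H2 D2] sym
      by (simp add: toggle_def)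
  qed
  let ?V = "{..<N}" let ?P = "Pow (all_pairs ?V)" let ?\<omega> = "mean_sample_prob W' ?V"
  let ?G = "\<lambda>E. \<lparr>verts = ?V, edges = E\<rparr>"
  have V: "finite ?V" "?V \<noteq> {}" using N by auto
  have A: "finite (verts H1)" "D1 \<subseteq> verts H1 \<times> verts H1" "asym D1"
    "finite (verts H2)" "D2 \<subseteq> verts H2 \<times> verts H2" "asym D2"
    using H1 H2 D1 D2 by (auto simp: finite_graph_def orientation_def)
  have G: "finite_graph (?G E)" if "E \<in> ?P" for E
    using that V by (auto simp: finite_graph_def)
  have \<omega>: "\<And>E. E \<in> ?P \<Longrightarrow> 0 \<le> ?\<omega> E" "(\<Sum>E\<in>?P. ?\<omega> E) = 1"
    using mean_sample_prob_nonneg [OF V W'] sum_mean_sample_prob [OF V W'] by auto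
  define \<epsilon>1 where "\<epsilon>1 = (real (card (verts H1)))\<^sup>2 / real N"
  define \<epsilon>2 where "\<epsilon>2 = (real (card (verts H2)))\<^sup>2 / real N + real (card D2) / real N"
  have s1: "(\<Sum>E\<in>?P. ?\<omega> E * hom_density H1 (?G E)) \<le> graphon_density H1 W + \<epsilon>1"
  proof -
    have "(\<Sum>E\<in>?P. ?\<omega> E * hom_density H1 (?G E)) =
        (\<Sum>E\<in>?P. ?\<omega> E * wdens (verts H1) D1 ?V (unif ?V) (\<lambda>s t. toggle False (adj (?G E) s t)))"
      using hom_density_eq_wdens [OF H1 G D1] by (intro sum.cong) (simp_all add: toggle_def)
    then show ?thesis
      using sum_mean_sample_prob_wdens_le [OF V W' A(1-3), of False] by (simp add: t1 \<epsilon>1_def)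
  qed
  have s2: "(\<Sum>E\<in>?P. ?\<omega> E * hom_density H2 (complement (?G E))) \<le> graphon_density H2 (\<lambda>z. 1 - W z) + \<epsilon>2"
  proof -
    let ?w = "\<lambda>E. wdens (verts H2) D2 ?V (unif ?V) (\<lambda>s t. toggle True (adj (?G E) s t))"
    have "(\<Sum>E\<in>?P. ?\<omega> E * hom_density H2 (complement (?G E))) \<le>
        (\<Sum>E\<in>?P. ?\<omega> E * (?w E + real (card D2) / real N))"
    proof (intro sum_mono mult_left_mono)
      fix E assume E: "E \<in> ?P"
      show "hom_density H2 (complement (?G E)) \<le> ?w E + real (card D2) / real N"
        using hom_density_complement_approx [OF H2 G [OF E] D2] by (simp add: toggle_def abs_le_iff)
    qed (rule \<omega>(1))
    also have "\<dots> = (\<Sum>E\<in>?P. ?\<omega> E * ?w E) + real (card D2) / real N"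
      unfolding distrib_left sum.distrib sum_distrib_right [symmetric] \<omega>(2) by simp
    also have "\<dots> \<le> graphon_density H2 (\<lambda>z. 1 - W z) + \<epsilon>2"
      using sum_mean_sample_prob_wdens_le [OF V W' A(4-6), of True] by (simp add: t2 \<epsilon>2_def)
    finally show ?thesis .
  qed
  obtain E where E: "E \<in> ?P" "val l (hom_density H1 (?G E), hom_density H2 (complement (?G E))) \<le>
      (\<Sum>E\<in>?P. ?\<omega> E * val l (hom_density H1 (?G E), hom_density H2 (complement (?G E))))"
    by (rule weighted_average_witness [of ?P ?\<omega>
          "\<lambda>E. val l (hom_density H1 (?G E), hom_density H2 (complement (?G E)))"])
       (use \<omega> finite_all_pairs [OF V(1)] in auto)
  note E(2)
  also have "(\<Sum>E\<in>?P. ?\<omega> E * val l (hom_density H1 (?G E), hom_density H2 (complement (?G E)))) =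
      l * (\<Sum>E\<in>?P. ?\<omega> E * hom_density H1 (?G E)) + (2 - l) * (\<Sum>E\<in>?P. ?\<omega> E * hom_density H2 (complement (?G E)))"
    unfolding val_def fst_conv snd_conv distrib_left sum.distrib sum_distrib_left by (simp only: mult.left_commute)
  also have "\<dots> \<le> l * (graphon_density H1 W + \<epsilon>1) + (2 - l) * (graphon_density H2 (\<lambda>z. 1 - W z) + \<epsilon>2)"
    using s1 s2 l by (intro add_mono mult_left_mono) auto
  also have "\<dots> = val l (graphon_density H1 W, graphon_density H2 (\<lambda>z. 1 - W z)) + (l * \<epsilon>1 + (2 - l) * \<epsilon>2)"
    by (simp add: val_def algebra_simps)
  also have "\<dots> \<le> val l (graphon_density H1 W, graphon_density H2 (\<lambda>z. 1 - W z)) + (2 * \<epsilon>1 + 2 * \<epsilon>2)"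
    using l by (intro add_mono order_refl mult_right_mono) (auto simp: \<epsilon>1_def \<epsilon>2_def)
  also have "2 * \<epsilon>1 + 2 * \<epsilon>2 = 2 * ((real (card (verts H1)))\<^sup>2 + (real (card (verts H2)))\<^sup>2 + real (card D2)) / real N"
    by (simp add: \<epsilon>1_def \<epsilon>2_def add_divide_distrib distrib_left)
  finally show thesis using G [OF E(1)] by (intro that [of "?G E"]) auto
qed

lemma c_lambda_le_graphon:
  assumes G: "enumerates_graphs G" and H1: "finite_graph H1" and H2: "finite_graph H2"
    and W: "graphon W" and l: "0 \<le> l" "l \<le> 2"
  shows "c_lambda G l H1 H2 \<le> ereal (val l (graphon_density H1 W, graphon_density H2 (\<lambda>z. 1 - W z)))"
    (is "_ \<le> ereal ?v")
proof (rule ccontr)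
  assume "\<not> ?thesis"
  then have "ereal ?v < c_lambda G l H1 H2" by simp
  then obtain b where b: "ereal ?v < ereal b" "ereal b < c_lambda G l H1 H2"
    using ereal_dense2 by blast
  define z where "z n = (hom_density H1 (G n), hom_density H2 (complement (G n)))" for n
  have "c_lambda G l H1 H2 = liminf (\<lambda>n. ereal (val l (z n)))"
    by (simp add: c_lambda_def val_def z_def)
  then have "eventually (\<lambda>n. ereal b < ereal (val l (z n))) sequentially"
    using b(2) by (intro less_LiminfD) simp
  then obtain n0 where n0: "\<And>n. n \<ge> n0 \<Longrightarrow> b < val l (z n)"
    by (auto simp: eventually_sequentially)
  obtain D1 D2 where D1: "orientation H1 D1" and D2: "orientation H2 D2"
    using orientation_exists [OF H1] orientation_exists [OF H2] by metis
  define C where "C = 2 * ((real (card (verts H1)))\<^sup>2 + (real (card (verts H2)))\<^sup>2 + real (card D2))"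
  obtain N1 where N1: "C / (b - ?v) < real N1" using reals_Archimedean2 by blast
  \<comment> \<open>Exceeding the orders of the first \<open>n0\<close> graphs forces the sampled
    graph to occur at an index from \<open>n0\<close> on; exceeding \<open>N1\<close> makes its
    error smaller than the gap.\<close>
  define N where "N = Suc (N1 + (\<Sum>n<n0. card (verts (G n))))"
  have "real N1 \<le> real N" by (simp add: N_def del: of_nat_Suc)
  with N1 have "C / (b - ?v) < real N" by simp
  then have CN: "C / real N < b - ?v"
  proof -
    have "0 < N" by (simp add: N_def)
    then have "0 < real N" by (simp only: of_nat_0_less_iff)
    moreover have "0 < b - ?v" using b(1) by simp
    ultimately show ?thesis using \<open>C / (b - ?v) < real N\<close> by (simp only: pos_divide_less_eq mult.commute)
  qed
  obtain F :: "nat ugraph" where F: "finite_graph F" "card (verts F) = N"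
    "val l (hom_density H1 F, hom_density H2 (complement F)) \<le> ?v + C / real N"
    using exists_sampled_graph [OF H1 D1 H2 D2 W _ l, of N] by (auto simp: N_def C_def)
  obtain n where n: "isomorphic F (G n)" and Gn: "finite_graph (G n)"
    using G F(1) by (auto simp: enumerates_graphs_def)
  have "card (verts (G n)) = N"
    using n F(2) by (auto simp: isomorphic_def dest: bij_betw_same_card)
  moreover have "card (verts (G n)) < N" if "n < n0"
    using member_le_sum [of n "{..<n0}" "\<lambda>n. card (verts (G n))"] that by (simp add: N_def)
  ultimately have "n \<ge> n0" by (meson less_irrefl not_le)
  from n0 [OF this] have "b < val l (hom_density H1 F, hom_density H2 (complement F))"
    using hom_density_isomorphic [OF H1 F(1) Gn n]
      hom_density_isomorphic [OF H2 finite_graph_complement [OF F(1)] finite_graph_complement [OF Gn] isomorphic_complement [OF n]]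
    by (simp add: z_def)
  then show False using F(3) CN by simp
qed


section \<open>Cluster points and minimisers\<close>

definition cluster_points :: "(nat \<Rightarrow> 'a::metric_space) \<Rightarrow> 'a set" where
  "cluster_points z = (\<Inter>N. closure (z ` {N..}))"

text \<open>Defined as an intersection of closures, the set of cluster points is evidently closed;
  this supplies the description by subsequences.\<close>

lemma cluster_point_subseq:
  assumes "q \<in> cluster_points z"
  obtains r where "strict_mono r" "(z \<circ> r) \<longlonglongrightarrow> q"
proof -
  have near: "\<exists>n\<ge>N. dist (z n) q < e" if e: "e > 0" for N e
  proof -
    have "q \<in> closure (z ` {N..})" using assms unfolding cluster_points_def by (rule INT_D) simp
    then obtain y where "y \<in> z ` {N..}" "dist y q < e" using e unfolding closure_approachable by blast
    then show ?thesis by blast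
  qed
  have "\<exists>r. \<forall>k. dist (z (r k)) q < 1 / real (Suc k) \<and> r k < r (Suc k)"
  proof (rule dependent_nat_choice)
    show "\<exists>n. dist (z n) q < 1 / real (Suc 0)" using near [of 1 0] by auto
    fix n k
    show "\<exists>n'. dist (z n') q < 1 / real (Suc (Suc k)) \<and> n < n'"
      using near [of "1 / real (Suc (Suc k))" "Suc n"] by (auto simp: Suc_le_eq)
  qed
  then obtain r where r: "\<And>k. dist (z (r k)) q < 1 / real (Suc k)" "\<And>k. r k < r (Suc k)" by blast
  have "(\<lambda>k. dist (z (r k)) q) \<longlonglongrightarrow> 0"
  proof (rule Lim_null_comparison [OF _ LIMSEQ_Suc [OF lim_1_over_n]], intro always_eventually allI)
    show "norm (dist (z (r k)) q) \<le> 1 / real (Suc k)" for k using r(1) [of k] by simp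
  qed
  then have "(z \<circ> r) \<longlonglongrightarrow> q" by (simp add: tendsto_dist_iff [of _ q] o_def)
  moreover have "strict_mono r" unfolding strict_mono_Suc_iff using r(2) by blast
  ultimately show thesis by (intro that)
qed

lemma subseq_cluster_point:
  assumes "strict_mono r" "(z \<circ> r) \<longlonglongrightarrow> q"
  shows "q \<in> cluster_points z"
  unfolding cluster_points_def
proof (rule INT_I)
  fix N
  have "(\<lambda>k. (z \<circ> r) (k + N)) \<longlonglongrightarrow> q" using assms(2) by (rule LIMSEQ_ignore_initial_segment)
  moreover have "(z \<circ> r) (k + N) \<in> z ` {N..}" for k
    using seq_suble [OF assms(1), of "k + N"] by auto
  ultimately show "q \<in> closure (z ` {N..})" unfolding closure_sequential
    by (intro exI [of _ "\<lambda>k. (z \<circ> r) (k + N)"] conjI allI)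
qed

lemma compact_cluster_points:
  fixes z :: "nat \<Rightarrow> real \<times> real"
  assumes "\<And>n. z n \<in> {0..1} \<times> {0..1}"
  shows "compact (cluster_points z)"
proof -
  have "cluster_points z \<subseteq> closure (z ` {0..})" unfolding cluster_points_def by (rule INT_lower) simp
  also have "\<dots> \<subseteq> {0..1} \<times> {0..1}" by (intro closure_minimal closed_Times image_subsetI assms) auto
  finally have "cluster_points z \<inter> ({0..1} \<times> {0..1}) = cluster_points z" by blast
  moreover have "closed (cluster_points z)" unfolding cluster_points_def by (intro closed_INT) simp
  ultimately show ?thesis by (metis closed_Int_compact compact_Icc compact_Times)
qed

text \<open>Pass to a subsequence along which the values tend to their limit inferior, then to one
  along which the points converge as well.\<close>

lemma liminf_val_attained:
  fixes z :: "nat \<Rightarrow> real \<times> real"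
  assumes z: "\<And>n. z n \<in> {0..1} \<times> {0..1}"
  obtains q where "q \<in> cluster_points z" "liminf (\<lambda>n. ereal (val l (z n))) = ereal (val l q)"
proof -
  obtain r where r: "strict_mono r" "((\<lambda>n. ereal (val l (z n))) \<circ> r) \<longlonglongrightarrow> liminf (\<lambda>n. ereal (val l (z n)))"
    using liminf_subseq_lim by blast
  have "seq_compact ({0..1} \<times> {0..1} :: (real \<times> real) set)"
    by (intro compact_imp_seq_compact compact_Times compact_Icc)
  then obtain q s where s: "strict_mono s" "((z \<circ> r) \<circ> s) \<longlonglongrightarrow> q"
    by (rule seq_compactE [of _ "z \<circ> r"]) (use z in auto)
  have "(\<lambda>n. val l ((z \<circ> r \<circ> s) n)) \<longlonglongrightarrow> val l q"
    unfolding val_def by (intro tendsto_intros s(2))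
  then have "(\<lambda>n. ereal (val l ((z \<circ> r \<circ> s) n))) \<longlonglongrightarrow> ereal (val l q)" by simp
  moreover have "(\<lambda>n. ereal (val l ((z \<circ> r \<circ> s) n))) \<longlonglongrightarrow> liminf (\<lambda>n. ereal (val l (z n)))"
    using LIMSEQ_subseq_LIMSEQ [OF r(2) s(1)] by (simp add: o_def)
  ultimately have "liminf (\<lambda>n. ereal (val l (z n))) = ereal (val l q)" by (rule LIMSEQ_unique [THEN sym])
  moreover have "q \<in> cluster_points z"
    using s(2) by (intro subseq_cluster_point [OF strict_mono_o [OF r(1) s(1)]]) (simp add: o_assoc)
  ultimately show thesis by (intro that)
qed

text \<open>A minimiser at a parameter \<open>\<mu>\<close> slightly beside \<open>l\<close>, where the value is no larger than at \<open>l\<close>,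
  lies on the side of the diagonal determined by the sign of \<open>l - \<mu>\<close>.\<close>

lemma one_sided_minimiser:
  assumes Q: "compact Q" "Q \<subseteq> {0..1} \<times> {0..1}" and \<sigma>: "\<sigma> \<in> {1, -1}"
    and ge: "\<And>q. q \<in> Q \<Longrightarrow> \<alpha> \<le> val l q"
    and le: "\<And>e. e > 0 \<Longrightarrow> \<exists>\<mu> q. \<bar>l - \<mu>\<bar> < e \<and> 0 < \<sigma> * (l - \<mu>) \<and> q \<in> Q \<and> val \<mu> q \<le> \<alpha>"
  obtains q where "q \<in> Q" "0 \<le> \<sigma> * (fst q - snd q)" "val l q \<le> \<alpha>"
proof -
  \<comment> \<open>The part of \<open>Q\<close> on the required side is compact, so points in it of
    value at most \<open>\<alpha> + e\<close> for every \<open>e\<close> are enough.\<close>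
  define S where "S = Q \<inter> {q. 0 \<le> \<sigma> * (fst q - snd q)}"
  have cont: "continuous_on UNIV (\<lambda>q. \<sigma> * (fst q - snd q))" "continuous_on S (val l)"
    unfolding val_def [abs_def] by (intro continuous_intros)+
  have "closed {q. 0 \<le> \<sigma> * (fst q - snd q)}"
    using cont(1) by (intro closed_Collect_le continuous_intros)
  then have S: "compact S" unfolding S_def by (rule compact_Int_closed [OF Q(1)])
  have approx: "\<exists>q\<in>S. val l q \<le> \<alpha> + e" if e: "e > 0" for e
  proof -
    obtain \<mu> q where q: "\<bar>l - \<mu>\<bar> < e" "0 < \<sigma> * (l - \<mu>)" "q \<in> Q" "val \<mu> q \<le> \<alpha>" using le [OF e] by blast
    have "0 \<le> (l - \<mu>) * (fst q - snd q)" using ge [OF q(3)] q(4) val_diff [of l q \<mu>] by simp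
    then have "0 \<le> \<sigma> * (fst q - snd q)"
      using q(2) \<sigma> by (auto simp: zero_le_mult_iff)
    then have "q \<in> S" using q(3) by (simp add: S_def)
    have "\<bar>fst q - snd q\<bar> \<le> 1" using q(3) Q(2) by (cases q) (auto simp: abs_le_iff)
    then have "\<bar>l - \<mu>\<bar> * \<bar>fst q - snd q\<bar> \<le> \<bar>l - \<mu>\<bar>" by (simp add: mult_left_le)
    then have "val l q \<le> val \<mu> q + e" using val_diff [of l q \<mu>] q(1) by (simp add: abs_mult [symmetric])
    then show ?thesis using \<open>q \<in> S\<close> q(4) by (intro bexI [of _ q]) auto
  qed
  then have "S \<noteq> {}" using zero_less_one by blast
  from continuous_attains_inf [OF S this cont(2)]
  obtain q where q: "q \<in> S" "\<And>y. y \<in> S \<Longrightarrow> val l q \<le> val l y" by blast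
  have "val l q \<le> \<alpha> + e" if "e > 0" for e using approx [OF that] q(2) by force
  then have "val l q \<le> \<alpha>" by (rule field_le_epsilon)
  with q(1) show thesis by (intro that) (auto simp: S_def)
qed

text \<open>The first value depends on having an edge, since an empty product would be 1. It
  supplies graphons of value 0 at the ends of the parameter interval.\<close>

lemma graphon_density_const:
  assumes H: "finite_graph H" "edges H \<noteq> {}"
  shows "graphon_density H (\<lambda>_. 0) = 0" "graphon_density H (\<lambda>_. 1) = 1"
proof -
  obtain D where D: "orientation H D" using orientation_exists [OF H(1)] by blast
  then have "D \<noteq> {}" using H(2) by (auto simp: orientation_def bij_betw_def)
  moreover have "finite D"
    using D H(1) by (auto simp: orientation_def finite_graph_def intro: finite_subset)
  ultimately have zero: "edge_prod D (\<lambda>_ _. 0) x = 0" for x :: "'a \<Rightarrow> real"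
    by (auto simp: edge_prod_def case_prod_unfold prod_zero_iff)
  interpret P: prob_space "\<Pi>\<^sub>M v\<in>verts H. unit_measure"
    by (intro prob_space_PiM prob_space_unit_measure)
  have "graphon_density H (\<lambda>_. c) = pdens (verts H) D (\<lambda>_. c)" for c
    by (rule graphon_density_eq_pdens [OF H(1) D]) auto
  then show "graphon_density H (\<lambda>_. 0) = 0" "graphon_density H (\<lambda>_. 1) = 1"
    by (simp_all add: pdens_def zero) (simp add: edge_prod_def case_prod_unfold P.prob_space)
qed

lemma graphon_const: "0 \<le> c \<Longrightarrow> c \<le> 1 \<Longrightarrow> graphon (\<lambda>_. c)"
  by (simp add: graphon_def)

theorem theorem3p2:
  fixes G :: "nat \<Rightarrow> nat ugraph"
    and H1 :: "'a ugraph" and H2 :: "'b ugraph"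
  assumes "enumerates_graphs G"
    and "finite_graph H1" and "edges H1 \<noteq> {}"
    and "finite_graph H2" and "edges H2 \<noteq> {}"
  shows "\<exists>m :: real. c_const G H1 H2 = ereal m \<and>
           (\<exists>W1 W2. certificate m H1 H2 W1 W2) \<and>
           (\<forall>\<alpha>. (\<exists>W1 W2. certificate \<alpha> H1 H2 W1 W2) \<longrightarrow> m \<le> \<alpha>)"
proof -
  note G = assms(1) and H1 = assms(2) and H2 = assms(4)
  define z where "z n = (hom_density H1 (G n), hom_density H2 (complement (G n)))" for n
  define pt where "pt W = (graphon_density H1 W, graphon_density H2 (\<lambda>p. 1 - W p))" for W
  have z: "z n \<in> {0..1} \<times> {0..1}" for n
    by (simp add: z_def hom_density_def)
  note Q = compact_cluster_points [of z, OF z]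
  have Q01: "cluster_points z \<subseteq> {0..1} \<times> {0..1}"
  proof
    fix q assume "q \<in> cluster_points z"
    then obtain r where lim: "(z \<circ> r) \<longlonglongrightarrow> q" by (rule cluster_point_subseq)
    have closed: "closed ({0..1} \<times> {0..1} :: (real \<times> real) set)" by (intro closed_Times closed_atLeastAtMost)
    show "q \<in> {0..1} \<times> {0..1}"
      by (rule closed_sequentially [OF closed _ lim]) (unfold comp_apply, rule z)
  qed
  have graphon_of: "\<exists>W. graphon W \<and> pt W = q" if q: "q \<in> cluster_points z" for q
  proof -
    obtain r where r: "strict_mono r" "(z \<circ> r) \<longlonglongrightarrow> q" using cluster_point_subseq [OF q] .
    have fin: "finite_graph (G (r n))" for n using G by (simp add: enumerates_graphs_def)
    have card: "filterlim (\<lambda>n. card (verts (G (r n)))) at_top sequentially"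
      by (rule filterlim_compose [OF card_verts_filterlim [OF G] filterlim_subseq [OF r(1)]])
    have "(\<lambda>n. hom_density H1 (G (r n))) \<longlonglongrightarrow> fst q" "(\<lambda>n. hom_density H2 (complement (G (r n)))) \<longlonglongrightarrow> snd q"
      using tendsto_fst [OF r(2)] tendsto_snd [OF r(2)] by (simp_all add: z_def o_def)
    from graphon_of_hom_density_limit [OF fin card H1 H2 this]
    obtain W where "graphon W" "graphon_density H1 W = fst q" "graphon_density H2 (\<lambda>p. 1 - W p) = snd q"
      by blast
    then show ?thesis by (intro exI [of _ W]) (simp add: pt_def)
  qed
  have "\<forall>l. \<exists>q. q \<in> cluster_points z \<and> c_lambda G l H1 H2 = ereal (val l q)"
  proof
    fix l
    have "c_lambda G l H1 H2 = liminf (\<lambda>n. ereal (val l (z n)))"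
      by (simp add: c_lambda_def val_def z_def)
    then show "\<exists>q. q \<in> cluster_points z \<and> c_lambda G l H1 H2 = ereal (val l q)"
      using liminf_val_attained [of z l, OF z] by metis
  qed
  from choice [OF this] obtain q where q: "\<And>l. q l \<in> cluster_points z"
    and c: "\<And>l. c_lambda G l H1 H2 = ereal (val l (q l))" by blast
  define m where "m l = val l (q l)" for l
  have le_graphon: "m l \<le> val l (pt W)" if "graphon W" "l \<in> {0..2}" for l W
    using c_lambda_le_graphon [OF G H1 H2 that(1), of l] that(2) by (simp add: c m_def pt_def)
  \<comment> \<open>A cluster point is the density pair of a graphon, so the sampling bound covers
    it and makes \<open>m l\<close> a minimum over cluster points.\<close>
  have le_cluster: "m l \<le> val l p" if "p \<in> cluster_points z" "l \<in> {0..2}" for l p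
    using graphon_of [OF that(1)] le_graphon that(2) by blast
  \<comment> \<open>Test the minimum at \<open>l\<close> with the minimiser at \<open>\<mu>\<close>;
    its slope is a difference of two numbers in the unit interval.\<close>
  have Lipschitz: "m l - m \<mu> \<le> \<bar>l - \<mu>\<bar>" if "l \<in> {0..2}" for l \<mu>
  proof -
    have "m l - m \<mu> \<le> (l - \<mu>) * (fst (q \<mu>) - snd (q \<mu>))"
      using le_cluster [OF q that, of \<mu>] by (simp add: m_def val_diff [symmetric])
    also have "\<dots> \<le> \<bar>l - \<mu>\<bar> * \<bar>fst (q \<mu>) - snd (q \<mu>)\<bar>" by (simp add: abs_mult [symmetric])
    also have "\<dots> \<le> \<bar>l - \<mu>\<bar>"
      using subsetD [OF Q01 q [of \<mu>]] by (intro mult_left_le) (auto simp: mem_Times_iff abs_le_iff)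
    finally show ?thesis .
  qed
  have "continuous_on {0..2} m"
  proof (rule continuous_onI)
    fix l e :: real assume l: "l \<in> {0..2}" "e > 0"
    have "dist (m l') (m l) \<le> e" if "l' \<in> {0..2}" "dist l' l < e" for l'
    proof -
      have "m l' - m l \<le> \<bar>l' - l\<bar>" "m l - m l' \<le> \<bar>l' - l\<bar>"
        using Lipschitz [OF that(1), of l] Lipschitz [OF l(1), of l'] by (simp_all only: abs_minus_commute)
      then show ?thesis using that(2) unfolding dist_real_def by linarith
    qed
    with l(2) show "\<exists>d>0. \<forall>l'\<in>{0..2}. dist l' l < d \<longrightarrow> dist (m l') (m l) \<le> e" by blast
  qed
  then obtain l0 where l0: "l0 \<in> {0..2}" and max: "\<And>l. l \<in> {0..2} \<Longrightarrow> m l \<le> m l0"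
    using continuous_attains_sup [of "{0..2 :: real}" m] by auto
  have "c_const G H1 H2 = ereal (m l0)"
    unfolding c_const_def
  proof (rule antisym)
    show "(SUP l\<in>{0..2}. c_lambda G l H1 H2) \<le> ereal (m l0)"
      by (rule SUP_least) (use max in \<open>simp add: c m_def\<close>)
    show "ereal (m l0) \<le> (SUP l\<in>{0..2}. c_lambda G l H1 H2)"
      by (rule SUP_upper2 [OF l0]) (simp add: c m_def)
  qed
  moreover have "\<exists>W1 W2. certificate (m l0) H1 H2 W1 W2"
  proof -
    have nonneg: "0 \<le> m l0"
      using subsetD [OF Q01 q [of l0]] l0 by (auto simp: m_def val_def mem_Times_iff)
    have one_side: "\<exists>W. graphon W \<and> val l0 (pt W) \<le> m l0 \<and> 0 \<le> \<sigma> * (fst (pt W) - snd (pt W))"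
      if \<sigma>: "\<sigma> \<in> {1, -1}"
        and near: "\<And>e. e > 0 \<Longrightarrow> \<exists>\<mu>\<in>{0..2}. \<bar>l0 - \<mu>\<bar> < e \<and> 0 < \<sigma> * (l0 - \<mu>)" for \<sigma> :: real
    proof -
      obtain p where p: "p \<in> cluster_points z" "0 \<le> \<sigma> * (fst p - snd p)" "val l0 p \<le> m l0"
      proof (rule one_sided_minimiser [OF Q Q01 \<sigma>])
        show "m l0 \<le> val l0 p" if "p \<in> cluster_points z" for p
          using le_cluster [OF that l0] .
        fix e :: real assume "e > 0"
        with near obtain \<mu> where "\<mu> \<in> {0..2}" "\<bar>l0 - \<mu>\<bar> < e" "0 < \<sigma> * (l0 - \<mu>)" by blast
        moreover have "val \<mu> (q \<mu>) \<le> m l0" using max [OF \<open>\<mu> \<in> {0..2}\<close>] by (simp add: m_def)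
        ultimately show "\<exists>\<mu> p. \<bar>l0 - \<mu>\<bar> < e \<and> 0 < \<sigma> * (l0 - \<mu>) \<and> p \<in> cluster_points z \<and> val \<mu> p \<le> m l0"
          using q [of \<mu>] by blast
      qed
      then show ?thesis using graphon_of [OF p(1)] by auto
    qed
    \<comment> \<open>Condition (iii) comes from parameters below \<open>l0\<close>. For
      \<open>l0 = 0\<close> there are none, and the constant graphon 1 has the pair (1, 0), hence
      value 0, which is at most \<open>m l0\<close>.\<close>
    have "\<exists>W. graphon W \<and> val l0 (pt W) \<le> m l0 \<and> 0 \<le> 1 * (fst (pt W) - snd (pt W))"
    proof (cases "l0 = 0")
      case True
      then show ?thesis
        using nonneg graphon_const [of 1] graphon_density_const [OF H1 assms(3)] graphon_density_const [OF H2 assms(5)]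
        by (intro exI [of _ "\<lambda>_. 1"]) (simp add: pt_def val_def)
    next
      case False
      show ?thesis
      proof (rule one_side)
        show "\<exists>\<mu>\<in>{0..2}. \<bar>l0 - \<mu>\<bar> < e \<and> 0 < 1 * (l0 - \<mu>)" if "e > 0" for e
          using that l0 False by (intro bexI [of _ "max 0 (l0 - e / 2)"]) (auto simp: max_def)
      qed simp
    qed
    \<comment> \<open>Condition (iv) comes from parameters above \<open>l0\<close>. For
      \<open>l0 = 2\<close> the constant graphon 0, with the pair (0, 1), takes over.\<close>
    moreover have "\<exists>W. graphon W \<and> val l0 (pt W) \<le> m l0 \<and> 0 \<le> -1 * (fst (pt W) - snd (pt W))"
    proof (cases "l0 = 2")
      case True
      then show ?thesis
        using nonneg graphon_const [of 0] graphon_density_const [OF H1 assms(3)] graphon_density_const [OF H2 assms(5)]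
        by (intro exI [of _ "\<lambda>_. 0"]) (simp add: pt_def val_def)
    next
      case False
      show ?thesis
      proof (rule one_side)
        show "\<exists>\<mu>\<in>{0..2}. \<bar>l0 - \<mu>\<bar> < e \<and> 0 < -1 * (l0 - \<mu>)" if "e > 0" for e
          using that l0 False by (intro bexI [of _ "min 2 (l0 + e / 2)"]) (auto simp: min_def)
      qed simp
    qed
    ultimately obtain W1 W2 where "graphon W1" "val l0 (pt W1) \<le> m l0" "0 \<le> 1 * (fst (pt W1) - snd (pt W1))"
      "graphon W2" "val l0 (pt W2) \<le> m l0" "0 \<le> -1 * (fst (pt W2) - snd (pt W2))" by blast
    then have "certificate (m l0) H1 H2 W1 W2"
      unfolding certificate_def by (auto simp: pt_def val_def intro!: bexI [OF _ l0])
    then show ?thesis by blast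
  qed
  moreover have "m l0 \<le> \<alpha>" if "certificate \<alpha> H1 H2 W1 W2" for \<alpha> W1 W2
  proof -
    obtain l where l: "val l (pt W1) \<le> \<alpha>" "val l (pt W2) \<le> \<alpha>"
      "snd (pt W1) \<le> fst (pt W1)" "fst (pt W2) \<le> snd (pt W2)" and W: "graphon W1" "graphon W2"
      using \<open>certificate \<alpha> H1 H2 W1 W2\<close> by (auto simp: certificate_def pt_def val_def)
    show ?thesis
    proof (cases "l \<le> l0")
      case True
      have "m l0 \<le> val l (pt W2) + (l0 - l) * (fst (pt W2) - snd (pt W2))"
        using le_graphon [OF W(2) l0] val_diff [of l0 "pt W2" l] by simp
      also have "\<dots> \<le> \<alpha>" using True l mult_nonneg_nonpos [of "l0 - l" "fst (pt W2) - snd (pt W2)"] by simp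
      finally show ?thesis .
    next
      case False
      have "m l0 \<le> val l (pt W1) + (l0 - l) * (fst (pt W1) - snd (pt W1))"
        using le_graphon [OF W(1) l0] val_diff [of l0 "pt W1" l] by simp
      also have "\<dots> \<le> \<alpha>" using False l mult_nonpos_nonneg [of "l0 - l" "fst (pt W1) - snd (pt W1)"] by simp
      finally show ?thesis .
    qed
  qed
  ultimately show ?thesis by blast
qed

end
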